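(* Let $\overline{\mathfrak{so}(n)}$ be the Lax operator algebra over $\mathfrak{so}(n)$ with Tyurin parameters $\{(\alpha_s,\gamma_s)\}$. Let $\mathcal{L}$ be a meromorphic skew-symmetric matrix-valued (i.e. $\mathfrak{so}(n)$-valued) 1-form on $\Gamma$, holomorphic outside $P_\pm$ and the points $\gamma_s$, such that at every $\gamma_s$ (with local coordinate $z$ vanishing at $\gamma_s$) $$\mathcal{L}=\mathcal{L}_{-1}\frac{dz}{z}+\mathcal{L}_0\,dz+\ldots,\qquad \mathcal{L}_{-1}=\alpha_s\tilde\beta_s^t-\tilde\beta_s\alpha_s^t,\quad \tilde\beta_s^t\alpha_s=1,\quad \mathcal{L}_0\alpha_s=\tilde k_s\alpha_s$$ for some $\tilde\beta_s\in\mathbb{C}^n$ and $\tilde k_s\in\mathbb{C}$. Then for all $L,L'\in\overline{\mathfrak{so}(n)}$ the 1-form $\operatorname{tr}(L\,dL'-[L,L']\mathcal{L})$ is regular except at the points $P_\pm$, and the expression $$\gamma(L,L')=\operatorname{res}_{P_+}\operatorname{tr}(L\,dL'-[L,L']\mathcal{L})$$ gives a local 2-cocycle on the Lax operator algebra $\overline{\mathfrak{so}(n)}$.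
   Context: $\Gamma$ is a compact Riemann surface of genus $g$ with two distinct marked points $P_+,P_-$. Fix further distinct points $\gamma_s\in\Gamma\setminus\{P_+,P_-\}$, $s=1,\ldots,ng$ (weak singularities), and nonzero vectors $\alpha_s\in\mathbb{C}^n$ with $\alpha_s^t\alpha_s=0$ (Tyurin parameters). $\mathfrak{so}(n)$ is the Lie algebra of complex skew-symmetric $n\times n$ matrices. The Lax operator algebra $\overline{\mathfrak{so}(n)}$ is the Lie algebra, under pointwise bracket, of meromorphic functions $L:\Gamma\to\mathfrak{so}(n)$, holomorphic outside $P_\pm$ and the $\gamma_s$ (arbitrary finite-order poles at $P_\pm$), such that at every $\gamma_s$ one has $L=L_{-1}z^{-1}+L_0+O(z)$ with $L_{-1}=\alpha_s\beta^t-\beta\alpha_s^t$ for some $\beta\in\mathbb{C}^n$ with $\beta^t\alpha_s=0$, and $L_0\alpha_s=k\alpha_s$ for some $k\in\mathbb{C}$ ($\beta,k$ depend on $L$ and $s$). Homogeneous subspaces: $\mathfrak{g}_m$ ($m\in\mathbb{Z}$) consists of $L\in\overline{\mathfrak{so}(n)}$ of order at least $m$ at $P_+$ and at least $-m-g$ at $P_-$ (and at most simple poles at the $\gamma_s$). A 2-cocycle on a Lie algebra is an antisymmetric bilinear form $\chi$ with $\chi([X,Y],Z)+\chi([Y,Z],X)+\chi([Z,X],Y)=0$. A cocycle $\chi$ is local if there are constants $\mu',\mu''$ such that $\chi(\mathfrak{g}_m,\mathfrak{g}_{m'})=0$ unless $\mu'\le m+m'\le\mu''$. *)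

theory Defs
  imports "HOL-Complex_Analysis.Complex_Analysis" "HOL-Homology.Homology"
    "HOL-Algebra.Free_Abelian_Groups"
begin

section \<open>Riemann surfaces, meromorphic functions and 1-forms\<close>

text \<open>A chart is a pair of a domain and a complex coordinate on it.\<close>

type_synonym 'a chart = "'a set \<times> ('a \<Rightarrow> complex)"

text \<open>The local expression of a function in a chart; only its values on the image of the
  domain of the chart are meaningful.\<close>

definition in_chart :: "'a chart \<Rightarrow> ('a \<Rightarrow> 'b) \<Rightarrow> complex \<Rightarrow> 'b" where
  "in_chart c f z = f (inv_into (fst c) (snd c) z)"

definition riemann_surface :: "'a topology \<Rightarrow> 'a chart set \<Rightarrow> bool" where
  "riemann_surface X A \<longleftrightarrow>
     Hausdorff_space X \<and> connected_space X \<and>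
     (\<Union>c\<in>A. fst c) = topspace X \<and>
     (\<forall>c\<in>A. openin X (fst c) \<and> open (snd c ` fst c) \<and>
        homeomorphic_map (subtopology X (fst c)) (top_of_set (snd c ` fst c)) (snd c)) \<and>
     (\<forall>c\<in>A. \<forall>c'\<in>A. in_chart c (snd c') holomorphic_on (snd c ` (fst c \<inter> fst c')))"

text \<open>For a compact Riemann surface \<open>X\<close>, having genus \<open>g\<close> means that the first integral homology
  group is free abelian of rank \<open>2g\<close>.\<close>

definition has_genus :: "'a topology \<Rightarrow> nat \<Rightarrow> bool" where
  "has_genus X g \<longleftrightarrow> homology_group 1 X \<cong> free_Abelian_group {..<2 * g}"

definition charts_at :: "'a chart set \<Rightarrow> 'a \<Rightarrow> 'a chart set" where
  "charts_at A p = {c \<in> A. p \<in> fst c}"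

text \<open>The zero function has order at least \<open>m\<close> for every \<open>m\<close>. The value of \<open>f\<close> at \<open>z0\<close> itself is
  irrelevant, so order at least \<open>0\<close> means holomorphic after removing the singularity.\<close>

definition order_at_least :: "int \<Rightarrow> (complex \<Rightarrow> complex) \<Rightarrow> complex \<Rightarrow> bool" where
  "order_at_least m f z0 \<longleftrightarrow>
     (\<exists>h. h analytic_on {z0} \<and> (\<forall>\<^sub>F z in at z0. f z = (z - z0) powi m * h z))"

definition meromorphic_fun :: "'a chart set \<Rightarrow> 'a set \<Rightarrow> ('a \<Rightarrow> complex) \<Rightarrow> bool" where
  \<comment> \<open>meromorphic on the surface and holomorphic outside the finite set \<open>D\<close>\<close>
  "meromorphic_fun A D f \<longleftrightarrow>
     (\<forall>c\<in>A. in_chart c f holomorphic_on (snd c ` (fst c - D)) \<and>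
            in_chart c f meromorphic_on (snd c ` fst c))"

text \<open>A 1-form \<open>\<omega>\<close> is given by its coefficients: in the chart \<open>c\<close> with coordinate \<open>z = snd c\<close> it
  equals \<open>\<omega> c p dz\<close> at the point \<open>p\<close>. The coefficients in different charts are related by the
  chain rule.\<close>

type_synonym ('a, 'b) form = "'a chart \<Rightarrow> 'a \<Rightarrow> 'b"

definition meromorphic_form :: "'a chart set \<Rightarrow> 'a set \<Rightarrow> ('a, complex) form \<Rightarrow> bool" where
  \<comment> \<open>meromorphic on the surface and holomorphic outside the finite set \<open>D\<close>\<close>
  "meromorphic_form A D \<omega> \<longleftrightarrow>
     (\<forall>c\<in>A. in_chart c (\<omega> c) holomorphic_on (snd c ` (fst c - D)) \<and>
            in_chart c (\<omega> c) meromorphic_on (snd c ` fst c)) \<and>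
     (\<forall>c\<in>A. \<forall>c'\<in>A. \<forall>p\<in>fst c \<inter> fst c' - D.
        \<omega> c p = \<omega> c' p * deriv (in_chart c (snd c')) (snd c p))"

definition form_regular_at :: "'a chart set \<Rightarrow> ('a, complex) form \<Rightarrow> 'a \<Rightarrow> bool" where
  "form_regular_at A \<omega> p \<longleftrightarrow>
     (\<forall>c\<in>charts_at A p. order_at_least 0 (in_chart c (\<omega> c)) (snd c p))"

text \<open>The residue of a meromorphic 1-form does not depend on the chart used to compute it.\<close>

definition form_residue :: "'a chart set \<Rightarrow> ('a, complex) form \<Rightarrow> 'a \<Rightarrow> complex" where
  "form_residue A \<omega> p =
     (let c = (SOME c. c \<in> charts_at A p) in residue (in_chart c (\<omega> c)) (snd c p))"


section \<open>Complex vectors and skew-symmetric matrices\<close>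

text \<open>The bilinear (not Hermitian) product \<open>u\<^sup>t v\<close> and the rank one matrix \<open>u v\<^sup>t\<close>.\<close>

definition bdot :: "complex^'n \<Rightarrow> complex^'n \<Rightarrow> complex" where
  "bdot u v = (\<Sum>i\<in>UNIV. u $ i * v $ i)"

definition outer :: "complex^'n \<Rightarrow> complex^'n \<Rightarrow> complex^'n^'n" where
  "outer u v = (\<chi> i j. u $ i * v $ j)"

definition so :: "(complex^'n^'n) set" where
  "so = {M. transpose M = - M}"

definition lie :: "complex^'n^'n \<Rightarrow> complex^'n^'n \<Rightarrow> complex^'n^'n" where
  "lie M N = M ** N - N ** M"

text \<open>\<open>F(z) = M / (z - z0) + N + O(z - z0)\<close> for a matrix-valued meromorphic germ \<open>F\<close> at \<open>z0\<close>.\<close>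

definition simple_expansion ::
  "(complex \<Rightarrow> complex^'n^'n) \<Rightarrow> complex \<Rightarrow> complex^'n^'n \<Rightarrow> complex^'n^'n \<Rightarrow> bool" where
  "simple_expansion F z0 M N \<longleftrightarrow>
     (\<forall>i j. order_at_least 1 (\<lambda>z. F z $ i $ j - (M $ i $ j / (z - z0) + N $ i $ j)) z0)"


section \<open>Lax operator algebras over \<open>so(n)\<close>\<close>

text \<open>Throughout, \<open>P\<close> and \<open>Q\<close> are the points \<open>P\<^sub>+\<close> and \<open>P\<^sub>-\<close>, and \<open>\<gamma> s\<close>, \<open>\<alpha> s\<close> for \<open>s \<in> S\<close> are the weak
  singularities and Tyurin parameters.

  All elements of the algebra are holomorphic outside the finite set \<open>sing\<close> of \<open>P\<close>, \<open>Q\<close> and the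
  \<open>\<gamma> s\<close>, so they are identified with their restrictions to the complement of this set. These are
  represented by functions vanishing on \<open>sing\<close> (and off the surface); that convention
  makes pointwise operations on representatives the algebra operations, and has no bearing on
  poles or orders, which only involve punctured neighbourhoods.\<close>

definition sing :: "'a \<Rightarrow> 'a \<Rightarrow> nat set \<Rightarrow> (nat \<Rightarrow> 'a) \<Rightarrow> 'a set" where
  "sing P Q S \<gamma> = {P, Q} \<union> \<gamma> ` S"

text \<open>The condition at the weak singularity \<open>p\<close> with Tyurin vector \<open>a\<close>, which does not depend on the
  choice of the local coordinate at \<open>p\<close>.\<close>

definition lax_at ::
  "'a chart set \<Rightarrow> 'a \<Rightarrow> complex^'n \<Rightarrow> ('a \<Rightarrow> complex^'n^'n) \<Rightarrow> bool" where
  "lax_at A p a L \<longleftrightarrow>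
     (\<exists>c\<in>charts_at A p. \<exists>L0 b k.
        simple_expansion (in_chart c L) (snd c p) (outer a b - outer b a) L0 \<and>
        bdot b a = 0 \<and> L0 *v a = k *s a)"

definition lax_so ::
  "'a topology \<Rightarrow> 'a chart set \<Rightarrow> 'a \<Rightarrow> 'a \<Rightarrow> nat set \<Rightarrow> (nat \<Rightarrow> 'a) \<Rightarrow> (nat \<Rightarrow> complex^'n)
     \<Rightarrow> ('a \<Rightarrow> complex^'n^'n) set" where
  "lax_so X A P Q S \<gamma> \<alpha> =
     {L. (\<forall>p. L p \<in> so) \<and>
         (\<forall>p. p \<notin> topspace X - sing P Q S \<gamma> \<longrightarrow> L p = 0) \<and>
         (\<forall>i j. meromorphic_fun A (sing P Q S \<gamma>) (\<lambda>p. L p $ i $ j)) \<and>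
         (\<forall>s\<in>S. lax_at A (\<gamma> s) (\<alpha> s) L)}"

definition fun_order_at_least ::
  "'a chart set \<Rightarrow> int \<Rightarrow> ('a \<Rightarrow> complex^'n^'n) \<Rightarrow> 'a \<Rightarrow> bool" where
  "fun_order_at_least A m L p \<longleftrightarrow>
     (\<exists>c\<in>charts_at A p. \<forall>i j. order_at_least m (in_chart c (\<lambda>q. L q $ i $ j)) (snd c p))"

definition lax_so_deg ::
  "'a topology \<Rightarrow> 'a chart set \<Rightarrow> 'a \<Rightarrow> 'a \<Rightarrow> nat set \<Rightarrow> (nat \<Rightarrow> 'a) \<Rightarrow> (nat \<Rightarrow> complex^'n)
     \<Rightarrow> nat \<Rightarrow> int \<Rightarrow> ('a \<Rightarrow> complex^'n^'n) set" where
  "lax_so_deg X A P Q S \<gamma> \<alpha> g m =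
     {L \<in> lax_so X A P Q S \<gamma> \<alpha>.
        fun_order_at_least A m L P \<and> fun_order_at_least A (- m - int g) L Q}"

text \<open>The additional hypotheses on the 1-form at a weak singularity: here the residue has the shape
  \<open>a b\<^sup>t - b a\<^sup>t\<close> with \<open>b\<^sup>t a = 1\<close> instead of \<open>0\<close>.\<close>

definition lax_form_at ::
  "'a chart set \<Rightarrow> 'a \<Rightarrow> complex^'n \<Rightarrow> ('a, complex^'n^'n) form \<Rightarrow> bool" where
  "lax_form_at A p a \<L> \<longleftrightarrow>
     (\<exists>c\<in>charts_at A p. \<exists>L0 b k.
        simple_expansion (in_chart c (\<L> c)) (snd c p) (outer a b - outer b a) L0 \<and>
        bdot b a = 1 \<and> L0 *v a = k *s a)"

definition so_form :: "'a chart set \<Rightarrow> 'a set \<Rightarrow> ('a, complex^'n^'n) form \<Rightarrow> bool" where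
  \<comment> \<open>\<open>so(n)\<close>-valued meromorphic 1-form, holomorphic outside \<open>D\<close>\<close>
  "so_form A D \<L> \<longleftrightarrow>
     (\<forall>c\<in>A. \<forall>p\<in>fst c - D. \<L> c p \<in> so) \<and>
     (\<forall>i j. meromorphic_form A D (\<lambda>c p. \<L> c p $ i $ j))"

definition differential :: "('a \<Rightarrow> complex^'n^'n) \<Rightarrow> ('a, complex^'n^'n) form" where
  "differential L c p = (\<chi> i j. deriv (in_chart c (\<lambda>q. L q $ i $ j)) (snd c p))"

text \<open>The 1-form \<open>tr(L dL' - [L,L'] \<L>)\<close> and its residue at \<open>P\<close>.\<close>

definition lax_form ::
  "('a, complex^'n^'n) form \<Rightarrow> ('a \<Rightarrow> complex^'n^'n) \<Rightarrow> ('a \<Rightarrow> complex^'n^'n) \<Rightarrow> ('a, complex) form"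
  where
  "lax_form \<L> L L' c p = trace (L p ** differential L' c p - lie (L p) (L' p) ** \<L> c p)"

definition lax_cocycle ::
  "'a chart set \<Rightarrow> 'a \<Rightarrow> ('a, complex^'n^'n) form
     \<Rightarrow> ('a \<Rightarrow> complex^'n^'n) \<Rightarrow> ('a \<Rightarrow> complex^'n^'n) \<Rightarrow> complex" where
  "lax_cocycle A P \<L> L L' = form_residue A (lax_form \<L> L L') P"


section \<open>Local 2-cocycles\<close>

text \<open>Antisymmetric bilinear forms with the cocycle identity on a Lie algebra \<open>V\<close> of matrix-valued
  functions with pointwise operations.\<close>

definition two_cocycle ::
  "('a \<Rightarrow> complex^'n^'n) set
     \<Rightarrow> (('a \<Rightarrow> complex^'n^'n) \<Rightarrow> ('a \<Rightarrow> complex^'n^'n) \<Rightarrow> complex) \<Rightarrow> bool" where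
  "two_cocycle V \<psi> \<longleftrightarrow>
     (\<forall>X\<in>V. \<forall>Y\<in>V. \<psi> Y X = - \<psi> X Y) \<and>
     (\<forall>X\<in>V. \<forall>Y\<in>V. \<forall>Z\<in>V. \<psi> (\<lambda>p. X p + Y p) Z = \<psi> X Z + \<psi> Y Z \<and>
                         \<psi> Z (\<lambda>p. X p + Y p) = \<psi> Z X + \<psi> Z Y) \<and>
     (\<forall>a. \<forall>X\<in>V. \<forall>Y\<in>V. \<psi> (\<lambda>p. map_matrix ((*) a) (X p)) Y = a * \<psi> X Y \<and>
                       \<psi> X (\<lambda>p. map_matrix ((*) a) (Y p)) = a * \<psi> X Y) \<and>
     (\<forall>X\<in>V. \<forall>Y\<in>V. \<forall>Z\<in>V. \<psi> (\<lambda>p. lie (X p) (Y p)) Z + \<psi> (\<lambda>p. lie (Y p) (Z p)) X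
                         + \<psi> (\<lambda>p. lie (Z p) (X p)) Y = 0)"

definition local_form ::
  "(int \<Rightarrow> 'b set) \<Rightarrow> ('b \<Rightarrow> 'b \<Rightarrow> complex) \<Rightarrow> bool" where
  "local_form V \<psi> \<longleftrightarrow>
     (\<exists>\<mu>1 \<mu>2 :: int. \<forall>m m'. \<not> (\<mu>1 \<le> m + m' \<and> m + m' \<le> \<mu>2) \<longrightarrow>
        (\<forall>X\<in>V m. \<forall>Y\<in>V m'. \<psi> X Y = 0))"

end

theory Submission
  imports Defs
begin

text \<open>
  Antisymmetry and the cocycle identity are local at \<open>P\<^sub>+\<close>: since \<open>tr(L dL') + tr(L' dL) = d tr(L L')\<close> and
  \<open>tr([L,L'] dL'') + \<dots> = d tr([L,L'] L'')\<close>, the obstructions are residues of exact forms, while the terms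
  with \<open>\<L>\<close> cancel by the Jacobi identity. Regularity at a weak singularity is a computation with
  principal parts; it rests on \<open>[\<alpha> \<beta>\<^sup>t - \<beta> \<alpha>\<^sup>t, \<alpha> b\<^sup>t - b \<alpha>\<^sup>t] = \<alpha> b\<^sup>t - b \<alpha>\<^sup>t\<close> for \<open>\<beta>\<^sup>t \<alpha> = 1\<close>, \<open>b\<^sup>t \<alpha> = 0\<close> and
  on \<open>tr(W (\<alpha> b\<^sup>t - b \<alpha>\<^sup>t)) = 0\<close> for skew-symmetric \<open>W\<close> killing \<open>\<alpha>\<close>.

  For locality, the form has no pole at \<open>P\<^sub>+\<close> if \<open>m + m'\<close> is large, and none at \<open>P\<^sub>-\<close> if \<open>m + m'\<close> is very
  negative. In the second case \<open>P\<^sub>+\<close> is the only pole, and the residue vanishes by the residue theorem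
  on a compact Riemann surface. The latter is Stokes' theorem with a partition of unity: if \<open>\<phi>\<^sub>0\<close> is a radial
  cutoff function around the pole and \<open>\<phi>\<^sub>1, \<dots>, \<phi>\<^sub>r\<close> complete it to a partition of unity subordinate to
  charts, then the integrals of the 2-forms \<open>d\<phi>\<^sub>k \<and> \<omega>\<close> add up to \<open>0\<close> and vanish for \<open>k > 0\<close>, while
  the one for \<open>k = 0\<close> is a nonzero multiple of the residue.
\<close>

text \<open>The coefficients of power series are written with the same symbol as vector components.\<close>

no_notation fps_nth (infixl \<open>$\<close> 75)

section \<open>Orders and residues of germs\<close>

text \<open>Orders, residues and expansions are handled on germs in one coordinate; charts matter
  only when germs are transported. Two features of the setting shape the rest. The values of a
  function or form on the exceptional set carry no information, so local statements concern
  punctured neighbourhoods, and Stokes' theorem is applied to coefficients whose removable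
  singularities have been filled in. Integrals are taken in the plane only: a 2-form is integrated
  in a chart containing its support, so a sum over a partition of unity mixes integrals from
  different charts and needs an exchange argument. With \<omega> = F dz in a chart, only the
  antiholomorphic part of d\<phi> contributes to the product of d\<phi> and \<omega>, hence the
  operator \<open>dbar\<close>; one continuous derivative is enough, so the cutoff functions are
  piecewise polynomial. The bounds in the locality statement are orders: if \<L> has poles of order
  at most \<open>nP\<close> and \<open>nQ\<close> at the two marked points, with both numbers at
  least 1, the form has order at least \<open>m + m' - nP\<close> at the first and
  \<open>- m - m' - 2g - nQ\<close> at the second.\<close>

lemma meromorphic_imp_order_at_least:
  assumes "f meromorphic_on {z0}" shows "\<exists>n::nat. order_at_least (- int n) f z0"
proof -
  have iso: "isolated_singularity_at f z0" and ne: "not_essential f z0"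
    using assms by (auto simp: meromorphic_at_iff)
  obtain r where r: "r > 0" "f holomorphic_on ball z0 r - {z0}"
    using iso by (auto simp: isolated_singularity_at_def) (metis analytic_imp_holomorphic)
  show ?thesis
  proof (cases "is_pole f z0")
    case True
    have "\<exists>s>0. cball z0 s \<subseteq> ball z0 r \<and> zor_poly f z0 holomorphic_on cball z0 s \<and> zor_poly f z0 z0 \<noteq> 0 \<and>
      (\<forall>w\<in>cball z0 s - {z0}. f w = zor_poly f z0 w / (w - z0) ^ nat (- zorder f z0) \<and> zor_poly f z0 w \<noteq> 0)"
      using zorder_exist_pole[OF r(2) open_ball _ True] r(1) by auto
    then obtain s where s: "s > 0" "zor_poly f z0 holomorphic_on cball z0 s"
      "\<And>w. w \<in> cball z0 s - {z0} \<Longrightarrow> f w = zor_poly f z0 w / (w - z0) ^ nat (- zorder f z0)" by blast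
    have "zor_poly f z0 analytic_on {z0}"
      using s(1,2) holomorphic_on_subset[of "zor_poly f z0" _ "ball z0 s"]
      by (auto simp: analytic_at intro!: exI[of _ "ball z0 s"])
    moreover have "\<forall>\<^sub>F w in at z0. w \<in> cball z0 s - {z0}"
      using s(1) eventually_at_in_open[of "ball z0 s" z0] by (auto elim!: eventually_mono)
    hence "\<forall>\<^sub>F w in at z0. f w = (w - z0) powi (- int (nat (- zorder f z0))) * zor_poly f z0 w"
      by (rule eventually_mono) (simp only: s(3) power_int_minus power_int_of_nat divide_inverse mult_ac)
    ultimately show ?thesis unfolding order_at_least_def by blast
  next
    case False
    then obtain l where l: "(f \<longlongrightarrow> l) (at z0)" using ne by (auto simp: not_essential_def)
    define g where "g = (\<lambda>z. if z = z0 then l else f z)"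
    have "g holomorphic_on ball z0 r"
    proof (rule no_isolated_singularity')
      show "(g \<longlongrightarrow> g z) (at z within ball z0 r)" if "z \<in> {z0}" for z
        using that l by (auto simp: g_def at_within_open[of z0 "ball z0 r"] r(1) intro: tendsto_cong[THEN iffD1, rotated]
          Lim_transform_within[OF l, of 1])
      show "g holomorphic_on ball z0 r - {z0}"
        by (rule holomorphic_transform[OF r(2)]) (auto simp: g_def)
    qed auto
    hence "g analytic_on {z0}" using r(1) by (auto simp: analytic_at intro!: exI[of _ "ball z0 r"])
    moreover have "\<forall>\<^sub>F z in at z0. f z = (z - z0) powi (- int 0) * g z"
      by (auto simp: eventually_at_filter g_def)
    ultimately show ?thesis unfolding order_at_least_def by blast
  qed
qed

lemma order_at_least_cong:
  assumes "\<forall>\<^sub>F z in at z0. f z = g z"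
  shows "order_at_least m f z0 \<longleftrightarrow> order_at_least m g z0"
proof -
  have *: "order_at_least m g z0" if f: "order_at_least m f z0" and fg: "\<forall>\<^sub>F z in at z0. f z = g z" for f g
  proof -
    obtain h where h: "h analytic_on {z0}" "\<forall>\<^sub>F z in at z0. f z = (z - z0) powi m * h z"
      using f by (auto simp: order_at_least_def)
    have "\<forall>\<^sub>F z in at z0. g z = (z - z0) powi m * h z"
      using h(2) fg by eventually_elim simp
    thus ?thesis using h(1) by (auto simp: order_at_least_def)
  qed
  have "\<forall>\<^sub>F z in at z0. g z = f z" using assms by eventually_elim simp
  thus ?thesis using *[of f g] *[of g f] assms by blast
qed

lemma order_at_least_analytic: "f analytic_on {z0} \<Longrightarrow> order_at_least 0 f z0"
  by (auto simp: order_at_least_def)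

lemma order_at_least_mult:
  assumes "order_at_least m f z0" "order_at_least n g z0"
  shows "order_at_least (m + n) (\<lambda>z. f z * g z) z0"
proof -
  obtain h k where h: "h analytic_on {z0}" "\<forall>\<^sub>F z in at z0. f z = (z - z0) powi m * h z"
    and k: "k analytic_on {z0}" "\<forall>\<^sub>F z in at z0. g z = (z - z0) powi n * k z"
    using assms by (auto simp: order_at_least_def)
  have "\<forall>\<^sub>F z in at z0. z \<noteq> z0" by (auto simp: eventually_at_filter)
  with h(2) k(2) have "\<forall>\<^sub>F z in at z0. f z * g z = (z - z0) powi (m + n) * (h z * k z)"
    by eventually_elim (simp add: power_int_add)
  thus ?thesis using h(1) k(1) unfolding order_at_least_def by (blast intro: analytic_on_mult)
qed

lemma order_at_least_mono:
  assumes "order_at_least n f z0" "m \<le> n" shows "order_at_least m f z0"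
proof -
  obtain h where h: "h analytic_on {z0}" "\<forall>\<^sub>F z in at z0. f z = (z - z0) powi n * h z"
    using assms by (auto simp: order_at_least_def)
  obtain k where k: "n = m + int k" using assms(2) zle_iff_zadd by blast
  have "\<forall>\<^sub>F z in at z0. z \<noteq> z0" by (auto simp: eventually_at_filter)
  with h(2) have "\<forall>\<^sub>F z in at z0. f z = (z - z0) powi m * ((z - z0) ^ k * h z)"
    by eventually_elim (simp add: k power_int_add)
  moreover have "(\<lambda>z. (z - z0) ^ k * h z) analytic_on {z0}"
    by (intro analytic_intros h)
  ultimately show ?thesis unfolding order_at_least_def by blast
qed

lemma order_at_least_add:
  assumes "order_at_least m f z0" "order_at_least m g z0"
  shows "order_at_least m (\<lambda>z. f z + g z) z0"
proof -
  obtain h k where h: "h analytic_on {z0}" "\<forall>\<^sub>F z in at z0. f z = (z - z0) powi m * h z"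
    and k: "k analytic_on {z0}" "\<forall>\<^sub>F z in at z0. g z = (z - z0) powi m * k z"
    using assms by (auto simp: order_at_least_def)
  from h(2) k(2) have "\<forall>\<^sub>F z in at z0. f z + g z = (z - z0) powi m * (h z + k z)"
    by eventually_elim (simp add: distrib_left)
  thus ?thesis using h(1) k(1) unfolding order_at_least_def by (blast intro: analytic_on_add)
qed

lemma order_at_least_const: "order_at_least 0 (\<lambda>_. c) z0"
  by (rule order_at_least_analytic) simp

lemma order_at_least_cmult:
  assumes "order_at_least m f z0" shows "order_at_least m (\<lambda>z. c * f z) z0"
  using order_at_least_mult[OF order_at_least_const assms] by simp

lemma order_at_least_uminus:
  assumes "order_at_least m f z0" shows "order_at_least m (\<lambda>z. - f z) z0"
  using order_at_least_cmult[OF assms, of "-1"] by simp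

lemma order_at_least_diff:
  assumes "order_at_least m f z0" "order_at_least m g z0"
  shows "order_at_least m (\<lambda>z. f z - g z) z0"
  using order_at_least_add[OF assms(1) order_at_least_uminus[OF assms(2)]] by simp

lemma order_at_least_0 [simp]: "order_at_least m (\<lambda>_. 0) z0"
  by (auto simp: order_at_least_def intro!: exI[of _ "\<lambda>_. 0"])

lemma order_at_least_sum:
  assumes "\<And>i. i \<in> I \<Longrightarrow> order_at_least m (f i) z0"
  shows "order_at_least m (\<lambda>z. \<Sum>i\<in>I. f i z) z0"
  using assms by (induction I rule: infinite_finite_induct) (auto intro: order_at_least_add)

text \<open>Differentiating the factorization gives \<open>(z - z0) powi (m - 1)\<close> times an
  analytic function whatever the sign of \<open>m\<close>; for \<open>m = 0\<close> the bound is
  merely not sharp.\<close>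

lemma order_at_least_deriv:
  assumes "order_at_least m f z0"
  shows "order_at_least (m - 1) (deriv f) z0"
proof -
  obtain h where h: "h analytic_on {z0}" "\<forall>\<^sub>F z in at z0. f z = (z - z0) powi m * h z"
    using assms by (auto simp: order_at_least_def)
  obtain V where V: "open V" "z0 \<in> V" "h holomorphic_on V" using h(1) by (auto simp: analytic_at)
  obtain W where W: "open W" "z0 \<in> W" "\<And>z. z \<in> W \<Longrightarrow> z \<noteq> z0 \<Longrightarrow> f z = (z - z0) powi m * h z"
    using h(2) by (auto simp: eventually_at_topological)
  have "deriv f z = (z - z0) powi (m - 1) * (of_int m * h z + (z - z0) * deriv h z)"
    if z: "z \<in> V \<inter> W - {z0}" for z
  proof (rule DERIV_imp_deriv)
    have "((\<lambda>z. (z - z0) powi m * h z) has_field_derivative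
        (z - z0) powi (m - 1) * (of_int m * h z + (z - z0) * deriv h z)) (at z)"
      using z by (auto intro!: derivative_eq_intros holomorphic_derivI[OF V(3,1)] simp: power_int_diff field_simps)
    thus "(f has_field_derivative (z - z0) powi (m - 1) * (of_int m * h z + (z - z0) * deriv h z)) (at z)"
      by (rule has_field_derivative_transform_within_open[of _ _ _ "W - {z0}"]) (use z W in auto)
  qed
  hence "\<forall>\<^sub>F z in at z0. deriv f z = (z - z0) powi (m - 1) * (of_int m * h z + (z - z0) * deriv h z)"
    using V W by (auto simp: eventually_at_topological intro!: exI[of _ "V \<inter> W"])
  moreover have "(\<lambda>z. of_int m * h z + (z - z0) * deriv h z) analytic_on {z0}"
    by (intro analytic_intros h)
  ultimately show ?thesis unfolding order_at_least_def by blast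
qed

lemma order_at_least_imp_residue_0:
  assumes "order_at_least 0 f z0" shows "residue f z0 = 0"
proof -
  obtain h where h: "h analytic_on {z0}" "\<forall>\<^sub>F z in at z0. f z = h z"
    using assms by (auto simp: order_at_least_def)
  obtain V where V: "open V" "z0 \<in> V" "h holomorphic_on V" using h(1) by (auto simp: analytic_at)
  have "residue f z0 = residue h z0" by (rule residue_cong) (use h in auto)
  thus ?thesis using residue_holo[OF V] by simp
qed

text \<open>Here \<open>k\<close> is the difference quotient completed by the derivative, so the
  equation holds for all \<open>z\<close> and not only near \<open>z0\<close>. The value
  \<open>k z0\<close> is what a second division needs.\<close>

lemma analytic_factor:
  assumes "h analytic_on {z0}"
  obtains k where "k analytic_on {z0}" "\<And>z. h z = h z0 + (z - z0) * k z" "k z0 = deriv h z0"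
proof -
  obtain V where V: "open V" "z0 \<in> V" "h holomorphic_on V" using assms by (auto simp: analytic_at)
  define k where "k = (\<lambda>z. if z = z0 then deriv h z0 else (h z - h z0) / (z - z0))"
  have "k holomorphic_on V" unfolding k_def by (rule pole_lemma_open[OF V(3,1)])
  hence "k analytic_on {z0}" using V by (auto simp: analytic_at)
  thus ?thesis by (rule that) (auto simp: k_def)
qed

lemma order_at_least_1_vanishing:
  assumes "h analytic_on {z0}" "h z0 = 0" shows "order_at_least 1 h z0"
proof -
  obtain k where k: "k analytic_on {z0}" "\<And>z. h z = h z0 + (z - z0) * k z"
    using analytic_factor[OF assms(1)] by metis
  thus ?thesis using assms(2) unfolding order_at_least_def by (intro exI[of _ k]) simp
qed

lemma order_at_least_divide:
  assumes "order_at_least m f z0" shows "order_at_least (m - 1) (\<lambda>z. f z / (z - z0)) z0"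
proof -
  have "order_at_least (-1) (\<lambda>z. 1 / (z - z0)) z0"
    unfolding order_at_least_def by (intro exI[of _ "\<lambda>_. 1"]) (simp add: power_int_minus divide_inverse)
  from order_at_least_mult[OF assms this] show ?thesis by simp
qed

text \<open>The source of the extra constant term when a simple pole is rewritten in another
  coordinate: a numerator that varies with \<open>z\<close> contributes its derivative.\<close>

lemma order_at_least_expansion:
  assumes "g analytic_on {z0}"
  shows "order_at_least 1 (\<lambda>z. g z / (z - z0) - (g z0 / (z - z0) + deriv g z0)) z0"
proof -
  obtain k where k: "k analytic_on {z0}" "\<And>z. g z = g z0 + (z - z0) * k z" "k z0 = deriv g z0"
    using analytic_factor[OF assms(1)] by metis
  have "order_at_least 1 (\<lambda>z. k z - k z0) z0"
    by (rule order_at_least_1_vanishing) (auto intro!: analytic_intros k(1))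
  moreover have "g z / (z - z0) - (g z0 / (z - z0) + deriv g z0) = k z - k z0" if "z \<noteq> z0" for z
  proof -
    have "g z / (z - z0) = g z0 / (z - z0) + k z"
      using that by (subst k(2)) (simp add: add_divide_distrib)
    thus ?thesis by (simp add: k(3))
  qed
  hence "\<forall>\<^sub>F z in at z0. g z / (z - z0) - (g z0 / (z - z0) + deriv g z0) = k z - k z0"
    by (auto simp: eventually_at_filter)
  ultimately show ?thesis by (rule iffD2[OF order_at_least_cong, rotated])
qed

text \<open>The limit is taken along the punctured filter at \<open>T z0\<close>, since the facts
  that get composed with \<open>T\<close> say nothing about the point itself. It avoids
  \<open>T z0\<close> because \<open>t\<close> does not vanish nearby.\<close>

lemma coordinate_factor:
  assumes T: "T analytic_on {z0}" and T': "deriv T z0 \<noteq> 0"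
  obtains t where "t analytic_on {z0}" "\<And>z. T z - T z0 = (z - z0) * t z" "t z0 = deriv T z0"
    "\<forall>\<^sub>F z in at z0. t z \<noteq> 0" "filterlim T (at (T z0)) (at z0)"
proof -
  obtain t where t: "t analytic_on {z0}" "\<And>z. T z = T z0 + (z - z0) * t z" "t z0 = deriv T z0"
    using analytic_factor[OF T] by metis
  have "isCont t z0" using t(1) by (simp add: analytic_at_imp_isCont)
  hence nz: "\<forall>\<^sub>F z in at z0. t z \<noteq> 0"
    using t(3) T' by (auto simp: isCont_def elim!: tendsto_imp_eventually_ne)
  have "(T \<longlongrightarrow> T z0) (at z0)"
    using analytic_at_imp_isCont[OF T] by (simp add: isCont_def)
  moreover have "\<forall>\<^sub>F z in at z0. z \<noteq> z0" by (auto simp: eventually_at_filter)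
  with nz have "\<forall>\<^sub>F z in at z0. T z \<noteq> T z0"
  proof eventually_elim
    case (elim z) thus ?case using t(2)[of z] by auto
  qed
  ultimately have "filterlim T (at (T z0)) (at z0)" by (simp add: filterlim_at)
  moreover have "T z - T z0 = (z - z0) * t z" for z using t(2)[of z] by simp
  ultimately show ?thesis using that t nz by blast
qed

lemma order_at_least_compose:
  assumes f: "order_at_least m f (T z0)" and T: "T analytic_on {z0}" "deriv T z0 \<noteq> 0"
  shows "order_at_least m (\<lambda>z. f (T z)) z0"
proof -
  obtain h where h: "h analytic_on {T z0}" "\<forall>\<^sub>F w in at (T z0). f w = (w - T z0) powi m * h w"
    using f by (auto simp: order_at_least_def)
  obtain t where t: "t analytic_on {z0}" "\<And>z. T z - T z0 = (z - z0) * t z" "t z0 = deriv T z0"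
     "filterlim T (at (T z0)) (at z0)"
    using coordinate_factor[OF T] by metis
  have "\<forall>\<^sub>F z in at z0. f (T z) = (T z - T z0) powi m * h (T z)"
    using h(2) t(4) by (rule eventually_compose_filterlim)
  hence "\<forall>\<^sub>F z in at z0. f (T z) = (z - z0) powi m * (t z powi m * h (T z))"
    by eventually_elim (simp add: t(2) power_int_mult_distrib)
  moreover have "(\<lambda>z. h (T z)) analytic_on {z0}"
    using analytic_on_compose[OF T(1), of h] h(1) by (simp add: o_def)
  hence "(\<lambda>z. t z powi m * h (T z)) analytic_on {z0}"
    using t(1,3) T(2) by (intro analytic_intros) auto
  ultimately show ?thesis unfolding order_at_least_def by blast
qed

section \<open>Residues of meromorphic germs\<close>

lemma residue_add_meromorphic:
  assumes "f meromorphic_on {z0}" "g meromorphic_on {z0}"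
  shows "residue (\<lambda>z. f z + g z) z0 = residue f z0 + residue g z0"
proof -
  have "(\<lambda>w. f (z0 + w)) has_laurent_expansion laurent_expansion f z0"
       "(\<lambda>w. g (z0 + w)) has_laurent_expansion laurent_expansion g z0"
    using meromorphic_on_imp_has_laurent_expansion assms by auto
  from this has_laurent_expansion_add[OF this] show ?thesis
    by (simp add: has_laurent_expansion_residue[of "\<lambda>z. f z + g z" z0] has_laurent_expansion_residue)
qed

lemma residue_cmult_meromorphic:
  assumes "f meromorphic_on {z0}"
  shows "residue (\<lambda>z. c * f z) z0 = c * residue f z0"
proof -
  have "(\<lambda>w. f (z0 + w)) has_laurent_expansion laurent_expansion f z0"
    using meromorphic_on_imp_has_laurent_expansion assms by auto
  from has_laurent_expansion_residue[OF this]
    has_laurent_expansion_residue[of "\<lambda>z. c * f z", OF has_laurent_expansion_cmult_left[OF this]]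
  show ?thesis by simp
qed

text \<open>Differentiation shifts exponents down by one and multiplies by the old exponent, so the
  term that would land at exponent -1 carries the factor 0. This kills the obstructions to
  antisymmetry and to the cocycle identity.\<close>

lemma residue_deriv_meromorphic:
  assumes "f meromorphic_on {z0}"
  shows "residue (deriv f) z0 = 0"
proof -
  have L: "(\<lambda>w. f (z0 + w)) has_laurent_expansion laurent_expansion f z0"
    using meromorphic_on_imp_has_laurent_expansion assms by auto
  have "deriv (\<lambda>w. f (z0 + w)) = (\<lambda>w. deriv f (z0 + w))"
    using DERIV_shift[of f _ _ z0] by (simp add: deriv_def add.commute fun_eq_iff)
  with has_laurent_expansion_deriv[OF L] have
    "(\<lambda>w. deriv f (z0 + w)) has_laurent_expansion fls_deriv (laurent_expansion f z0)" by simp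
  from has_laurent_expansion_residue[OF this] show ?thesis by (simp add: fls_residue_deriv)
qed

section \<open>Change of variables for holomorphic maps\<close>

text \<open>The identification with \<open>real^2\<close> is needed because the change-of-variables
  theorem with a Jacobian determinant is formulated for such vectors.\<close>

definition of_vec2 :: "real^2 \<Rightarrow> complex" where "of_vec2 v = Complex (v$1) (v$2)"
definition to_vec2 :: "complex \<Rightarrow> real^2" where "to_vec2 z = vector [Re z, Im z]"

lemma of_vec2_inverse [simp]: "of_vec2 (to_vec2 z) = z" by (simp add: of_vec2_def to_vec2_def)
lemma to_vec2_inverse [simp]: "to_vec2 (of_vec2 v) = v" by (simp add: of_vec2_def to_vec2_def vec_eq_iff forall_2)

lemma linear_of_vec2: "linear of_vec2"
  by (rule linearI) (auto simp: of_vec2_def complex_eq_iff)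
lemma linear_to_vec2: "linear to_vec2"
  by (rule linearI) (auto simp: to_vec2_def vec_eq_iff forall_2)

lemma bounded_linear_of_vec2: "bounded_linear of_vec2" using linear_of_vec2 linear_conv_bounded_linear by blast
lemma bounded_linear_to_vec2: "bounded_linear to_vec2" using linear_to_vec2 linear_conv_bounded_linear by blast

lemma of_vec2_cbox: "of_vec2 ` cbox u v = cbox (of_vec2 u) (of_vec2 v)"
proof -
  have *: "x \<in> cbox u v \<longleftrightarrow> of_vec2 x \<in> cbox (of_vec2 u) (of_vec2 v)" for x
    by (auto simp: in_cbox_complex_iff mem_box_cart forall_2 of_vec2_def)
  show ?thesis using * by (auto simp: image_iff) (metis of_vec2_inverse)
qed

lemma to_vec2_cbox: "to_vec2 ` cbox u v = cbox (to_vec2 u) (to_vec2 v)"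
proof -
  have "to_vec2 ` cbox u v = to_vec2 ` (of_vec2 ` cbox (to_vec2 u) (to_vec2 v))" by (simp add: of_vec2_cbox)
  thus ?thesis by (simp add: image_image)
qed

lemma content_of_vec2: "measure lborel (of_vec2 ` cbox u v) = measure lborel (cbox u v)"
proof (cases "cbox u v = {}")
  case False
  then have "u$1 \<le> v$1" "u$2 \<le> v$2" by (auto simp: interval_ne_empty_cart)
  hence "measure lborel (cbox (of_vec2 u) (of_vec2 v)) = (v$1-u$1)*(v$2-u$2)"
    by (subst content_cbox) (auto simp: Basis_complex_def of_vec2_def)
  moreover have "measure lborel (cbox u v) = (v$1-u$1)*(v$2-u$2)"
    using False by (simp add: content_cbox_cart UNIV_2)
  ultimately show ?thesis by (simp add: of_vec2_cbox)
qed simp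

text \<open>The identification maps boxes to boxes of the same content, so Riemann sums
  correspond.\<close>

lemma has_integral_of_vec2:
  fixes f :: "complex \<Rightarrow> 'b::real_normed_vector"
  assumes "(f has_integral I) (cbox a b)"
  shows "((f \<circ> of_vec2) has_integral I) (cbox (to_vec2 a) (to_vec2 b))"
proof -
  have "((\<lambda>x. f (of_vec2 x)) has_integral (1/1) *\<^sub>R I) (to_vec2 ` cbox a b)"
  proof (rule has_integral_twiddle)
    show "\<exists>w z. of_vec2 ` cbox u v = cbox w z" for u v by (metis of_vec2_cbox)
    show "\<exists>w z. to_vec2 ` cbox u v = cbox w z" for u v by (metis to_vec2_cbox)
    show "isCont of_vec2 x" for x by (simp add: linear_continuous_at bounded_linear_of_vec2)
    show "measure lborel (of_vec2 ` cbox u v) = 1 * measure lborel (cbox u v)" for u v by (simp add: content_of_vec2)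
  qed (use assms in auto)
  thus ?thesis by (simp add: to_vec2_cbox o_def)
qed

text \<open>A box around the support reduces integrability to continuity on a box. The second claim
  allows the domain of integration to be exchanged for any set containing the support.\<close>

lemma compact_support_integrable:
  fixes f :: "'a::euclidean_space \<Rightarrow> 'b::euclidean_space"
  assumes "continuous_on UNIV f" "compact K" "\<And>x. x \<notin> K \<Longrightarrow> f x = 0" "K \<subseteq> S"
  shows "f absolutely_integrable_on S" "integral S f = integral UNIV f"
proof -
  obtain a where a: "K \<subseteq> cbox (-a) a"
    using assms(2) bounded_subset_cbox_symmetric compact_imp_bounded by blast
  have "f absolutely_integrable_on cbox (-a) a"
    using assms(1) continuous_on_subset by (blast intro: absolutely_integrable_continuous)
  hence "(\<lambda>x. if x \<in> cbox (-a) a then f x else 0) absolutely_integrable_on UNIV"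
    by (simp only: absolutely_integrable_restrict_UNIV)
  moreover have "(\<lambda>x. if x \<in> cbox (-a) a then f x else 0) = f" "(\<lambda>x. if x \<in> S then f x else 0) = f"
    using a assms(3,4) by (auto simp: fun_eq_iff)
  ultimately show "f absolutely_integrable_on S" "integral S f = integral UNIV f"
    using absolutely_integrable_restrict_UNIV[of S f] integral_restrict_UNIV[of S f] by auto
qed

lemma integral_of_vec2:
  fixes f :: "complex \<Rightarrow> 'b::euclidean_space"
  assumes "continuous_on UNIV f" "compact K" "\<And>x. x \<notin> K \<Longrightarrow> f x = 0"
  shows "integral UNIV (\<lambda>x. f (of_vec2 x)) = integral UNIV f"
proof -
  obtain a where a: "K \<subseteq> cbox (-a) a"
    using assms(2) bounded_subset_cbox_symmetric compact_imp_bounded by blast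
  have "f integrable_on cbox (-a) a"
    using assms(1) continuous_on_subset by (blast intro: integrable_continuous)
  moreover have "integral (cbox (-a) a) f = integral UNIV f"
    by (rule compact_support_integrable(2)[OF assms a]) auto
  ultimately have "(f has_integral integral UNIV f) (cbox (-a) a)" by (metis integrable_integral)
  from has_integral_of_vec2[OF this] have "integral (cbox (to_vec2 (-a)) (to_vec2 a)) (f \<circ> of_vec2) = integral UNIV f"
    by blast
  moreover have "integral (cbox (to_vec2 (-a)) (to_vec2 a)) (f \<circ> of_vec2) = integral UNIV (f \<circ> of_vec2)"
  proof (rule compact_support_integrable(2))
    show "continuous_on UNIV (f \<circ> of_vec2)"
      by (intro continuous_on_compose linear_continuous_on bounded_linear_of_vec2 continuous_on_subset[OF assms(1)]) auto
    show "(f \<circ> of_vec2) x = 0" if "x \<notin> to_vec2 ` K" for x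
    proof -
      have "of_vec2 x \<notin> K" using that by (metis to_vec2_inverse imageI)
      thus ?thesis using assms(3)[of "of_vec2 x"] by simp
    qed
    show "compact (to_vec2 ` K)"
      by (intro compact_continuous_image linear_continuous_on bounded_linear_to_vec2 assms)
    show "to_vec2 ` K \<subseteq> cbox (to_vec2 (-a)) (to_vec2 a)"
      using a to_vec2_cbox[of "-a" a] by blast
  qed
  ultimately show ?thesis by (simp add: o_def)
qed

text \<open>By the Cauchy-Riemann equations the real Jacobian determinant of \<open>T\<close> is
  \<open>(cmod (deriv T z))\<^sup>2\<close>. Both integrands live on the whole plane and have
  compact supports inside \<open>W\<close> and its image, so the behaviour of \<open>T\<close> near
  the boundary does not matter.\<close>

lemma holomorphic_change_of_variables:
  fixes F :: "complex \<Rightarrow> complex"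
  assumes W: "open W" and T: "T holomorphic_on W" and inj: "inj_on T W"
    and K: "compact K" "K \<subseteq> T ` W"
    and F: "continuous_on UNIV F" "\<And>w. w \<notin> K \<Longrightarrow> F w = 0"
    and G: "continuous_on UNIV G" "compact K'" "\<And>z. z \<notin> K' \<Longrightarrow> G z = 0" "K' \<subseteq> W"
       "\<And>z. z \<in> W \<Longrightarrow> G z = (cmod (deriv T z))\<^sup>2 *\<^sub>R F (T z)"
  shows "integral UNIV G = integral UNIV F"
proof -
  define U where "U = of_vec2 -` W"
  define T' where "T' = to_vec2 \<circ> T \<circ> of_vec2"
  define D where "D = (\<lambda>x h. to_vec2 (deriv T (of_vec2 x) * of_vec2 h))"
  define F' where "F' = to_vec2 \<circ> F \<circ> of_vec2"
  have cont: "continuous_on S of_vec2" for S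
    by (simp add: linear_continuous_on bounded_linear_of_vec2)
  have contv: "continuous_on S to_vec2" for S
    by (simp add: linear_continuous_on bounded_linear_to_vec2)
  have opU: "open U" unfolding U_def using W cont by (simp add: continuous_open_vimage linear_continuous_at bounded_linear_of_vec2)
  have der: "(T' has_derivative D x) (at x within U)" if "x \<in> U" for x
  proof -
    have "(T has_field_derivative deriv T (of_vec2 x)) (at (of_vec2 x))"
      using W T that by (auto simp: U_def intro: holomorphic_derivI)
    hence "(T has_derivative (*) (deriv T (of_vec2 x))) (at (of_vec2 x))"
      by (simp add: has_field_derivative_def)
    hence "((to_vec2 \<circ> T \<circ> of_vec2) has_derivative (to_vec2 \<circ> (*) (deriv T (of_vec2 x)) \<circ> of_vec2)) (at x)"
      by (intro diff_chain_at) (auto intro: bounded_linear_imp_has_derivative bounded_linear_of_vec2 bounded_linear_to_vec2)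
    thus ?thesis unfolding T'_def D_def o_def by (rule has_derivative_at_withinI)
  qed
  have det: "\<bar>det (matrix (D x))\<bar> = (cmod (deriv T (of_vec2 x)))\<^sup>2" for x
  proof -
    have "det (matrix (D x)) = (Re (deriv T (of_vec2 x)))\<^sup>2 + (Im (deriv T (of_vec2 x)))\<^sup>2"
      unfolding det_2 matrix_def D_def to_vec2_def by (simp add: of_vec2_def axis_def power2_eq_square)
    thus ?thesis by (simp add: cmod_power2)
  qed
  have inj': "inj_on T' U" unfolding T'_def U_def
    using inj by (auto simp: inj_on_def) (metis of_vec2_inverse to_vec2_inverse)
  \<comment> \<open>The values are moved to \<open>real^2\<close> as well as the arguments;
    \<open>F'\<close> and \<open>G'\<close> are the integrands after both identifications.\<close>
  have *: "(\<lambda>x. \<bar>det (matrix (D x))\<bar> *\<^sub>R F'(T' x)) absolutely_integrable_on U \<and>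
           integral U (\<lambda>x. \<bar>det (matrix (D x))\<bar> *\<^sub>R F'(T' x)) = b
     \<longleftrightarrow> F' absolutely_integrable_on (T' ` U) \<and> integral (T' ` U) F' = b" for b
  proof (rule has_absolute_integral_change_of_variables)
    show "U \<in> sets lebesgue" using opU lebesgue_openin[of U UNIV] by simp
  qed (fact der inj')+
  have vim: "T' ` U = to_vec2 ` (T ` W)"
  proof -
    have "of_vec2 ` U = W" unfolding U_def by (auto simp: image_iff) (metis of_vec2_inverse vimageI)
    moreover have "T' ` U = to_vec2 ` T ` of_vec2 ` U" unfolding T'_def by (simp add: image_image)
    ultimately show ?thesis by simp
  qed
  have compv: "compact (to_vec2 ` X)" if "compact X" for X
    by (intro compact_continuous_image contv that)
  have zF: "F' x = 0" if "x \<notin> to_vec2 ` K" for x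
  proof -
    have "of_vec2 x \<notin> K" using that by (metis to_vec2_inverse imageI)
    thus ?thesis using F(2)[of "of_vec2 x"] by (simp add: F'_def linear_0[OF linear_to_vec2])
  qed
  have contF: "continuous_on UNIV F'" unfolding F'_def
    by (intro continuous_on_compose cont contv continuous_on_subset[OF F(1)]) auto
  define G' where "G' = to_vec2 \<circ> G \<circ> of_vec2"
  have zG: "G' x = 0" if "x \<notin> to_vec2 ` K'" for x
  proof -
    have "of_vec2 x \<notin> K'" using that by (metis to_vec2_inverse imageI)
    thus ?thesis using G(3)[of "of_vec2 x"] by (simp add: G'_def linear_0[OF linear_to_vec2])
  qed
  have contG: "continuous_on UNIV G'" unfolding G'_def
    by (intro continuous_on_compose cont contv continuous_on_subset[OF G(1)]) auto
  have KU: "to_vec2 ` K' \<subseteq> U" using G(4) by (auto simp: U_def)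
  have KT: "to_vec2 ` K \<subseteq> T' ` U" unfolding vim using K by blast
  have Geq: "\<bar>det (matrix (D x))\<bar> *\<^sub>R F'(T' x) = G' x" if "x \<in> U" for x
    using that G(5)[of "of_vec2 x"] by (simp add: det U_def F'_def T'_def G'_def linear_scale[OF linear_to_vec2])
  have "integral U (\<lambda>x. \<bar>det (matrix (D x))\<bar> *\<^sub>R F'(T' x)) = integral (T' ` U) F'"
    using *[of "integral (T' ` U) F'"] compact_support_integrable(1)[OF contF compv[OF K(1)] zF KT] by blast
  also have "integral U (\<lambda>x. \<bar>det (matrix (D x))\<bar> *\<^sub>R F'(T' x)) = integral U G'"
    by (intro integral_cong Geq)
  also have "integral U G' = integral UNIV G'"
    by (rule compact_support_integrable(2)[OF contG compv[OF G(2)] zG KU])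
  also have "integral (T' ` U) F' = integral UNIV F'"
    by (rule compact_support_integrable(2)[OF contF compv[OF K(1)] zF KT])
  also have "integral UNIV F' = integral UNIV (\<lambda>x. to_vec2 (F x))"
    unfolding F'_def o_def
    by (rule integral_of_vec2[of _ K]) (use F K in \<open>auto intro!: continuous_on_compose2[OF contv] simp: linear_0[OF linear_to_vec2]\<close>)
  also have "integral UNIV (\<lambda>x. to_vec2 (F x)) = to_vec2 (integral UNIV F)"
    using integral_linear[OF _ bounded_linear_to_vec2, of F UNIV] compact_support_integrable(1)[OF F(1) K(1) F(2), of UNIV]
    by (auto simp: o_def set_lebesgue_integral_eq_integral)
  also have "integral UNIV G' = integral UNIV (\<lambda>x. to_vec2 (G x))"
    unfolding G'_def o_def
    by (rule integral_of_vec2[of _ K']) (use G in \<open>auto intro!: continuous_on_compose2[OF contv] simp: linear_0[OF linear_to_vec2]\<close>)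
  also have "integral UNIV (\<lambda>x. to_vec2 (G x)) = to_vec2 (integral UNIV G)"
    using integral_linear[OF _ bounded_linear_to_vec2, of G UNIV] compact_support_integrable(1)[OF G(1) G(2) G(3), of UNIV]
    by (auto simp: o_def set_lebesgue_integral_eq_integral)
  finally show ?thesis by (metis of_vec2_inverse)
qed

section \<open>Continuously differentiable functions and the Cauchy--Riemann operator\<close>

text \<open>A real-linear derivative is determined by its values at \<open>1\<close> and
  \<open>\<i>\<close>, so continuity of these two functions is continuity of the derivative.
  Differentiability refers to full neighbourhoods of the points of \<open>S\<close>.\<close>

definition C1_on :: "complex set \<Rightarrow> (complex \<Rightarrow> complex) \<Rightarrow> bool" where
  "C1_on S f \<longleftrightarrow> (\<forall>z\<in>S. f differentiable at z) \<and>
     continuous_on S (\<lambda>z. frechet_derivative f (at z) 1) \<and>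
     continuous_on S (\<lambda>z. frechet_derivative f (at z) \<i>)"

text \<open>Twice the Wirtinger derivative with respect to the conjugate variable.\<close>

definition dbar :: "(complex \<Rightarrow> complex) \<Rightarrow> complex \<Rightarrow> complex" where
  "dbar f z = frechet_derivative f (at z) 1 + \<i> * frechet_derivative f (at z) \<i>"

lemma dbar_eqI: "(f has_derivative f') (at z) \<Longrightarrow> dbar f z = f' 1 + \<i> * f' \<i>"
  by (simp add: dbar_def frechet_derivative_at[symmetric])

lemma C1_onI:
  assumes "\<And>z. z \<in> S \<Longrightarrow> (f has_derivative D z) (at z)"
    and "continuous_on S (\<lambda>z. D z 1)" "continuous_on S (\<lambda>z. D z \<i>)"
  shows "C1_on S f"
  unfolding C1_on_def
proof (intro conjI ballI)
  have *: "frechet_derivative f (at z) = D z" if "z \<in> S" for z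
    using assms(1)[OF that] by (simp add: frechet_derivative_at[symmetric])
  show "continuous_on S (\<lambda>z. frechet_derivative f (at z) 1)"
    using assms(2) by (rule continuous_on_eq) (simp add: *)
  show "continuous_on S (\<lambda>z. frechet_derivative f (at z) \<i>)"
    using assms(3) by (rule continuous_on_eq) (simp add: *)
qed (use assms(1) differentiable_def in blast)

lemma C1_onD:
  assumes "C1_on S f" "z \<in> S"
  shows "(f has_derivative frechet_derivative f (at z)) (at z)"
  using assms by (auto simp: C1_on_def frechet_derivative_works)

lemma C1_on_subset: "C1_on S f \<Longrightarrow> T \<subseteq> S \<Longrightarrow> C1_on T f"
  by (auto simp: C1_on_def intro: continuous_on_subset)

lemma C1_on_imp_continuous_on: "C1_on S f \<Longrightarrow> continuous_on S f"
  by (metis C1_on_def differentiable_imp_continuous_within continuous_at_imp_continuous_on)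

lemma C1_on_continuous_partials:
  assumes "C1_on S f"
  shows "continuous_on S (\<lambda>z. frechet_derivative f (at z) 1)"
    and "continuous_on S (\<lambda>z. frechet_derivative f (at z) \<i>)"
  using assms by (auto simp: C1_on_def)

lemma C1_on_dbar: "C1_on S f \<Longrightarrow> continuous_on S (dbar f)"
  unfolding C1_on_def dbar_def [abs_def] by (intro continuous_intros) auto

lemma frechet_derivative_cong_open:
  assumes "open S" "z \<in> S" "\<And>w. w \<in> S \<Longrightarrow> f w = g w"
  shows "frechet_derivative f (at z) = frechet_derivative g (at z)"
proof -
  have "(f has_derivative D) (at z) \<longleftrightarrow> (g has_derivative D) (at z)" for D
    using has_derivative_transform_within_open[of f D z UNIV S g]
          has_derivative_transform_within_open[of g D z UNIV S f] assms by auto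
  thus ?thesis by (simp add: frechet_derivative_def)
qed

lemma dbar_cong_open:
  assumes "open S" "z \<in> S" "\<And>w. w \<in> S \<Longrightarrow> f w = g w"
  shows "dbar f z = dbar g z"
proof -
  have "frechet_derivative f (at z) = frechet_derivative g (at z)"
    by (rule frechet_derivative_cong_open) (use assms in auto)
  thus ?thesis by (simp add: dbar_def)
qed

lemma C1_on_cong_open:
  assumes "C1_on S f" "open S" "\<And>z. z \<in> S \<Longrightarrow> f z = g z"
  shows "C1_on S g"
proof (rule C1_onI)
  have *: "frechet_derivative f (at z) = frechet_derivative g (at z)" if "z \<in> S" for z
    by (rule frechet_derivative_cong_open) (use assms that in auto)
  show "(g has_derivative frechet_derivative f (at z)) (at z)" if "z \<in> S" for z
    using C1_onD[OF assms(1) that] assms that has_derivative_transform_within_open by blast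
qed (use assms(1) in \<open>auto simp: C1_on_def\<close>)

lemma C1_on_Un: "C1_on S f \<Longrightarrow> C1_on T f \<Longrightarrow> open S \<Longrightarrow> open T \<Longrightarrow> C1_on (S \<union> T) f"
  by (auto simp: C1_on_def intro!: continuous_on_open_Un)

lemma C1_on_holomorphic:
  assumes "f holomorphic_on S" "open S" shows "C1_on S f"
proof (rule C1_onI)
  show "(f has_derivative (*) (deriv f z)) (at z)" if "z \<in> S" for z
    using holomorphic_derivI[OF assms that] by (simp add: has_field_derivative_def)
  have "continuous_on S (deriv f)"
    using assms holomorphic_deriv holomorphic_on_imp_continuous_on by blast
  thus "continuous_on S (\<lambda>z. deriv f z * 1)" "continuous_on S (\<lambda>z. deriv f z * \<i>)"
    by (auto intro!: continuous_intros)
qed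

lemma dbar_holomorphic:
  assumes "f holomorphic_on S" "open S" "z \<in> S" shows "dbar f z = 0"
proof -
  have "(f has_derivative (*) (deriv f z)) (at z)"
    using holomorphic_derivI[OF assms] by (simp add: has_field_derivative_def)
  from dbar_eqI[OF this] show ?thesis by (simp add: algebra_simps flip: mult.assoc)
qed

lemma C1_on_const [simp]: "C1_on S (\<lambda>_. c)"
  by (rule C1_onI[where D="\<lambda>_ _. 0"]) auto

lemma dbar_const [simp]: "dbar (\<lambda>_. c) z = 0"
  using dbar_eqI[of "\<lambda>_. c" "\<lambda>_. 0" z] by simp

lemma C1_on_add:
  assumes "C1_on S f" "C1_on S g" shows "C1_on S (\<lambda>z. f z + g z)"
proof (rule C1_onI)
  show "((\<lambda>z. f z + g z) has_derivative
      (\<lambda>h. frechet_derivative f (at z) h + frechet_derivative g (at z) h)) (at z)" if "z \<in> S" for z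
    using C1_onD[OF assms(1) that] C1_onD[OF assms(2) that] by (rule has_derivative_add)
qed (intro continuous_intros C1_on_continuous_partials assms)+

lemma dbar_add:
  assumes "f differentiable at z" "g differentiable at z"
  shows "dbar (\<lambda>z. f z + g z) z = dbar f z + dbar g z"
  using dbar_eqI[OF has_derivative_add[OF assms[unfolded frechet_derivative_works]]]
  by (simp add: dbar_def algebra_simps)

lemma C1_on_sum:
  assumes "\<And>i. i \<in> I \<Longrightarrow> C1_on S (f i)" shows "C1_on S (\<lambda>z. \<Sum>i\<in>I. f i z)"
  using assms by (induction I rule: infinite_finite_induct) (auto intro: C1_on_add)

lemma dbar_sum:
  assumes "\<And>i. i \<in> I \<Longrightarrow> f i differentiable at z"
  shows "dbar (\<lambda>z. \<Sum>i\<in>I. f i z) z = (\<Sum>i\<in>I. dbar (f i) z)"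
  using assms by (induction I rule: infinite_finite_induct) (auto simp: dbar_add differentiable_sum)

lemma C1_on_mult:
  assumes "C1_on S f" "C1_on S g" shows "C1_on S (\<lambda>z. f z * g z)"
proof (rule C1_onI)
  show "((\<lambda>z. f z * g z) has_derivative
      (\<lambda>h. f z * frechet_derivative g (at z) h + frechet_derivative f (at z) h * g z)) (at z)" if "z \<in> S" for z
    using C1_onD[OF assms(1) that] C1_onD[OF assms(2) that] by (rule has_derivative_mult)
qed (intro continuous_intros C1_on_imp_continuous_on C1_on_continuous_partials assms)+

lemma dbar_mult:
  assumes "f differentiable at z" "g differentiable at z"
  shows "dbar (\<lambda>z. f z * g z) z = f z * dbar g z + dbar f z * g z"
  using dbar_eqI[OF has_derivative_mult[OF assms[unfolded frechet_derivative_works]]]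
  by (simp add: dbar_def algebra_simps)

lemma C1_on_inverse:
  assumes "C1_on S f" "\<And>z. z \<in> S \<Longrightarrow> f z \<noteq> 0" shows "C1_on S (\<lambda>z. inverse (f z))"
proof (rule C1_onI)
  show "((\<lambda>z. inverse (f z)) has_derivative
      (\<lambda>h. - (inverse (f z) * frechet_derivative f (at z) h * inverse (f z)))) (at z)" if "z \<in> S" for z
    using that by (intro Deriv.has_derivative_inverse assms C1_onD[OF assms(1) that])
qed (intro continuous_intros C1_on_imp_continuous_on C1_on_continuous_partials assms ballI; simp)+

lemma has_derivative_compose_holomorphic:
  assumes "T holomorphic_on W" "open W" "z \<in> W" "(f has_derivative D) (at (T z))"
  shows "((\<lambda>z. f (T z)) has_derivative (\<lambda>h. D (deriv T z * h))) (at z)"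
proof -
  have "(T has_derivative (*) (deriv T z)) (at z)"
    using holomorphic_derivI[OF assms(1-3)] by (simp add: has_field_derivative_def)
  from diff_chain_at[OF this assms(4)] show ?thesis by (simp add: o_def)
qed

lemma linear_complex_mult_expand:
  assumes "linear D" shows "D (w::complex) = of_real (Re w) * D 1 + of_real (Im w) * (D \<i> :: complex)"
proof -
  have "w = Re w *\<^sub>R 1 + Im w *\<^sub>R \<i>" by (simp add: complex_eq_iff)
  hence "D w = D (Re w *\<^sub>R 1 + Im w *\<^sub>R \<i>)" by simp
  also have "\<dots> = Re w *\<^sub>R D 1 + Im w *\<^sub>R D \<i>"
    by (simp only: linear_add[OF assms] linear_scale[OF assms])
  finally show ?thesis by (simp add: scaleR_conv_of_real)
qed

lemma C1_on_compose_holomorphic: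
  assumes T: "T holomorphic_on W" "open W" and f: "C1_on S f" "T ` W \<subseteq> S"
  shows "C1_on W (\<lambda>z. f (T z))"
proof (rule C1_onI)
  fix z assume z: "z \<in> W"
  show "((\<lambda>z. f (T z)) has_derivative (\<lambda>h. frechet_derivative f (at (T z)) (deriv T z * h))) (at z)"
    using has_derivative_compose_holomorphic[OF T z C1_onD[OF f(1)]] z f(2) by blast
next
  have ct: "continuous_on W T" "continuous_on W (deriv T)"
    using T by (auto intro: holomorphic_on_imp_continuous_on holomorphic_deriv)
  have lin: "linear (frechet_derivative f (at (T z)))" if "z \<in> W" for z
    using C1_onD[OF f(1), of "T z"] that f(2) has_derivative_linear by blast
  have *: "continuous_on W (\<lambda>z. frechet_derivative f (at (T z)) 1)"
       "continuous_on W (\<lambda>z. frechet_derivative f (at (T z)) \<i>)"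
    using f by (auto simp: C1_on_def intro!: continuous_on_compose2[OF _ ct(1)])
  show "continuous_on W (\<lambda>z. frechet_derivative f (at (T z)) (deriv T z * 1))"
    by (rule continuous_on_eq[OF _ linear_complex_mult_expand[OF lin, symmetric]])
       (auto intro!: continuous_intros * ct)
  show "continuous_on W (\<lambda>z. frechet_derivative f (at (T z)) (deriv T z * \<i>))"
    by (rule continuous_on_eq[OF _ linear_complex_mult_expand[OF lin, symmetric]])
       (auto intro!: continuous_intros * ct)
qed

text \<open>A real-linear map has the form \<open>h \<mapsto> a * h + b * cnj h\<close>, and
  \<open>dbar\<close> reads off \<open>2 * b\<close>. Precomposition with multiplication by
  \<open>deriv T z\<close> multiplies \<open>b\<close> by the conjugate of that number.\<close>

lemma dbar_compose_holomorphic: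
  assumes T: "T holomorphic_on W" "open W" "z \<in> W" and f: "f differentiable at (T z)"
  shows "dbar (\<lambda>z. f (T z)) z = cnj (deriv T z) * dbar f (T z)"
proof -
  define D where "D = frechet_derivative f (at (T z))"
  have D: "(f has_derivative D) (at (T z))" using f by (simp add: D_def frechet_derivative_works)
  have lin: "linear D" using D has_derivative_linear by blast
  have "dbar (\<lambda>z. f (T z)) z = D (deriv T z * 1) + \<i> * D (deriv T z * \<i>)"
    using dbar_eqI[OF has_derivative_compose_holomorphic[OF T D]] .
  also have "\<dots> = cnj (deriv T z) * (D 1 + \<i> * D \<i>)"
    unfolding linear_complex_mult_expand[OF lin, of "deriv T z * 1"]
      linear_complex_mult_expand[OF lin, of "deriv T z * \<i>"]
    by (subst (5) complex_eq) (simp add: complex_eq_iff algebra_simps)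
  finally show ?thesis by (simp add: dbar_def D_def)
qed

section \<open>Compactly supported functions and Stokes' theorem in the plane\<close>

lemma continuous_on_zero_extension:
  fixes g :: "'a::t2_space \<Rightarrow> 'b::{topological_space,zero}"
  assumes "open V" "continuous_on V g" "compact K" "K \<subseteq> V" "\<And>z. z \<in> V \<Longrightarrow> z \<notin> K \<Longrightarrow> g z = 0"
  shows "continuous_on UNIV (\<lambda>z. if z \<in> V then g z else 0)"
proof -
  \<comment> \<open>\<open>V\<close> and the complement of \<open>K\<close> are open and cover the
    space; on the first the extension is \<open>g\<close>, on the second it is zero.\<close>
  have "continuous_on (V \<union> - K) (\<lambda>z. if z \<in> V then g z else 0)"
  proof (rule continuous_on_open_Un)
    show "continuous_on V (\<lambda>z. if z \<in> V then g z else 0)" by (rule continuous_on_eq[OF assms(2)]) auto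
    show "continuous_on (-K) (\<lambda>z. if z \<in> V then g z else 0)"
      by (rule continuous_on_eq[of _ "\<lambda>_. 0"]) (use assms(5) in auto)
    show "open (- K)" using assms(3) by (simp add: compact_imp_closed open_Compl)
  qed fact
  moreover have "V \<union> - K = UNIV" using assms(4) by auto
  ultimately show ?thesis by simp
qed

lemma C1_zero_extension:
  assumes "open V" "C1_on V g" "compact K" "K \<subseteq> V" "\<And>z. z \<in> V \<Longrightarrow> z \<notin> K \<Longrightarrow> g z = 0"
  shows "C1_on UNIV (\<lambda>z. if z \<in> V then g z else 0)"
proof -
  have o: "open (- K)" using assms(3) by (simp add: compact_imp_closed open_Compl)
  have "C1_on (V \<union> - K) (\<lambda>z. if z \<in> V then g z else 0)"
  proof (rule C1_on_Un)
    show "C1_on V (\<lambda>z. if z \<in> V then g z else 0)"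
      by (rule C1_on_cong_open[OF assms(2) assms(1)]) auto
    show "C1_on (-K) (\<lambda>z. if z \<in> V then g z else 0)"
      by (rule C1_on_cong_open[of _ "\<lambda>_. 0"]) (use assms(5) o in auto)
  qed (use o assms(1) in auto)
  moreover have "V \<union> - K = UNIV" using assms(4) by auto
  ultimately show ?thesis by simp
qed

lemma integral_translation:
  fixes f :: "complex \<Rightarrow> complex"
  assumes "continuous_on UNIV f" "compact K" "\<And>x. x \<notin> K \<Longrightarrow> f x = 0"
  shows "integral UNIV (\<lambda>z. f (z + w)) = integral UNIV f"
proof (rule holomorphic_change_of_variables[where W=UNIV and T="\<lambda>z. z + w" and K=K and K'="(\<lambda>z. z - w) ` K"])
  show "f (z + w) = 0" if "z \<notin> (\<lambda>z. z - w) ` K" for z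
    using that assms(3)[of "z + w"] by (auto simp: image_iff algebra_simps)
  show "K \<subseteq> range (\<lambda>z. z + w)" by (auto intro: image_eqI[of _ _ "_ - w"])
  have "((\<lambda>z. z + w) has_field_derivative 1) (at z)" for z by (auto intro!: derivative_eq_intros)
  hence "deriv (\<lambda>z. z + w) z = 1" for z using DERIV_imp_deriv by blast
  thus "f (z + w) = (cmod (deriv (\<lambda>z. z + w) z))\<^sup>2 *\<^sub>R f (z + w)" for z by simp
  show "compact ((\<lambda>z. z - w) ` K)" by (intro compact_continuous_image continuous_intros assms)
qed (auto intro!: continuous_intros holomorphic_intros assms continuous_on_compose2[OF assms(1)] inj_onI)

lemma integral_directional_derivative:
  fixes f :: "complex \<Rightarrow> complex"
  assumes f: "\<And>z. (f has_derivative D z) (at z)" and D: "continuous_on UNIV (\<lambda>z. D z v)"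
    and K: "compact K" "\<And>z. z \<notin> K \<Longrightarrow> f z = 0"
  shows "integral UNIV (\<lambda>z. D z v :: complex) = 0"
proof -
  have contf: "continuous_on S f" for S
    by (meson continuous_at_imp_continuous_on f has_derivative_continuous)
  \<comment> \<open>\<open>K2\<close> contains the supports of all translates by
    \<open>x *\<^sub>R v\<close> with \<open>x\<close> between -1 and 1, so one box serves for the
    whole family that is differentiated in \<open>x\<close>.\<close>
  define K2 where "K2 = (\<lambda>(z,x). z - x *\<^sub>R v) ` (K \<times> {-1..1::real})"
  have K2: "compact K2" unfolding K2_def using K(1)
    by (intro compact_continuous_image compact_Times) (auto intro!: continuous_intros simp: split_beta)
  have K2z: "f (z + x *\<^sub>R v) = 0" if "z \<notin> K2" "x \<in> {-1..1}" for z x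
  proof (rule ccontr)
    assume "f (z + x *\<^sub>R v) \<noteq> 0"
    hence "z + x *\<^sub>R v \<in> K" using K by blast
    hence "(z + x *\<^sub>R v) - x *\<^sub>R v \<in> K2" unfolding K2_def using that(2) by force
    thus False using that by simp
  qed
  obtain a where a: "K2 \<subseteq> cbox (-a) a"
    using K2 bounded_subset_cbox_symmetric compact_imp_bounded by blast
  \<comment> \<open>the integral of \<open>f (z + x v)\<close> does not depend on \<open>x\<close>; differentiate it under the integral sign\<close>
  have "((\<lambda>x. integral (cbox (-a) a) (\<lambda>z. f (z + x *\<^sub>R v))) has_vector_derivative
     integral (cbox (-a) a) (\<lambda>z. D (z + 0 *\<^sub>R v) v)) (at 0 within {-1..1})" (is "(?I has_vector_derivative _) _")
  proof (rule leibniz_rule_vector_derivative)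
    fix x z
    have *: "((\<lambda>x. z + x *\<^sub>R v) has_derivative (\<lambda>h. h *\<^sub>R v)) (at x)"
      by (auto intro!: derivative_eq_intros)
    have "((\<lambda>x. f (z + x *\<^sub>R v)) has_derivative (\<lambda>h. D (z + x *\<^sub>R v) (h *\<^sub>R v))) (at x)"
      using diff_chain_at[OF * f] by (simp add: o_def)
    moreover have "(\<lambda>h. D (z + x *\<^sub>R v) (h *\<^sub>R v)) = (\<lambda>h. h *\<^sub>R D (z + x *\<^sub>R v) v)"
      using linear_scale[OF has_derivative_linear[OF f]] by auto
    ultimately show "((\<lambda>x. f (z + x *\<^sub>R v)) has_vector_derivative D (z + x *\<^sub>R v) v) (at x within {-1..1})"
      unfolding has_vector_derivative_def by (simp add: has_derivative_at_withinI)
  next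
    show "(\<lambda>z. f (z + x *\<^sub>R v)) integrable_on cbox (- a) a" for x
      by (intro integrable_continuous continuous_on_compose2[OF contf[of UNIV]] continuous_intros) auto
    show "continuous_on ({- 1..1} \<times> cbox (- a) a) (\<lambda>(x, t). D (t + x *\<^sub>R v) v)"
      unfolding split_beta by (intro continuous_on_compose2[OF D] continuous_intros) auto
  qed auto
  moreover have "integral (cbox (-a) a) (\<lambda>z. f (z + x *\<^sub>R v)) = integral UNIV f" if "x \<in> {-1..1}" for x
  proof -
    have "integral (cbox (-a) a) (\<lambda>z. f (z + x *\<^sub>R v)) = integral UNIV (\<lambda>z. f (z + x *\<^sub>R v))"
      by (rule compact_support_integrable(2)[OF _ K2 _ a])
         (use K2z that in \<open>auto intro!: continuous_on_compose2[OF contf[of UNIV]] continuous_intros\<close>)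
    also have "\<dots> = integral UNIV f"
      by (rule integral_translation[of f K]) (use contf K in auto)
    finally show ?thesis .
  qed
  note Ieq = this
  ultimately have "((\<lambda>x. integral UNIV f) has_vector_derivative
     integral (cbox (-a) a) (\<lambda>z. D (z + 0 *\<^sub>R v) v)) (at 0 within {-1..1})"
    by - (rule has_vector_derivative_transform[of 0 _ _ ?I], auto simp: Ieq)
  hence der: "((\<lambda>x. integral UNIV f) has_vector_derivative integral (cbox (-a) a) (\<lambda>z. D z v)) (at 0 within {-1..1})"
    by simp
  have "at (0::real) within {-1..1} = at 0" by (simp add: at_within_Icc_at)
  with der have "((\<lambda>x::real. integral UNIV f) has_vector_derivative integral (cbox (-a) a) (\<lambda>z. D z v)) (at 0)"
    by simp
  hence "integral (cbox (-a) a) (\<lambda>z. D z v) = 0"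
    using vector_derivative_unique_at has_vector_derivative_const by blast
  moreover have "integral (cbox (-a) a) (\<lambda>z. D z v) = integral UNIV (\<lambda>z. D z v)"
  proof (rule compact_support_integrable(2)[OF D K2 _ a])
    fix z assume "z \<notin> K2"
    hence "z \<notin> K" by (force simp: K2_def)
    have "open (- K)" using K(1) by (simp add: compact_imp_closed open_Compl)
    hence "((\<lambda>_. 0) has_derivative D z) (at z)"
      using has_derivative_transform_within_open[OF f[of z], of "-K" "\<lambda>_. 0"] \<open>z \<notin> K\<close> K by auto
    thus "D z v = 0" using has_derivative_const has_derivative_unique by metis
  qed
  ultimately show ?thesis by simp
qed

text \<open>Stokes' theorem for the compactly supported 1-form \<open>g dz\<close>, whose exterior
  derivative is \<open>dbar g\<close> times a constant multiple of the area form. After extension by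
  zero both partial derivatives integrate to zero separately.\<close>

theorem integral_dbar_eq_0:
  assumes "open V" "C1_on V g" "compact K" "K \<subseteq> V" "\<And>z. z \<in> V \<Longrightarrow> z \<notin> K \<Longrightarrow> g z = 0"
  shows "integral UNIV (\<lambda>z. if z \<in> V then dbar g z else 0) = 0"
proof -
  define G where "G = (\<lambda>z. if z \<in> V then g z else 0)"
  have C1: "C1_on UNIV G" unfolding G_def by (rule C1_zero_extension[OF assms])
  define D where "D = (\<lambda>z. frechet_derivative G (at z))"
  have D: "(G has_derivative D z) (at z)" for z unfolding D_def by (rule C1_onD[OF C1]) auto
  have c: "continuous_on UNIV (\<lambda>z. D z 1)" "continuous_on UNIV (\<lambda>z. D z \<i>)"
    using C1 by (auto simp: C1_on_def D_def)
  have z: "G z = 0" if "z \<notin> K" for z using that assms(5) by (auto simp: G_def)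
  have oK: "open (- K)" using assms(3) by (simp add: compact_imp_closed open_Compl)
  have Dz: "D z = (\<lambda>_. 0)" if "z \<notin> K" for z
    unfolding D_def using frechet_derivative_cong_open[OF oK, of z G "\<lambda>_. 0"] that z by auto
  have "dbar G z = (if z \<in> V then dbar g z else 0)" for z
  proof (cases "z \<in> V")
    case True thus ?thesis using dbar_cong_open[OF assms(1) True, of G g] by (simp add: G_def)
  next
    case False
    hence "D z = (\<lambda>_. 0)" using assms(4) by (intro Dz) auto
    thus ?thesis using False by (simp add: dbar_def D_def)
  qed
  hence "integral UNIV (\<lambda>z. if z \<in> V then dbar g z else 0) = integral UNIV (\<lambda>z. D z 1 + \<i> * D z \<i>)"
    by (simp add: dbar_def D_def)
  also have "\<dots> = integral UNIV (\<lambda>z. D z 1) + \<i> * integral UNIV (\<lambda>z. D z \<i>)"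
  proof -
    have 1: "(\<lambda>z. D z 1) absolutely_integrable_on UNIV" "(\<lambda>z. D z \<i>) absolutely_integrable_on UNIV"
      by (rule compact_support_integrable(1)[OF c(1) assms(3)] compact_support_integrable(1)[OF c(2) assms(3)]; simp add: Dz)+
    hence "(\<lambda>z. D z 1) integrable_on UNIV" "(\<lambda>z. D z \<i>) integrable_on UNIV"
      using set_lebesgue_integral_eq_integral(1) by blast+
    thus ?thesis by (simp add: integral_add)
  qed
  also have "\<dots> = 0"
    using integral_directional_derivative[OF D c(1) assms(3) z]
          integral_directional_derivative[OF D c(2) assms(3) z] by simp
  finally show ?thesis .
qed

section \<open>Cutoff functions and residues\<close>

text \<open>The square makes the derivative continuous at 0, and one continuous derivative is all
  that the Stokes argument uses.\<close>

definition ramp :: "real \<Rightarrow> real" where "ramp x = (max 0 x)\<^sup>2"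

lemma has_real_derivative_ramp: "(ramp has_real_derivative 2 * max 0 x) (at x)"
proof (cases "x = 0")
  case True
  have "((\<lambda>h. (ramp (0 + h) - ramp 0) / h) \<longlongrightarrow> 0) (at 0)"
  proof (rule Lim_null_comparison)
    show "\<forall>\<^sub>F h in at 0. norm ((ramp (0 + h) - ramp 0) / h) \<le> \<bar>h\<bar>"
    proof (rule always_eventually, rule allI)
      fix h :: real
      show "norm ((ramp (0 + h) - ramp 0) / h) \<le> \<bar>h\<bar>"
        by (cases "h > 0") (auto simp: ramp_def power2_eq_square)
    qed
    show "((\<lambda>h::real. \<bar>h\<bar>) \<longlongrightarrow> 0) (at 0)" by (auto intro!: tendsto_eq_intros)
  qed
  thus ?thesis using True by (simp add: DERIV_def)
next
  case False
  show ?thesis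
  proof (cases "x > 0")
    case True
    have "((\<lambda>x. x\<^sup>2) has_real_derivative 2 * max 0 x) (at x)"
      using True by (auto intro!: derivative_eq_intros)
    thus ?thesis
      by (rule has_field_derivative_transform_within_open[of _ _ _ "{0<..}"]) (use True in \<open>auto simp: ramp_def\<close>)
  next
    assume "\<not> x > 0"
    hence "x < 0" using False by simp
    have "((\<lambda>x. 0) has_real_derivative 2 * max 0 x) (at x)"
      using \<open>x < 0\<close> by (auto intro!: derivative_eq_intros)
    thus ?thesis
      by (rule has_field_derivative_transform_within_open[of _ _ _ "{..<0}"]) (use \<open>x < 0\<close> in \<open>auto simp: ramp_def\<close>)
  qed
qed

lemma continuous_on_ramp [continuous_intros]:
  "continuous_on S f \<Longrightarrow> continuous_on S (\<lambda>x. ramp (f x))"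
  unfolding ramp_def by (intro continuous_intros)

text \<open>The inner ramp starts at 1 and reaches the value 1 at 2, so the outer one falls from 1
  to 0 exactly on the interval from 1 to 2.\<close>

definition cutoff :: "real \<Rightarrow> real" where "cutoff t = ramp (1 - ramp (t - 1))"

definition cutoff' :: "real \<Rightarrow> real" where
  "cutoff' t = - (4 * max 0 (1 - ramp (t - 1)) * max 0 (t - 1))"

lemma has_real_derivative_cutoff: "(cutoff has_real_derivative cutoff' t) (at t)"
proof -
  have "((\<lambda>t. 1 - ramp (t - 1)) has_real_derivative - (2 * max 0 (t - 1))) (at t)"
    by (auto intro!: derivative_eq_intros DERIV_chain'[OF _ has_real_derivative_ramp])
  from DERIV_chain'[OF this has_real_derivative_ramp]
  show ?thesis unfolding cutoff_def [abs_def] cutoff'_def by (simp add: mult_ac)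
qed

lemma continuous_on_cutoff': "continuous_on S cutoff'"
  unfolding cutoff'_def [abs_def] by (intro continuous_intros)

lemma cutoff_eq_1: "t \<le> 1 \<Longrightarrow> cutoff t = 1"
  by (simp add: cutoff_def ramp_def)

lemma cutoff_eq_0: "t \<ge> 2 \<Longrightarrow> cutoff t = 0"
  using power_mono[of 1 "t - 1" 2] by (simp add: cutoff_def ramp_def)

lemma cutoff'_eq_0: "t \<le> 1 \<or> t \<ge> 2 \<Longrightarrow> cutoff' t = 0"
  using power_mono[of 1 "t - 1" 2] by (auto simp: cutoff'_def ramp_def)

lemma cutoff'_nonpos: "cutoff' t \<le> 0"
  by (simp add: cutoff'_def)

lemma cutoff'_neg: "cutoff' (3/2) < 0"
  by (simp add: cutoff'_def ramp_def power2_eq_square)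

text \<open>The profile is applied to the squared distance, which is smooth even at the centre;
  \<open>dbar\<close> of \<open>(z - c) * cnj (z - c)\<close> is \<open>2 * (z - c)\<close>.\<close>

lemma
  fixes q :: "real \<Rightarrow> real"
  assumes q: "\<And>t. (q has_real_derivative q' t) (at t)" and q': "continuous_on UNIV q'"
  shows C1_on_radial: "C1_on S (\<lambda>z. of_real (q ((cmod (z - c))\<^sup>2 / r)))"
    and dbar_radial: "dbar (\<lambda>z. of_real (q ((cmod (z - c))\<^sup>2 / r))) z =
           of_real (q' ((cmod (z - c))\<^sup>2 / r)) * (2 * (z - c) / of_real r)"
proof -
  define D where "D = (\<lambda>z h. complex_of_real (q' ((cmod (z - c))\<^sup>2 / r) * ((2 * Re (z - c) * Re h + 2 * Im (z - c) * Im h) / r)))"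
  have D: "((\<lambda>z. of_real (q ((cmod (z - c))\<^sup>2 / r))) has_derivative D z) (at z)" for z
  proof -
    have "((\<lambda>z. (Re (z - c))\<^sup>2 + (Im (z - c))\<^sup>2) has_derivative
       (\<lambda>h. 2 * Re (z - c) * Re h + 2 * Im (z - c) * Im h)) (at z)"
      by (auto intro!: derivative_eq_intros simp: fun_eq_iff algebra_simps)
    from bounded_linear.has_derivative[OF bounded_linear_divide[of r] this]
    have "((\<lambda>z. (cmod (z - c))\<^sup>2 / r) has_derivative
       (\<lambda>h. (2 * Re (z - c) * Re h + 2 * Im (z - c) * Im h) / r)) (at z)"
      by (simp add: cmod_power2)
    from has_derivative_compose[OF this q[of "(cmod (z - c))\<^sup>2 / r", unfolded has_field_derivative_def]]
    have "((\<lambda>z. q ((cmod (z - c))\<^sup>2 / r)) has_derivative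
       (\<lambda>h. q' ((cmod (z - c))\<^sup>2 / r) * ((2 * Re (z - c) * Re h + 2 * Im (z - c) * Im h) / r))) (at z)" .
    from has_derivative_of_real[OF this] show ?thesis unfolding D_def .
  qed
  show "C1_on S (\<lambda>z. of_real (q ((cmod (z - c))\<^sup>2 / r)))"
  proof (rule C1_onI[OF D])
    have "continuous_on S (\<lambda>z. q' ((cmod (z - c))\<^sup>2 / r))"
      by (cases "r = 0") (auto intro!: continuous_on_compose2[OF q'] continuous_intros)
    thus "continuous_on S (\<lambda>z. D z 1)" "continuous_on S (\<lambda>z. D z \<i>)"
      unfolding D_def by (cases "r = 0"; auto intro!: continuous_intros)+
  qed
  show "dbar (\<lambda>z. of_real (q ((cmod (z - c))\<^sup>2 / r))) z =
           of_real (q' ((cmod (z - c))\<^sup>2 / r)) * (2 * (z - c) / of_real r)"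
    unfolding dbar_eqI[OF D[of z]] D_def by (simp add: complex_eq_iff mult_ac)
qed

text \<open>Integration against \<open>u\<close> reads off the residue up to a fixed factor: the
  holomorphic part of the germ contributes nothing by Stokes, the powers of exponent at most -2
  contribute nothing by rotational symmetry, and the simple pole remains. The factor is not
  evaluated; it is nonzero because the profile is monotone and not constant.\<close>

lemma
  fixes z0 :: complex and r :: real
  assumes r: "r > 0"
  defines "u \<equiv> dbar (\<lambda>z. of_real (cutoff ((cmod (z - z0))\<^sup>2 / r)))"
  assumes V: "open V" "cball z0 (sqrt (2 * r)) \<subseteq> V"
  shows cutoff_kernel_zero: "z \<notin> cball z0 (sqrt (2 * r)) \<Longrightarrow> u z = 0"
    and cutoff_kernel_residue: "H holomorphic_on V \<Longrightarrow> integral UNIV (\<lambda>z. u z * (H z / (z - z0) ^ n)) =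
      integral UNIV (\<lambda>z. u z / (z - z0)) * residue (\<lambda>z. H z / (z - z0) ^ n) z0"
    and cutoff_kernel_nonzero: "integral UNIV (\<lambda>z. u z / (z - z0)) \<noteq> 0"
proof -
  have u: "u z = of_real (cutoff' ((cmod (z - z0))\<^sup>2 / r)) * (2 * (z - z0) / of_real r)" for z
    unfolding u_def by (rule dbar_radial[OF has_real_derivative_cutoff continuous_on_cutoff'])
  define B where "B = cball z0 (sqrt (2 * r))"
  \<comment> \<open>The annulus outside which \<open>u\<close> vanishes. It stays away from
    \<open>z0\<close>, so \<open>u\<close> times a function with a singularity at \<open>z0\<close>
    is continuous and compactly supported.\<close>
  define N where "N = B - ball z0 (sqrt r)"
  have cN: "compact N" unfolding N_def B_def by (intro compact_diff) auto
  have cB: "compact B" unfolding B_def by auto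
  have z0V: "z0 \<in> V" using V(2) r by auto
  have NV: "N \<subseteq> V - {z0}" using V r by (auto simp: N_def B_def)
  have uN: "u z = 0" if "z \<notin> N" for z
  proof -
    have "cmod (z - z0) \<le> sqrt r \<or> cmod (z - z0) \<ge> sqrt (2 * r)"
      using that by (auto simp: N_def B_def dist_norm norm_minus_commute)
    hence "(cmod (z - z0))\<^sup>2 \<le> r \<or> (cmod (z - z0))\<^sup>2 \<ge> 2 * r"
      using r power_mono[of "cmod (z - z0)" "sqrt r" 2] power_mono[of "sqrt (2 * r)" "cmod (z - z0)" 2]
      by (metis (no_types, lifting) less_imp_le mult_pos_pos norm_ge_zero real_sqrt_ge_zero real_sqrt_pow2 zero_less_numeral)
    hence "(cmod (z - z0))\<^sup>2 / r \<le> 1 \<or> (cmod (z - z0))\<^sup>2 / r \<ge> 2"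
      using r by (auto simp: field_simps)
    thus ?thesis using u cutoff'_eq_0 by simp
  qed
  show uz: "u z = 0" if "z \<notin> cball z0 (sqrt (2 * r))" for z
    using that by (intro uN) (auto simp: N_def B_def)
  have u0: "u z0 = 0" using u by simp
  have contu: "continuous_on S u" for S
    unfolding u_def by (intro C1_on_dbar C1_on_radial[OF has_real_derivative_cutoff continuous_on_cutoff'])
  have cont: "continuous_on UNIV (\<lambda>z. u z * f z)" if "continuous_on (V - {z0}) f" for f
  proof -
    have "continuous_on UNIV (\<lambda>z. if z \<in> V - {z0} then u z * f z else 0)"
      by (rule continuous_on_zero_extension[OF _ _ cN NV])
         (use V(1) uN in \<open>auto intro!: continuous_intros contu that\<close>)
    moreover have "(\<lambda>z. if z \<in> V - {z0} then u z * f z else 0) = (\<lambda>z. u z * f z)"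
      using uN NV by (auto simp: fun_eq_iff)
    ultimately show ?thesis by (simp only:)
  qed
  have integrable: "(\<lambda>z. u z * f z) integrable_on UNIV" if "continuous_on (V - {z0}) f" for f
    using compact_support_integrable(1)[OF cont[OF that] cN, of UNIV] uN
    by (auto simp: set_lebesgue_integral_eq_integral)
  have rot: "integral UNIV (\<lambda>z. u z / (z - z0) ^ Suc (Suc n)) = 0" for n
  proof - \<comment> \<open>the rotation by \<open>w\<close> about \<open>z0\<close> changes the sign of the integrand\<close>
    \<comment> \<open>The rotation multiplies \<open>u\<close> by \<open>w\<close> and the power by
      \<open>w\<close> to the exponent \<open>-(n + 2)\<close>, together by the inverse of
      \<open>w ^ Suc n\<close>; hence a root of -1 of that order. For a simple pole the two factors
      would cancel.\<close>
    define w where "w = cis (pi / real (Suc n))"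
    have "real (Suc n) * (pi / real (Suc n)) = pi" by (simp del: of_nat_Suc)
    hence w: "cmod w = 1" "w \<noteq> 0" "w ^ Suc n = -1"
      unfolding w_def by (simp_all only: Complex.DeMoivre cis_pi norm_cis cis_neq_zero not_False_eq_True)
    define g where "g = (\<lambda>z. u z * inverse ((z - z0) ^ Suc (Suc n)))"
    have cg: "continuous_on UNIV g" unfolding g_def
      by (intro cont continuous_intros) auto
    have g0: "g z = 0" if "z \<notin> B" for z using uN that by (auto simp: g_def N_def)
    define G where "G = (\<lambda>z. g (z0 + w * (z - z0)))"
    have G: "G z = - g z" for z
    proof -
      have "G z = w * inverse (w ^ Suc (Suc n)) * g z"
      proof -
        have "u (z0 + w * (z - z0)) = w * u z" by (simp add: u norm_mult w(1))
        moreover have "inverse ((z0 + w * (z - z0) - z0) ^ Suc (Suc n)) =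
            inverse (w ^ Suc (Suc n)) * inverse ((z - z0) ^ Suc (Suc n))"
          by (simp only: add_diff_cancel_left' power_mult_distrib inverse_mult_distrib)
        ultimately show ?thesis by (simp only: G_def g_def mult_ac)
      qed
      also have "w * inverse (w ^ Suc (Suc n)) = inverse (w ^ Suc n)"
        using w(2) by (simp add: field_simps)
      also have "\<dots> = - 1" by (simp only: w(3)) simp
      finally show ?thesis by simp
    qed
    have "integral UNIV G = integral UNIV g"
    proof (rule holomorphic_change_of_variables[where W = UNIV and T = "\<lambda>z. z0 + w * (z - z0)" and K = B and K' = B])
      have "((\<lambda>z. z0 + w * (z - z0)) has_field_derivative w) (at z)" for z
        by (auto intro!: derivative_eq_intros)
      hence "deriv (\<lambda>z. z0 + w * (z - z0)) z = w" for z using DERIV_imp_deriv by blast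
      thus "G z = (cmod (deriv (\<lambda>z. z0 + w * (z - z0)) z))\<^sup>2 *\<^sub>R g (z0 + w * (z - z0))" for z
        by (simp add: w G_def)
      show "B \<subseteq> range (\<lambda>z. z0 + w * (z - z0))"
        using w(2) by (auto intro!: image_eqI[of _ _ "z0 + (_ - z0) / w"])
      show "continuous_on UNIV G" unfolding G by (intro continuous_intros cg)
      show "G z = 0" if "z \<notin> B" for z unfolding G using g0[OF that] by simp
    qed (use w cB g0 in \<open>auto intro!: holomorphic_intros cg inj_onI\<close>)
    hence "- integral UNIV g = integral UNIV g" unfolding G by simp
    hence "integral UNIV g = 0" by (simp add: eq_neg_iff_add_eq_0 flip: mult_2)
    thus ?thesis by (simp add: g_def field_simps)
  qed
  show "integral UNIV (\<lambda>z. u z * (H z / (z - z0) ^ n)) =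
      integral UNIV (\<lambda>z. u z / (z - z0)) * residue (\<lambda>z. H z / (z - z0) ^ n) z0"
    if "H holomorphic_on V" for H n
    using that
  proof (induction n arbitrary: H)
    case 0
    \<comment> \<open>As \<open>H\<close> is holomorphic, the product rule leaves only the
      derivative of the cutoff, so the integrand is \<open>dbar\<close> of a compactly supported
      function.\<close>
    have d: "dbar (\<lambda>z. of_real (cutoff ((cmod (z - z0))\<^sup>2 / r)) * H z) z = u z * H z" if "z \<in> V" for z
    proof -
      have "(\<lambda>z. of_real (cutoff ((cmod (z - z0))\<^sup>2 / r)) :: complex) differentiable at z"
        using C1_on_radial[OF has_real_derivative_cutoff continuous_on_cutoff', of UNIV z0 r] by (auto simp: C1_on_def)
      moreover have "H differentiable at z"
        using C1_on_holomorphic[OF 0 V(1)] that by (auto simp: C1_on_def)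
      ultimately show ?thesis using dbar_holomorphic[OF 0 V(1) that] by (simp add: dbar_mult u_def)
    qed
    have "integral UNIV (\<lambda>z. if z \<in> V then dbar (\<lambda>z. of_real (cutoff ((cmod (z - z0))\<^sup>2 / r)) * H z) z else 0) = 0"
    proof (rule integral_dbar_eq_0[OF V(1) _ cB])
      show "C1_on V (\<lambda>z. of_real (cutoff ((cmod (z - z0))\<^sup>2 / r)) * H z)"
        by (intro C1_on_mult C1_on_radial[OF has_real_derivative_cutoff continuous_on_cutoff'] C1_on_holomorphic V 0)
      show "B \<subseteq> V" using V by (simp add: B_def)
      fix z assume "z \<notin> B"
      hence "cmod (z - z0) \<ge> sqrt (2 * r)" by (auto simp: B_def dist_norm norm_minus_commute)
      hence "(cmod (z - z0))\<^sup>2 / r \<ge> 2"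
        using r power_mono[of "sqrt (2 * r)" "cmod (z - z0)" 2] by (simp add: field_simps)
      thus "of_real (cutoff ((cmod (z - z0))\<^sup>2 / r)) * H z = 0" by (simp add: cutoff_eq_0)
    qed
    also have "(\<lambda>z. if z \<in> V then dbar (\<lambda>z. of_real (cutoff ((cmod (z - z0))\<^sup>2 / r)) * H z) z else 0)
       = (\<lambda>z. u z * H z)"
    proof
      fix z show "(if z \<in> V then dbar (\<lambda>z. of_real (cutoff ((cmod (z - z0))\<^sup>2 / r)) * H z) z else 0) = u z * H z"
        using d[of z] uz[of z] subsetD[OF V(2), of z] by (cases "z \<in> V") auto
    qed
    finally show ?case using residue_holo[OF V(1) z0V 0] by simp
  next
    case (Suc n)
    \<comment> \<open>Induction on the pole order: the leading coefficient is split off and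
      \<open>H1\<close> carries a pole of order one less. This is why \<open>H\<close> has to be
      arbitrary in the induction.\<close>
    define H1 where "H1 = (\<lambda>z. if z = z0 then deriv H z0 else (H z - H z0) / (z - z0))"
    have H1: "H1 holomorphic_on V" unfolding H1_def
      by (rule pole_lemma_open) (use Suc V in auto)
    have dec: "H z / (z - z0) ^ Suc n = H z0 / (z - z0) ^ Suc n + H1 z / (z - z0) ^ n" if "z \<noteq> z0" for z
    proof -
      have "H1 z / (z - z0) ^ n = (H z - H z0) / (z - z0) ^ Suc n" using that by (simp add: H1_def)
      thus ?thesis by (simp only: flip: add_divide_distrib) simp
    qed
    have cH: "continuous_on (V - {z0}) (\<lambda>z. H z0 / (z - z0) ^ Suc n)"
       "continuous_on (V - {z0}) (\<lambda>z. H1 z / (z - z0) ^ n)"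
      using continuous_on_subset[OF holomorphic_on_imp_continuous_on[OF H1], of "V - {z0}"]
      by (auto intro!: continuous_intros)
    have "integral UNIV (\<lambda>z. u z * (H z / (z - z0) ^ Suc n)) =
        integral UNIV (\<lambda>z. u z * (H z0 / (z - z0) ^ Suc n) + u z * (H1 z / (z - z0) ^ n))"
    proof (rule integral_cong)
      fix z show "u z * (H z / (z - z0) ^ Suc n) = u z * (H z0 / (z - z0) ^ Suc n) + u z * (H1 z / (z - z0) ^ n)"
      proof (cases "z = z0")
        case False
        show ?thesis by (simp only: dec[OF False] distrib_left)
      qed (simp add: u0)
    qed
    also have "\<dots> = integral UNIV (\<lambda>z. u z * (H z0 / (z - z0) ^ Suc n)) + integral UNIV (\<lambda>z. u z * (H1 z / (z - z0) ^ n))"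
      by (intro integral_add integrable cH)
    also have "integral UNIV (\<lambda>z. u z * (H z0 / (z - z0) ^ Suc n)) =
         integral UNIV (\<lambda>z. u z / (z - z0)) * residue (\<lambda>z. H z0 / (z - z0) ^ Suc n) z0"
    proof -
      have res: "residue (\<lambda>z. H z0 / (z - z0) ^ Suc n) z0 = (deriv ^^ n) (\<lambda>_. H z0) z0 / fact n"
        using residue_holomorphic_over_power[of UNIV z0 "\<lambda>_. H z0" n] by simp
      have "integral UNIV (\<lambda>z. u z * (H z0 / (z - z0) ^ Suc n)) = H z0 * integral UNIV (\<lambda>z. u z / (z - z0) ^ Suc n)"
        by (subst integral_mult_right[symmetric]) (simp add: mult_ac)
      \<comment> \<open>For \<open>n = 0\<close> the residue is the constant \<open>H z0\<close>;
        for larger \<open>n\<close> the derivative of a constant and the rotated integral are both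
        zero.\<close>
      thus ?thesis using res rot by (cases n) (simp_all del: power_Suc add: higher_deriv_const)
    qed
    also have "integral UNIV (\<lambda>z. u z * (H1 z / (z - z0) ^ n)) =
         integral UNIV (\<lambda>z. u z / (z - z0)) * residue (\<lambda>z. H1 z / (z - z0) ^ n) z0"
      by (rule Suc.IH[OF H1])
    also have "integral UNIV (\<lambda>z. u z / (z - z0)) * residue (\<lambda>z. H z0 / (z - z0) ^ Suc n) z0 +
       integral UNIV (\<lambda>z. u z / (z - z0)) * residue (\<lambda>z. H1 z / (z - z0) ^ n) z0 =
       integral UNIV (\<lambda>z. u z / (z - z0)) * residue (\<lambda>z. H z0 / (z - z0) ^ Suc n + H1 z / (z - z0) ^ n) z0"
      by (subst residue_add[OF V(1) z0V])
         (auto intro!: holomorphic_intros holomorphic_on_subset[OF H1] simp: distrib_left)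
    also have "residue (\<lambda>z. H z0 / (z - z0) ^ Suc n + H1 z / (z - z0) ^ n) z0 =
        residue (\<lambda>z. H z / (z - z0) ^ Suc n) z0"
      by (rule residue_cong) (use dec in \<open>auto simp: eventually_at_filter\<close>)
    finally show ?case .
  qed
  show "integral UNIV (\<lambda>z. u z / (z - z0)) \<noteq> 0"
  proof -
    define g where "g = (\<lambda>z. - (2 * cutoff' ((cmod (z - z0))\<^sup>2 / r) / r))"
    have ug: "u z / (z - z0) = of_real (- g z)" for z
    proof (cases "z = z0")
      case False
      have "u z / (z - z0) = of_real (cutoff' ((cmod (z - z0))\<^sup>2 / r)) * (2 / of_real r) * ((z - z0) / (z - z0))"
        unfolding u by (simp only: divide_inverse mult_ac)
      thus ?thesis using False by (simp add: g_def)
    qed (simp add: g_def cutoff'_eq_0)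
    have cg: "continuous_on UNIV g" unfolding g_def using r
      by (intro continuous_intros continuous_on_compose2[OF continuous_on_cutoff'[of UNIV]]) auto
    have gB: "g z = 0" if "z \<notin> B" for z
    proof -
      have "z \<noteq> z0" using that r by (auto simp: B_def)
      thus ?thesis using ug[of z] uz[of z] that by (simp add: B_def)
    qed
    obtain a b where ab: "B \<subseteq> cbox a b"
      using cB bounded_subset_cbox_symmetric compact_imp_bounded by metis
    have gint: "g integrable_on UNIV"
      using compact_support_integrable(1)[OF cg cB gB, of UNIV] by (auto simp: set_lebesgue_integral_eq_integral)
    have "integral UNIV (\<lambda>z. u z / (z - z0)) = - of_real (integral UNIV g)"
      using integral_linear[OF gint bounded_linear_of_real[where 'a = complex]] by (simp add: ug o_def)
    moreover have "integral UNIV g = integral (cbox a b) g"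
      using compact_support_integrable(2)[OF cg cB gB ab] by simp
    moreover have "integral (cbox a b) g \<noteq> 0"
    proof
      assume 0: "integral (cbox a b) g = 0"
      have "ball z0 (sqrt (2 * r)) \<subseteq> cbox a b" using ab by (auto simp: B_def)
      hence "ball z0 (sqrt (2 * r)) \<subseteq> interior (cbox a b)" by (rule interior_maximal) simp
      moreover have "ball z0 (sqrt (2 * r)) \<noteq> {}" using r by simp
      ultimately have "box a b \<noteq> {}" by (simp only: interior_cbox) blast
      hence "\<forall>z\<in>cbox a b. g z = 0"
        using integral_cbox_eq_0_iff[OF continuous_on_subset[OF cg], of a b] 0 cutoff'_nonpos r
        by (auto simp: g_def field_simps)
      \<comment> \<open>At this point the profile has the argument 3/2, the midpoint of its descent,
        where its derivative is strictly negative. A continuous function \<open>g\<close> of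
        constant sign with zero integral would have to vanish there.\<close>
      moreover have "z0 + of_real (sqrt (3/2 * r)) \<in> cbox a b"
        using ab r by (auto simp: B_def dist_norm)
      ultimately have "g (z0 + of_real (sqrt (3/2 * r))) = 0" by blast
      thus False using cutoff'_neg r by (simp add: g_def)
    qed
    ultimately show ?thesis by simp
  qed
qed

section \<open>The residue theorem on a compact Riemann surface\<close>

locale surface =
  fixes X :: "'a topology" and A :: "'a chart set"
  assumes riemann_surface: "riemann_surface X A"
begin

abbreviation chart_img :: "'a chart \<Rightarrow> complex set" where "chart_img c \<equiv> snd c ` fst c"

abbreviation transition :: "'a chart \<Rightarrow> 'a chart \<Rightarrow> complex \<Rightarrow> complex" where
  "transition c c' \<equiv> in_chart c (snd c')"

lemma Hausdorff: "Hausdorff_space X"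
  and charts_cover: "(\<Union>c\<in>A. fst c) = topspace X"
  using riemann_surface by (auto simp: riemann_surface_def)

lemma
  assumes "c \<in> A"
  shows open_chart_dom: "openin X (fst c)"
    and open_chart_img: "open (chart_img c)"
    and chart_homeo: "homeomorphic_map (subtopology X (fst c)) (top_of_set (chart_img c)) (snd c)"
    and chart_inj: "inj_on (snd c) (fst c)"
    and chart_subset: "fst c \<subseteq> topspace X"
proof -
  show a: "openin X (fst c)" "open (chart_img c)"
       "homeomorphic_map (subtopology X (fst c)) (top_of_set (chart_img c)) (snd c)"
    using riemann_surface assms by (auto simp: riemann_surface_def)
  show "fst c \<subseteq> topspace X" using a(1) by (simp add: openin_subset)
  thus "inj_on (snd c) (fst c)"
    using homeomorphic_imp_injective_map[OF a(3)] by (simp add: Int_absorb1)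
qed

lemma in_chart_eq:
  assumes "c \<in> A" "p \<in> fst c" shows "in_chart c f (snd c p) = f p"
  using inv_into_f_f[OF chart_inj[OF assms(1)] assms(2)] by (simp add: in_chart_def)

lemma open_image_chart:
  assumes "c \<in> A" "openin X W" shows "open (snd c ` (fst c \<inter> W))"
proof -
  have "openin (subtopology X (fst c)) (fst c \<inter> W)"
    using assms by (metis inf_commute openin_subtopology)
  hence "openin (top_of_set (chart_img c)) (snd c ` (fst c \<inter> W))"
    using homeomorphic_imp_open_map[OF chart_homeo[OF assms(1)]] by (simp add: open_map_def)
  thus ?thesis using open_chart_img[OF assms(1)] openin_open_eq by blast
qed

lemma open_vimage_chart:
  assumes "c \<in> A" "open W" shows "openin X {p \<in> fst c. snd c p \<in> W}"
proof -
  have "openin (top_of_set (chart_img c)) (chart_img c \<inter> W)" using assms by auto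
  hence "openin (subtopology X (fst c)) {p \<in> topspace (subtopology X (fst c)). snd c p \<in> chart_img c \<inter> W}"
    using homeomorphic_imp_continuous_map[OF chart_homeo[OF assms(1)]] openin_continuous_map_preimage by blast
  moreover have "{p \<in> topspace (subtopology X (fst c)). snd c p \<in> chart_img c \<inter> W} = {p \<in> fst c. snd c p \<in> W}"
    using chart_subset[OF assms(1)] by auto
  ultimately show ?thesis using open_chart_dom[OF assms(1)] openin_trans_full by metis
qed

lemma compact_image_chart:
  assumes "c \<in> A" "compactin X K" "K \<subseteq> fst c" shows "compact (snd c ` K)"
proof -
  have "compactin (subtopology X (fst c)) K" using assms by (simp add: compactin_subtopology)
  hence "compactin (top_of_set (chart_img c)) (snd c ` K)"
    using image_compactin homeomorphic_imp_continuous_map[OF chart_homeo[OF assms(1)]] by blast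
  thus ?thesis by (simp add: compactin_subtopology)
qed

lemma compact_vimage_chart:
  assumes "c \<in> A" "compact K" "K \<subseteq> chart_img c" shows "compactin X {p \<in> fst c. snd c p \<in> K}"
proof -
  let ?L = "{p \<in> fst c. snd c p \<in> K}"
  have im: "snd c ` ?L = K" using assms(3) by auto
  have "compactin (top_of_set (chart_img c)) (snd c ` ?L)"
    using assms by (simp add: im compactin_subtopology)
  moreover have "?L \<subseteq> topspace (subtopology X (fst c))" using chart_subset[OF assms(1)] by auto
  ultimately have "compactin (subtopology X (fst c)) ?L"
    using homeomorphic_map_compactness[OF chart_homeo[OF assms(1)]] by blast
  thus ?thesis by (simp add: compactin_subtopology)
qed

lemma transition_eq: "c \<in> A \<Longrightarrow> p \<in> fst c \<Longrightarrow> transition c c' (snd c p) = snd c' p"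
  by (rule in_chart_eq)

lemma transition_holomorphic:
  assumes "c \<in> A" "c' \<in> A" shows "transition c c' holomorphic_on (snd c ` (fst c \<inter> fst c'))"
  using riemann_surface assms by (auto simp: riemann_surface_def)

lemma open_overlap: "c \<in> A \<Longrightarrow> c' \<in> A \<Longrightarrow> open (snd c ` (fst c \<inter> fst c'))"
  by (rule open_image_chart) (auto intro: open_chart_dom)

lemma transition_inj:
  assumes "c \<in> A" "c' \<in> A" shows "inj_on (transition c c') (snd c ` (fst c \<inter> fst c'))"
proof (rule inj_onI)
  fix w z assume "w \<in> snd c ` (fst c \<inter> fst c')" "z \<in> snd c ` (fst c \<inter> fst c')" "transition c c' w = transition c c' z"
  then obtain p q where pq: "p \<in> fst c \<inter> fst c'" "q \<in> fst c \<inter> fst c'" "w = snd c p" "z = snd c q" by auto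
  hence "snd c' p = snd c' q" using \<open>transition c c' w = transition c c' z\<close> assms by (simp add: transition_eq)
  thus "w = z" using pq chart_inj[OF assms(2)] by (auto simp: inj_on_def)
qed

lemma transition_image:
  assumes "c \<in> A" "W \<subseteq> fst c" shows "transition c c' ` snd c ` W = snd c' ` W"
  using assms by (auto simp: image_image transition_eq subset_iff intro!: image_cong)

lemma transition_deriv_nonzero:
  assumes "c \<in> A" "c' \<in> A" "p \<in> fst c" "p \<in> fst c'" shows "deriv (transition c c') (snd c p) \<noteq> 0"
  using holomorphic_injective_imp_regular[OF transition_holomorphic[OF assms(1,2)] open_overlap[OF assms(1,2)]
     transition_inj[OF assms(1,2)]] assms by blast

lemma in_chart_trans:
  assumes "c \<in> A" "c' \<in> A" "z \<in> snd c ` (fst c \<inter> fst c')"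
  shows "in_chart c f z = in_chart c' f (transition c c' z)"
  using assms by (auto simp: in_chart_eq)

section \<open>Differentiable functions and bump functions on the surface\<close>

definition C1_fun :: "('a \<Rightarrow> complex) \<Rightarrow> bool" where
  "C1_fun f \<longleftrightarrow> (\<forall>c\<in>A. C1_on (chart_img c) (in_chart c f))"

lemma C1_fun_chart: "C1_fun f \<Longrightarrow> c \<in> A \<Longrightarrow> C1_on (chart_img c) (in_chart c f)"
  by (simp add: C1_fun_def)

lemma C1_fun_differentiable:
  "C1_fun f \<Longrightarrow> c \<in> A \<Longrightarrow> z \<in> chart_img c \<Longrightarrow> in_chart c f differentiable at z"
  using C1_fun_chart[of f c] unfolding C1_on_def by blast

lemma C1_fun_intros:
  "C1_fun (\<lambda>_. a)"
  "C1_fun f \<Longrightarrow> C1_fun g \<Longrightarrow> C1_fun (\<lambda>p. f p + g p)"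
  "C1_fun f \<Longrightarrow> C1_fun g \<Longrightarrow> C1_fun (\<lambda>p. f p * g p)"
  using C1_on_const C1_on_add C1_on_mult
  by (auto simp: C1_fun_def in_chart_def [abs_def])

lemma C1_fun_sum: "(\<And>i. i \<in> I \<Longrightarrow> C1_fun (f i)) \<Longrightarrow> C1_fun (\<lambda>p. \<Sum>i\<in>I. f i p)"
  unfolding C1_fun_def in_chart_def [abs_def] by (intro ballI C1_on_sum) blast

lemma C1_fun_inverse:
  assumes "C1_fun f" "\<And>p. p \<in> topspace X \<Longrightarrow> f p \<noteq> 0" shows "C1_fun (\<lambda>p. inverse (f p))"
  unfolding C1_fun_def
proof
  fix c assume c: "c \<in> A"
  have "in_chart c f z \<noteq> 0" if "z \<in> chart_img c" for z
    using that c assms(2) chart_subset[OF c] by (auto simp: in_chart_eq)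
  hence "C1_on (chart_img c) (\<lambda>z. inverse (in_chart c f z))"
    using C1_on_inverse[OF C1_fun_chart[OF assms(1) c]] by blast
  thus "C1_on (chart_img c) (in_chart c (\<lambda>p. inverse (f p)))" by (simp add: in_chart_def [abs_def])
qed

lemma open_support:
  assumes "C1_fun f" shows "openin X {p \<in> topspace X. f p \<noteq> 0}"
proof -
  have "openin X {p \<in> fst c. f p \<noteq> 0}" if c: "c \<in> A" for c
  proof -
    have "continuous_on (chart_img c) (in_chart c f)"
      using C1_on_imp_continuous_on C1_fun_chart[OF assms c] by blast
    hence "open (chart_img c \<inter> in_chart c f -` (- {0}))"
      using open_chart_img[OF c] by (intro continuous_open_preimage) auto
    from open_vimage_chart[OF c this] have "openin X {p \<in> fst c. in_chart c f (snd c p) \<noteq> 0}"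
      by (rule back_subst[of "openin X"]) auto
    moreover have "{p \<in> fst c. in_chart c f (snd c p) \<noteq> 0} = {p \<in> fst c. f p \<noteq> 0}"
      using in_chart_eq[OF c, where f = f] by auto
    ultimately show ?thesis by simp
  qed
  hence "openin X (\<Union>c\<in>A. {p \<in> fst c. f p \<noteq> 0})" by blast
  moreover have "(\<Union>c\<in>A. {p \<in> fst c. f p \<noteq> 0}) = {p \<in> topspace X. f p \<noteq> 0}"
    using charts_cover by auto
  ultimately show ?thesis by simp
qed

definition ext :: "'a chart \<Rightarrow> (complex \<Rightarrow> complex) \<Rightarrow> 'a \<Rightarrow> complex" where
  "ext c g p = (if p \<in> fst c then g (snd c p) else 0)"

text \<open>In another chart the image is covered by the overlap with \<open>c\<close>, where the
  extension is a composition with a transition map, and by the image of the complement of the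
  support, where it is zero. That complement is open because compact sets are closed in a Hausdorff
  space.\<close>

lemma C1_fun_ext:
  assumes c: "c \<in> A" and g: "C1_on (chart_img c) g"
    and K: "compact K" "K \<subseteq> chart_img c" "\<And>z. z \<in> chart_img c \<Longrightarrow> z \<notin> K \<Longrightarrow> g z = 0"
  shows "C1_fun (ext c g)"
  unfolding C1_fun_def
proof
  fix c' assume c': "c' \<in> A"
  define L where "L = {p \<in> fst c. snd c p \<in> K}"
  define W where "W = snd c' ` (fst c' \<inter> fst c)"
  define N where "N = snd c' ` (fst c' \<inter> (topspace X - L))"
  have "closedin X L" unfolding L_def
    using compactin_imp_closedin[OF Hausdorff compact_vimage_chart[OF c K(1,2)]] .
  hence N: "open N" unfolding N_def by (intro open_image_chart c') auto
  have W: "open W" unfolding W_def by (intro open_image_chart c' open_chart_dom c)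
  have "C1_on (W \<union> N) (in_chart c' (ext c g))"
  proof (rule C1_on_Un[OF _ _ W N])
    have "C1_on W (\<lambda>z. g (transition c' c z))"
    proof (rule C1_on_compose_holomorphic[OF _ W g])
      show "transition c' c holomorphic_on W" unfolding W_def by (rule transition_holomorphic[OF c' c])
      show "transition c' c ` W \<subseteq> chart_img c" unfolding W_def using c' by (auto simp: transition_eq)
    qed
    thus "C1_on W (in_chart c' (ext c g))"
      by (rule C1_on_cong_open[OF _ W]) (use c' in \<open>auto simp: W_def in_chart_eq transition_eq ext_def\<close>)
    have K0: "g (snd c p) = 0" if "p \<in> fst c" "snd c p \<notin> K" for p using K(3) that by blast
    show "C1_on N (in_chart c' (ext c g))"
    proof (rule C1_on_cong_open[OF C1_on_const[of _ 0] N])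
      fix z assume "z \<in> N"
      then obtain p where p: "p \<in> fst c'" "p \<notin> L" "z = snd c' p" by (auto simp: N_def)
      have "ext c g p = 0" using p(2) K0[of p] by (cases "p \<in> fst c") (auto simp: ext_def L_def)
      thus "0 = in_chart c' (ext c g) z" using p c' by (simp add: in_chart_eq)
    qed
  qed
  moreover have "W \<union> N = chart_img c'" using chart_subset[OF c'] by (auto simp: W_def N_def L_def)
  ultimately show "C1_on (chart_img c') (in_chart c' (ext c g))" by simp
qed

text \<open>The values are kept real and nonnegative so that finite sums of such functions cannot
  cancel.\<close>

lemma bump_exists:
  assumes c: "c \<in> A" and q: "q \<in> fst c"
  obtains f K where "C1_fun f" "\<And>p. \<exists>t\<ge>0. f p = of_real t" "f q \<noteq> 0"
    "compactin X K" "K \<subseteq> fst c" "\<And>p. p \<notin> K \<Longrightarrow> f p = 0"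
proof -
  obtain e where e: "e > 0" "cball (snd c q) e \<subseteq> chart_img c"
    using open_chart_img[OF c] q open_contains_cball by blast
  define g where "g = (\<lambda>z. complex_of_real (ramp (1 - (cmod (z - snd c q))\<^sup>2 / e\<^sup>2)))"
  have C1: "C1_on S g" for S unfolding g_def
  proof (rule C1_on_radial[where q' = "\<lambda>t. - (2 * max 0 (1 - t))"])
    show "((\<lambda>t. ramp (1 - t)) has_real_derivative - (2 * max 0 (1 - t))) (at t)" for t
    proof -
      have "((\<lambda>t. 1 - t) has_real_derivative - 1) (at t)" by (auto intro!: derivative_eq_intros)
      from DERIV_chain'[OF this has_real_derivative_ramp] show ?thesis by simp
    qed
  qed (intro continuous_intros)
  have z: "g z = 0" if "z \<notin> cball (snd c q) e" for z
  proof -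
    have "cmod (z - snd c q) \<ge> e" using that by (simp add: dist_norm norm_minus_commute)
    hence "(cmod (z - snd c q))\<^sup>2 / e\<^sup>2 \<ge> 1" using e(1) power_mono[of e "cmod (z - snd c q)" 2] by simp
    thus ?thesis by (simp add: g_def ramp_def)
  qed
  show ?thesis
  proof (rule that[of "ext c g" "{p \<in> fst c. snd c p \<in> cball (snd c q) e}"])
    show "C1_fun (ext c g)" by (rule C1_fun_ext[OF c C1 compact_cball e(2)]) (use z in auto)
    show "\<exists>t\<ge>0. ext c g p = of_real t" for p
    proof (cases "p \<in> fst c")
      case True thus ?thesis by (auto simp: ext_def g_def ramp_def intro!: exI[of _ "ramp _"] simp del: of_real_power)
    qed (auto simp: ext_def intro!: exI[of _ 0])
    show "ext c g q \<noteq> 0" using q by (simp add: ext_def g_def ramp_def)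
    show "compactin X {p \<in> fst c. snd c p \<in> cball (snd c q) e}"
      by (rule compact_vimage_chart[OF c compact_cball e(2)])
    show "ext c g p = 0" if "p \<notin> {p \<in> fst c. snd c p \<in> cball (snd c q) e}" for p
      using that z[of "snd c p"] by (auto simp: ext_def)
  qed auto
qed

lemma dbar_locally_constant:
  assumes c: "c \<in> A" and p: "p \<in> fst c" and N: "openin X N" "p \<in> N" "\<And>q. q \<in> N \<Longrightarrow> v q = a"
  shows "dbar (in_chart c v) (snd c p) = 0"
proof -
  have "dbar (in_chart c v) (snd c p) = dbar (\<lambda>_. a) (snd c p)"
    by (rule dbar_cong_open[OF open_image_chart[OF c N(1)]]) (use c p N in \<open>auto simp: in_chart_eq\<close>)
  thus ?thesis by simp
qed

end

text \<open>Coefficients are functions on the chart images and obey the chain rule at every point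
  other than \<open>P\<close>. Those of a \<open>form\<close> may be meaningless on a whole
  exceptional set, so this locale is instantiated after the removable singularities have been filled
  in.\<close>

locale punctured_form = surface X A
  for X :: "'a topology" and A :: "'a chart set" +
  fixes P :: 'a and F :: "'a chart \<Rightarrow> complex \<Rightarrow> complex"
  assumes P: "P \<in> topspace X"
    and F_holomorphic: "\<And>c. c \<in> A \<Longrightarrow> F c holomorphic_on snd c ` (fst c - {P})"
    and F_trans: "\<And>c c' p. c \<in> A \<Longrightarrow> c' \<in> A \<Longrightarrow> p \<in> fst c \<inter> fst c' - {P} \<Longrightarrow>
       F c (snd c p) = F c' (snd c' p) * deriv (transition c c') (snd c p)"
begin

text \<open>In the chart \<open>c\<close>, this is the coefficient of the 2-form \<open>u dv \<and> \<omega>\<close> up to a constant factor.\<close>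

definition pairing :: "'a chart \<Rightarrow> ('a \<Rightarrow> complex) \<Rightarrow> ('a \<Rightarrow> complex) \<Rightarrow> complex \<Rightarrow> complex" where
  "pairing c u v z = (if z \<in> chart_img c then in_chart c u z * dbar (in_chart c v) z * F c z else 0)"

lemma pairing_chart:
  "c \<in> A \<Longrightarrow> p \<in> fst c \<Longrightarrow> pairing c u v (snd c p) = u p * dbar (in_chart c v) (snd c p) * F c (snd c p)"
  by (simp add: pairing_def in_chart_eq)

lemma open_punctured: "c \<in> A \<Longrightarrow> open (snd c ` (fst c - {P}))"
proof -
  assume c: "c \<in> A"
  have "closedin X {P}" using Hausdorff P by (simp add: closedin_Hausdorff_singleton)
  hence "open (snd c ` (fst c \<inter> (topspace X - {P})))" by (intro open_image_chart c) auto
  moreover have "fst c \<inter> (topspace X - {P}) = fst c - {P}" using chart_subset[OF c] by auto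
  ultimately show ?thesis by simp
qed

text \<open>Where \<open>v\<close> is constant its derivative vanishes, which masks the singularity
  of the form at \<open>P\<close>. The neighbourhood is a parameter because it has to be cut out of
  the support.\<close>

definition const_near_P :: "('a \<Rightarrow> complex) \<Rightarrow> 'a set \<Rightarrow> bool" where
  "const_near_P v N \<longleftrightarrow> openin X N \<and> P \<in> N \<and> (\<exists>a. \<forall>p\<in>N. v p = a)"

definition supported_in :: "('a \<Rightarrow> complex) \<Rightarrow> 'a set \<Rightarrow> bool" where
  "supported_in u K \<longleftrightarrow> compactin X K \<and> (\<forall>p. p \<notin> K \<longrightarrow> u p = 0)"

text \<open>The factor \<open>u\<close> vanishes outside \<open>Ku\<close>, and the derivative of
  \<open>v\<close> vanishes outside \<open>Kv\<close> and inside \<open>N\<close>; removing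
  \<open>N\<close> keeps the compact support off the pole.\<close>

lemma pairing_support:
  assumes c: "c \<in> A" and uv: "const_near_P v N" and K: "supported_in u Ku" "supported_in v Kv" "Ku \<inter> Kv \<subseteq> fst c"
  shows "compact (snd c ` (Ku \<inter> Kv - N))"
    and "z \<notin> snd c ` (Ku \<inter> Kv - N) \<Longrightarrow> pairing c u v z = 0"
proof -
  have cu: "compactin X Ku" "compactin X Kv" and z: "\<And>p. p \<notin> Ku \<Longrightarrow> u p = 0" "\<And>p. p \<notin> Kv \<Longrightarrow> v p = 0"
    using K by (auto simp: supported_in_def)
  have cl: "closedin X Ku" "closedin X Kv" using compactin_imp_closedin[OF Hausdorff] cu by auto
  have N: "openin X N" using uv by (simp add: const_near_P_def)
  have "compactin X (Ku \<inter> Kv - N)"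
    by (rule closed_compactin[OF cu(1)]) (use cl N in \<open>auto intro!: closedin_diff\<close>)
  thus "compact (snd c ` (Ku \<inter> Kv - N))" using K(3) by (intro compact_image_chart c) auto
  show "pairing c u v z = 0" if "z \<notin> snd c ` (Ku \<inter> Kv - N)" for z
  proof (cases "z \<in> chart_img c")
    case True
    then obtain p where p: "p \<in> fst c" "z = snd c p" by auto
    with that have "p \<notin> Ku \<or> p \<notin> Kv \<or> p \<in> N" by auto
    moreover have "dbar (in_chart c v) z = 0" if "p \<in> N"
      using uv that dbar_locally_constant[OF c p(1) N] p by (auto simp: const_near_P_def)
    moreover have "dbar (in_chart c v) z = 0" if "p \<notin> Kv"
    proof -
      have "openin X (topspace X - Kv)" using cl by auto
      from dbar_locally_constant[OF c p(1) this, of v 0] that show ?thesis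
        using chart_subset[OF c] p z(2) by auto
    qed
    ultimately show ?thesis using z(1)[of p] p by (auto simp: pairing_chart[OF c])
  qed (simp add: pairing_def)
qed

lemma pairing_continuous:
  assumes c: "c \<in> A" and uv: "const_near_P v N" and C1: "C1_fun u" "C1_fun v"
    and K: "supported_in u Ku" "supported_in v Kv" "Ku \<inter> Kv \<subseteq> fst c"
  shows "continuous_on UNIV (pairing c u v)"
proof -
  let ?V = "snd c ` (fst c - {P})" and ?K = "snd c ` (Ku \<inter> Kv - N)"
  note supp = pairing_support[OF c uv K]
  have "continuous_on UNIV (\<lambda>z. if z \<in> ?V then pairing c u v z else 0)"
  proof (rule continuous_on_zero_extension[OF open_punctured[OF c] _ supp(1)])
    have "continuous_on ?V (\<lambda>z. in_chart c u z * dbar (in_chart c v) z * F c z)"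
      using C1_on_imp_continuous_on[OF C1_fun_chart[OF C1(1) c]] C1_on_dbar[OF C1_fun_chart[OF C1(2) c]]
        holomorphic_on_imp_continuous_on[OF F_holomorphic[OF c]]
      by (intro continuous_intros) (auto elim: continuous_on_subset)
    thus "continuous_on ?V (pairing c u v)"
      by (rule continuous_on_eq) (auto simp: pairing_def)
    show "?K \<subseteq> ?V" using K(3) uv by (auto simp: const_near_P_def)
  qed (use supp(2) in auto)
  moreover have "(\<lambda>z. if z \<in> ?V then pairing c u v z else 0) = pairing c u v"
  proof
    fix z
    have "z \<in> ?V" if "z \<in> ?K" using that K(3) uv by (auto simp: const_near_P_def)
    thus "(if z \<in> ?V then pairing c u v z else 0) = pairing c u v z"
      using supp(2)[of z] by auto
  qed
  ultimately show ?thesis by (simp only:)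
qed

lemma pairing_integrable:
  assumes c: "c \<in> A" and uv: "const_near_P v N" and C1: "C1_fun u" "C1_fun v"
    and K: "supported_in u Ku" "supported_in v Kv" "Ku \<inter> Kv \<subseteq> fst c"
  shows "pairing c u v integrable_on UNIV"
  using compact_support_integrable(1)[OF pairing_continuous[OF assms] pairing_support(1)[OF c uv K], where S = UNIV]
    pairing_support(2)[OF c uv K] by (auto simp: set_lebesgue_integral_eq_integral)

text \<open>The derivative of \<open>v\<close> contributes the conjugate of the derivative of the
  transition map and the coefficient of the form contributes that derivative itself; the product is
  the real Jacobian determinant.\<close>

lemma pairing_change_chart:
  assumes c: "c \<in> A" "c' \<in> A" and uv: "const_near_P v N" and C1: "C1_fun u" "C1_fun v"
    and K: "supported_in u Ku" "supported_in v Kv" "Ku \<inter> Kv \<subseteq> fst c \<inter> fst c'"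
  shows "integral UNIV (pairing c u v) = integral UNIV (pairing c' u v)"
proof -
  have K3: "Ku \<inter> Kv \<subseteq> fst c" "Ku \<inter> Kv \<subseteq> fst c'" using K by auto
  let ?W = "snd c ` (fst c \<inter> fst c')"
  note s = pairing_support[OF c(1) uv K(1,2) K3(1)]
  note s' = pairing_support[OF c(2) uv K(1,2) K3(2)]
  show ?thesis
  proof (rule holomorphic_change_of_variables[OF open_overlap[OF c] transition_holomorphic[OF c] transition_inj[OF c]])
    show "snd c' ` (Ku \<inter> Kv - N) \<subseteq> transition c c' ` ?W"
      using K3 by (subst transition_image[OF c(1)]) auto
    show "snd c ` (Ku \<inter> Kv - N) \<subseteq> ?W" using K3 by auto
    fix z assume "z \<in> ?W"
    then obtain p where p: "p \<in> fst c" "p \<in> fst c'" "z = snd c p" by auto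
    show "pairing c u v z = (cmod (deriv (transition c c') z))\<^sup>2 *\<^sub>R pairing c' u v (transition c c' z)"
    \<comment> \<open>At \<open>P\<close> no chain rule for \<open>F\<close> is available, but both
      sides are zero because \<open>v\<close> is constant nearby.\<close>
    proof (cases "p = P")
      case True
      hence "pairing c u v z = 0" "pairing c' u v (snd c' p) = 0"
        using uv dbar_locally_constant[OF c(1) p(1), of N v] dbar_locally_constant[OF c(2) p(2), of N v] p
        by (auto simp: const_near_P_def pairing_chart c)
      thus ?thesis using p by (simp add: transition_eq c)
    next
      case False
      have "dbar (in_chart c v) z = dbar (\<lambda>z. in_chart c' v (transition c c' z)) z"
        by (rule dbar_cong_open[OF open_overlap[OF c]]) (use p in \<open>auto intro: in_chart_trans[OF c]\<close>)
      also have "\<dots> = cnj (deriv (transition c c') z) * dbar (in_chart c' v) (transition c c' z)"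
        by (rule dbar_compose_holomorphic[OF transition_holomorphic[OF c] open_overlap[OF c]])
           (use p c C1_fun_differentiable[OF C1(2) c(2)] in \<open>auto simp: transition_eq\<close>)
      finally have "pairing c u v z =
         (deriv (transition c c') z * cnj (deriv (transition c c') z)) * pairing c' u v (transition c c' z)"
        using p False by (simp add: pairing_chart c transition_eq F_trans[OF c])
      thus ?thesis by (simp only: complex_norm_square[symmetric] scaleR_conv_of_real)
    qed
  qed (use s s' pairing_continuous[OF c(1) uv C1 K(1,2) K3(1)]
      pairing_continuous[OF c(2) uv C1 K(1,2) K3(2)] in auto)
qed

text \<open>A holomorphic form is closed, so the integrand is the exterior derivative of
  \<open>v\<close> times the form. Since \<open>v\<close> vanishes near \<open>P\<close>, this
  product has compact support in the punctured chart and Stokes applies.\<close>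

lemma integral_pairing_eq_0:
  assumes c: "c \<in> A" and v: "C1_fun v" and N: "openin X N" "P \<in> N" "\<And>p. p \<in> N \<Longrightarrow> v p = 0"
    and K: "supported_in v K" "K \<subseteq> fst c"
  shows "integral UNIV (pairing c (\<lambda>_. 1) v) = 0"
proof -
  let ?V = "snd c ` (fst c - {P})"
  have C1v: "C1_on ?V (in_chart c v)" by (rule C1_on_subset[OF C1_fun_chart[OF v c]]) auto
  have "integral UNIV (\<lambda>z. if z \<in> ?V then dbar (\<lambda>z. in_chart c v z * F c z) z else 0) = 0"
  proof (rule integral_dbar_eq_0[OF open_punctured[OF c]])
    show "C1_on ?V (\<lambda>z. in_chart c v z * F c z)"
      by (intro C1_on_mult C1v C1_on_holomorphic F_holomorphic open_punctured c)
    have cK: "compactin X K" using K by (simp add: supported_in_def)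
    have "compactin X (K - N)"
      by (rule closed_compactin[OF cK])
         (use compactin_imp_closedin[OF Hausdorff cK] N(1) in \<open>auto intro!: closedin_diff\<close>)
    thus "compact (snd c ` (K - N))" using K(2) by (intro compact_image_chart c) auto
    show "snd c ` (K - N) \<subseteq> ?V" using K(2) N(2) by auto
    show "in_chart c v z * F c z = 0" if z: "z \<in> ?V" "z \<notin> snd c ` (K - N)" for z
    proof -
      obtain p where p: "p \<in> fst c" "z = snd c p" using z by auto
      hence "p \<notin> K \<or> p \<in> N" using z by auto
      hence "v p = 0" using N(3) K by (auto simp: supported_in_def)
      thus ?thesis using p c by (simp add: in_chart_eq)
    qed
  qed
  also have "(\<lambda>z. if z \<in> ?V then dbar (\<lambda>z. in_chart c v z * F c z) z else 0) = pairing c (\<lambda>_. 1) v"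
  proof
    fix z
    show "(if z \<in> ?V then dbar (\<lambda>z. in_chart c v z * F c z) z else 0) = pairing c (\<lambda>_. 1) v z"
    proof (cases "z \<in> ?V")
      case True
      have "F c differentiable at z"
        using C1_on_holomorphic[OF F_holomorphic[OF c] open_punctured[OF c]] True by (auto simp: C1_on_def)
      moreover have "in_chart c v differentiable at z" using C1v True by (auto simp: C1_on_def)
      ultimately have "dbar (\<lambda>z. in_chart c v z * F c z) z = dbar (in_chart c v) z * F c z"
        using dbar_holomorphic[OF F_holomorphic[OF c] open_punctured[OF c] True] by (simp add: dbar_mult)
      thus ?thesis using True by (auto simp: pairing_chart[OF c])
    next
      case False
      have "pairing c (\<lambda>_. 1) v z = 0"
      proof (cases "z \<in> chart_img c")
        case True
        hence "P \<in> fst c" "z = snd c P" using False by auto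
        thus ?thesis using dbar_locally_constant[OF c _ N(1,2), of v 0] N(3) by (simp add: pairing_chart[OF c])
      qed (simp add: pairing_def)
      thus ?thesis using False by simp
    qed
  qed
  finally show ?thesis .
qed

end

section \<open>Functions for a partition of unity\<close>

context surface
begin

text \<open>A partition of unity before normalization. At each point all values are nonnegative and
  one is positive, so the sum may be inverted.\<close>

lemma finite_bump_cover:
  assumes "compact_space X"
  obtains Q C K and f :: "'a \<Rightarrow> 'a \<Rightarrow> complex" where "finite Q"
    "\<And>q. q \<in> Q \<Longrightarrow> C q \<in> A" "\<And>q. q \<in> Q \<Longrightarrow> C1_fun (f q)"
    "\<And>q. q \<in> Q \<Longrightarrow> compactin X (K q)" "\<And>q. q \<in> Q \<Longrightarrow> K q \<subseteq> fst (C q)"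
    "\<And>q p. q \<in> Q \<Longrightarrow> p \<notin> K q \<Longrightarrow> f q p = 0"
    "\<And>p. p \<in> topspace X \<Longrightarrow> (\<Sum>q\<in>Q. f q p) \<noteq> 0"
proof -
  \<comment> \<open>Chart, bump function and support are bundled into one triple, so that a single
    choice for each point provides all three.\<close>
  define good where "good = (\<lambda>q (c, f, K). c \<in> A \<and> C1_fun f \<and> (\<forall>p. \<exists>t\<ge>0. f p = of_real t) \<and> f q \<noteq> 0 \<and>
    compactin X K \<and> K \<subseteq> fst c \<and> (\<forall>p. p \<notin> K \<longrightarrow> f p = 0))"
  have "\<exists>t. good q t" if "q \<in> topspace X" for q
  proof -
    have "q \<in> (\<Union>c\<in>A. fst c)" unfolding charts_cover by (rule that)
    then obtain c where c: "c \<in> A" "q \<in> fst c" by blast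
    show ?thesis
    proof (rule bump_exists[OF c])
      fix f K
      assume "C1_fun f" "\<And>p. \<exists>t\<ge>0. f p = of_real t" "f q \<noteq> 0"
        "compactin X K" "K \<subseteq> fst c" "\<And>p. p \<notin> K \<Longrightarrow> f p = 0"
      hence "good q (c, f, K)" using c(1) by (simp add: good_def)
      thus ?thesis by (rule exI)
    qed
  qed
  then obtain T where T: "\<And>q. q \<in> topspace X \<Longrightarrow> good q (T q)" by metis
  define C f K where "C = (\<lambda>q. fst (T q))" and "f = (\<lambda>q. fst (snd (T q)))" and "K = (\<lambda>q. snd (snd (T q)))"
  have 1: "C q \<in> A \<and> C1_fun (f q) \<and>
     (\<forall>p. \<exists>t\<ge>0. f q p = of_real t) \<and> f q q \<noteq> 0 \<and>
    compactin X (K q) \<and> K q \<subseteq> fst (C q) \<and> (\<forall>p. p \<notin> K q \<longrightarrow> f q p = 0)" if "q \<in> topspace X" for q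
    using T[OF that] by (simp add: good_def C_def f_def K_def split: prod.splits)
  let ?U = "\<lambda>q. {p \<in> topspace X. f q p \<noteq> 0}"
  have "\<exists>\<F>. finite \<F> \<and> \<F> \<subseteq> ?U ` topspace X \<and> topspace X \<subseteq> \<Union>\<F>"
  proof (rule compactinD)
    show "compactin X (topspace X)" using assms by (simp add: compact_space_def)
    show "openin X U" if "U \<in> ?U ` topspace X" for U using that 1 open_support by blast
    show "topspace X \<subseteq> \<Union>(?U ` topspace X)" using 1 by blast
  qed
  then obtain \<F> where "finite \<F>" "\<F> \<subseteq> ?U ` topspace X" and cov: "topspace X \<subseteq> \<Union>\<F>" by blast
  then obtain Q where Q': "Q \<subseteq> topspace X" "finite Q" "\<F> = ?U ` Q" using finite_subset_image by meson
  have Q: "finite Q" "Q \<subseteq> topspace X" "topspace X \<subseteq> (\<Union>q\<in>Q. ?U q)" using Q' cov by blast+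
  show ?thesis
  proof (rule that[of Q C f K])
    fix p assume p: "p \<in> topspace X"
    obtain q where q: "q \<in> Q" "f q p \<noteq> 0" using p Q by blast
    have t: "\<exists>t\<ge>0. f q p = of_real t" if "q \<in> Q" for q using 1 that Q(2) by blast
    have re: "Re (f q p) \<ge> 0" if "q \<in> Q" for q using t[OF that] by auto
    have "Re (f q p) \<noteq> 0" using t[OF q(1)] q(2) by auto
    hence "Re (f q p) > 0" using re[OF q(1)] by simp
    hence "(\<Sum>q\<in>Q. Re (f q p)) > 0" using re q Q(1) by (intro sum_pos2[of Q q]) auto
    hence "Re (\<Sum>q\<in>Q. f q p) > 0" by (simp only: Re_sum)
    thus "(\<Sum>q\<in>Q. f q p) \<noteq> 0" by (metis less_irrefl zero_complex.sel(1))
  next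
    show "finite Q" by fact
    fix q assume "q \<in> Q"
    hence q: "q \<in> topspace X" using Q by blast
    show "C q \<in> A" "C1_fun (f q)" "compactin X (K q)" "K q \<subseteq> fst (C q)" using 1[OF q] by blast+
    show "f q p = 0" if "p \<notin> K q" for p using 1[OF q] that by blast
  qed
qed

end

section \<open>The residue theorem for a single pole\<close>

context punctured_form
begin

text \<open>The derivatives of a partition of unity add up to zero, but the resulting 2-forms are
  integrated in different charts. Inserting the partition a second time gives terms indexed by
  pairs, each supported in the overlap of two charts and therefore movable from one to the other;
  then the sum over the differentiated index can be taken in a single chart.\<close>

theorem residue_puncture_eq_0:
  assumes cpt: "compact_space X" and c0: "c0 \<in> A" "P \<in> fst c0"
    and mero: "F c0 meromorphic_on {snd c0 P}"
  shows "residue (F c0) (snd c0 P) = 0"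
proof -
  define z0 where "z0 = snd c0 P"
  obtain n h where h: "h analytic_on {z0}" "\<forall>\<^sub>F z in at z0. F c0 z = (z - z0) powi (- int n) * h z"
    using meromorphic_imp_order_at_least[OF mero] by (auto simp: order_at_least_def z0_def)
  obtain V1 where V1: "open V1" "z0 \<in> V1" "h holomorphic_on V1" using h(1) by (auto simp: analytic_at)
  obtain V2 where V2: "open V2" "z0 \<in> V2" "\<And>z. z \<in> V2 \<Longrightarrow> z \<noteq> z0 \<Longrightarrow> F c0 z = (z - z0) powi (- int n) * h z"
    using h(2) by (auto simp: eventually_at_topological)
  define V where "V = V1 \<inter> V2 \<inter> chart_img c0"
  have V: "open V" "z0 \<in> V" using V1 V2 open_chart_img[OF c0(1)] c0(2) by (auto simp: V_def z0_def)
  have hV: "h holomorphic_on V" using V1(3) by (rule holomorphic_on_subset) (auto simp: V_def)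
  have FV: "F c0 z = h z / (z - z0) ^ n" if "z \<in> V" "z \<noteq> z0" for z
    using V2(3)[of z] that by (simp add: V_def power_int_minus power_int_of_nat divide_inverse mult.commute)
  obtain e where e: "e > 0" "cball z0 e \<subseteq> V" using V open_contains_cball by blast
  \<comment> \<open>With this choice \<open>2 * r\<close> is the square of \<open>e\<close>, so the
    cutoff has died out exactly at distance \<open>e\<close>.\<close>
  define r where "r = e\<^sup>2 / 2"
  have r: "r > 0" "sqrt (2 * r) = e" using e by (auto simp: r_def)
  have cV: "cball z0 (sqrt (2 * r)) \<subseteq> V" using e r by simp
  define g where "g = (\<lambda>z. complex_of_real (cutoff ((cmod (z - z0))\<^sup>2 / r)))"
  define \<phi>0 where "\<phi>0 = ext c0 g"
  define K0 where "K0 = {p \<in> fst c0. snd c0 p \<in> cball z0 e}"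
  define N where "N = {p \<in> fst c0. snd c0 p \<in> ball z0 (sqrt r)}"
  have g0: "g z = 0" if "z \<notin> cball z0 e" for z
  proof -
    have "cmod (z - z0) \<ge> e" using that by (simp add: dist_norm norm_minus_commute)
    hence "2 * r \<le> (cmod (z - z0))\<^sup>2" using e(1) power_mono[of e "cmod (z - z0)" 2] by (simp add: r_def)
    hence "(cmod (z - z0))\<^sup>2 / r \<ge> 2" using r(1) by (simp add: pos_le_divide_eq)
    thus ?thesis by (simp add: g_def cutoff_eq_0)
  qed
  have g1: "g z = 1" if "z \<in> ball z0 (sqrt r)" for z
  proof -
    have "cmod (z - z0) \<le> sqrt r" using that by (simp add: dist_norm norm_minus_commute)
    hence "(cmod (z - z0))\<^sup>2 / r \<le> 1" using r(1) power_mono[of "cmod (z - z0)" "sqrt r" 2] by simp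
    thus ?thesis by (simp add: g_def cutoff_eq_1)
  qed
  have C1g: "C1_on S g" for S
    unfolding g_def by (rule C1_on_radial[OF has_real_derivative_cutoff continuous_on_cutoff'])
  have ce: "cball z0 e \<subseteq> chart_img c0" using e by (auto simp: V_def)
  have \<phi>0: "C1_fun \<phi>0" unfolding \<phi>0_def
    by (rule C1_fun_ext[OF c0(1) C1g compact_cball ce]) (use g0 in auto)
  have s0: "supported_in \<phi>0 K0" "K0 \<subseteq> fst c0"
    using compact_vimage_chart[OF c0(1) compact_cball ce] g0
    by (auto simp: supported_in_def K0_def \<phi>0_def ext_def)
  have N: "openin X N" "P \<in> N" "\<And>p. p \<in> N \<Longrightarrow> \<phi>0 p = 1"
    using open_vimage_chart[OF c0(1) open_ball] g1 c0(2) r(1) by (auto simp: N_def z0_def \<phi>0_def ext_def)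
  obtain Q C K and f :: "'a \<Rightarrow> 'a \<Rightarrow> complex" where Q: "finite Q"
    "\<And>q. q \<in> Q \<Longrightarrow> C q \<in> A" "\<And>q. q \<in> Q \<Longrightarrow> C1_fun (f q)"
    "\<And>q. q \<in> Q \<Longrightarrow> compactin X (K q)" "\<And>q. q \<in> Q \<Longrightarrow> K q \<subseteq> fst (C q)"
    "\<And>q p. q \<in> Q \<Longrightarrow> p \<notin> K q \<Longrightarrow> f q p = 0"
    "\<And>p. p \<in> topspace X \<Longrightarrow> (\<Sum>q\<in>Q. f q p) \<noteq> 0"
    by (rule finite_bump_cover[OF cpt]) blast
  \<comment> \<open>Normalization makes these functions add up to \<open>1 - \<phi>0\<close>, and
    the first factor makes each of them vanish on \<open>N\<close>.\<close>
  define \<phi> where "\<phi> = (\<lambda>q p. (1 + (-1) * \<phi>0 p) * (f q p * inverse (\<Sum>q\<in>Q. f q p)))"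
  have \<phi>: "C1_fun (\<phi> q)" if "q \<in> Q" for q
    unfolding \<phi>_def using that Q by (intro C1_fun_intros \<phi>0 C1_fun_inverse C1_fun_sum) auto
  have s\<phi>: "supported_in (\<phi> q) (K q)" if "q \<in> Q" for q
    using that Q by (auto simp: supported_in_def \<phi>_def)
  have N\<phi>: "\<phi> q p = 0" if "p \<in> N" for p q using N(3)[OF that] by (simp add: \<phi>_def)
  \<comment> \<open>The index \<open>None\<close> stands for the cutoff around the pole,
    \<open>Some q\<close> for the other members of the partition.\<close>
  define I where "I = insert None (Some ` Q)"
  define \<psi> where "\<psi> = (\<lambda>i. case i of None \<Rightarrow> \<phi>0 | Some q \<Rightarrow> \<phi> q)"
  define D where "D = (\<lambda>i. case i of None \<Rightarrow> c0 | Some q \<Rightarrow> C q)"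
  define L where "L = (\<lambda>i. case i of None \<Rightarrow> K0 | Some q \<Rightarrow> K q)"
  have finI: "finite I" using Q(1) by (simp add: I_def)
  have I: "C1_fun (\<psi> i)" "supported_in (\<psi> i) (L i)" "L i \<subseteq> fst (D i)" "D i \<in> A" "const_near_P (\<psi> i) N" if i: "i \<in> I" for i
  proof -
    have cn: "const_near_P \<phi>0 N" "const_near_P (\<phi> q) N" for q
      unfolding const_near_P_def using N N\<phi> by blast+
    consider "i = None" | q where "i = Some q" "q \<in> Q" using i by (auto simp: I_def)
    hence "C1_fun (\<psi> i) \<and> supported_in (\<psi> i) (L i) \<and> L i \<subseteq> fst (D i) \<and> D i \<in> A \<and> const_near_P (\<psi> i) N"
    proof cases
      case 1 thus ?thesis using \<phi>0 s0 c0(1) cn(1) by (simp add: \<psi>_def D_def L_def)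
    next
      case (2 q) thus ?thesis using \<phi>[of q] s\<phi>[of q] cn(2)[of q] Q(2)[of q] Q(5)[of q] by (simp add: \<psi>_def D_def L_def)
    qed
    thus "C1_fun (\<psi> i)" "supported_in (\<psi> i) (L i)" "L i \<subseteq> fst (D i)" "D i \<in> A" "const_near_P (\<psi> i) N"
      by blast+
  qed
  have sum1: "(\<Sum>i\<in>I. \<psi> i p) = 1" if "p \<in> topspace X" for p
  proof -
    have "(\<Sum>i\<in>I. \<psi> i p) = \<phi>0 p + (\<Sum>q\<in>Q. \<phi> q p)"
      using Q(1) by (simp add: I_def \<psi>_def sum.reindex)
    also have "(\<Sum>q\<in>Q. \<phi> q p) = (1 + (-1) * \<phi>0 p) * ((\<Sum>q\<in>Q. f q p) * inverse (\<Sum>q\<in>Q. f q p))"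
      unfolding \<phi>_def by (simp flip: sum_distrib_left sum_distrib_right)
    finally show ?thesis using Q(7)[OF that] by simp
  qed
  \<comment> \<open>The constant 1 is replaced by the sum of all \<open>\<psi> j\<close> within the
    chart of \<open>\<psi> k\<close>.\<close>
  have split: "integral UNIV (pairing (D k) (\<lambda>_. 1) (\<psi> k)) = (\<Sum>j\<in>I. integral UNIV (pairing (D k) (\<psi> j) (\<psi> k)))"
    if k: "k \<in> I" for k
  proof -
    have "pairing (D k) (\<lambda>_. 1) (\<psi> k) = (\<lambda>z. \<Sum>j\<in>I. pairing (D k) (\<psi> j) (\<psi> k) z)"
    proof
      fix z
      show "pairing (D k) (\<lambda>_. 1) (\<psi> k) z = (\<Sum>j\<in>I. pairing (D k) (\<psi> j) (\<psi> k) z)"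
      proof (cases "z \<in> chart_img (D k)")
        case True
        then obtain p where p: "p \<in> fst (D k)" "z = snd (D k) p" by auto
        have "p \<in> topspace X" using p chart_subset[OF I(4)[OF k]] by auto
        hence "(\<Sum>j\<in>I. \<psi> j p) = 1" by (rule sum1)
        thus ?thesis using p by (simp add: pairing_chart[OF I(4)[OF k]] flip: sum_distrib_right)
      qed (simp add: pairing_def)
    qed
    moreover have "pairing (D k) (\<psi> j) (\<psi> k) integrable_on UNIV" if j: "j \<in> I" for j
      by (rule pairing_integrable[OF I(4)[OF k] I(5)[OF k] I(1)[OF j] I(1)[OF k] I(2)[OF j] I(2)[OF k]])
         (use I(3)[OF k] in auto)
    ultimately show ?thesis using finI by (simp add: integral_sum)
  qed
  \<comment> \<open>In the fixed chart of \<open>\<psi> j\<close> the functions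
    \<open>\<psi> k\<close> add up to 1, so their derivatives add up to 0.\<close>
  have vanish: "(\<Sum>k\<in>I. integral UNIV (pairing (D j) (\<psi> j) (\<psi> k))) = 0" if j: "j \<in> I" for j
  proof -
    have "pairing (D j) (\<psi> j) (\<psi> k) integrable_on UNIV" if k: "k \<in> I" for k
      by (rule pairing_integrable[OF I(4)[OF j] I(5)[OF k] I(1)[OF j] I(1)[OF k] I(2)[OF j] I(2)[OF k]])
         (use I(3)[OF j] in auto)
    hence "(\<Sum>k\<in>I. integral UNIV (pairing (D j) (\<psi> j) (\<psi> k))) =
        integral UNIV (\<lambda>z. \<Sum>k\<in>I. pairing (D j) (\<psi> j) (\<psi> k) z)"
      using finI by (simp add: integral_sum)
    also have "(\<lambda>z. \<Sum>k\<in>I. pairing (D j) (\<psi> j) (\<psi> k) z) = (\<lambda>_. 0)"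
    proof
      fix z
      show "(\<Sum>k\<in>I. pairing (D j) (\<psi> j) (\<psi> k) z) = 0"
      proof (cases "z \<in> chart_img (D j)")
        case True
        have "(\<Sum>k\<in>I. dbar (in_chart (D j) (\<psi> k)) z) = dbar (\<lambda>z. \<Sum>k\<in>I. in_chart (D j) (\<psi> k) z) z"
          by (rule dbar_sum[symmetric]) (use C1_fun_differentiable[OF I(1) I(4)[OF j] True] in auto)
        also have "\<dots> = dbar (\<lambda>_. 1) z"
        proof (rule dbar_cong_open[OF open_chart_img[OF I(4)[OF j]] True])
          fix w assume "w \<in> chart_img (D j)"
          then obtain p where p: "p \<in> fst (D j)" "w = snd (D j) p" by auto
          have "p \<in> topspace X" using p chart_subset[OF I(4)[OF j]] by auto
          thus "(\<Sum>k\<in>I. in_chart (D j) (\<psi> k) w) = 1" using sum1 p by (simp add: in_chart_eq[OF I(4)[OF j]])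
        qed
        finally have "(\<Sum>k\<in>I. dbar (in_chart (D j) (\<psi> k)) z) = 0" by simp
        thus ?thesis using True by (simp add: pairing_def flip: sum_distrib_left sum_distrib_right)
      qed (simp add: pairing_def)
    qed
    finally show ?thesis by simp
  qed
  have "(\<Sum>k\<in>I. integral UNIV (pairing (D k) (\<lambda>_. 1) (\<psi> k))) =
     (\<Sum>k\<in>I. \<Sum>j\<in>I. integral UNIV (pairing (D k) (\<psi> j) (\<psi> k)))"
    by (intro sum.cong refl split)
  \<comment> \<open>Each term is moved from the chart of \<open>\<psi> k\<close> to that of
    \<open>\<psi> j\<close>; its support lies in both.\<close>
  also have "\<dots> = (\<Sum>k\<in>I. \<Sum>j\<in>I. integral UNIV (pairing (D j) (\<psi> j) (\<psi> k)))"
  proof (intro sum.cong refl)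
    fix k j assume k: "k \<in> I" and j: "j \<in> I"
    show "integral UNIV (pairing (D k) (\<psi> j) (\<psi> k)) = integral UNIV (pairing (D j) (\<psi> j) (\<psi> k))"
      by (rule pairing_change_chart[OF I(4)[OF k] I(4)[OF j] I(5)[OF k] I(1)[OF j] I(1)[OF k] I(2)[OF j] I(2)[OF k]])
         (use I(3)[OF k] I(3)[OF j] in auto)
  qed
  also have "\<dots> = (\<Sum>j\<in>I. \<Sum>k\<in>I. integral UNIV (pairing (D j) (\<psi> j) (\<psi> k)))"
    by (rule sum.swap)
  also have "\<dots> = 0" using vanish by simp
  finally have "(\<Sum>k\<in>I. integral UNIV (pairing (D k) (\<lambda>_. 1) (\<psi> k))) = 0" .
  moreover have "(\<Sum>k\<in>I. integral UNIV (pairing (D k) (\<lambda>_. 1) (\<psi> k))) =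
     integral UNIV (pairing c0 (\<lambda>_. 1) \<phi>0) + (\<Sum>q\<in>Q. integral UNIV (pairing (C q) (\<lambda>_. 1) (\<phi> q)))"
    using Q(1) by (simp add: I_def D_def \<psi>_def sum.reindex)
  moreover have "integral UNIV (pairing (C q) (\<lambda>_. 1) (\<phi> q)) = 0" if "q \<in> Q" for q
    by (rule integral_pairing_eq_0[OF Q(2)[OF that] \<phi>[OF that] N(1,2) _ s\<phi>[OF that] Q(5)[OF that]]) (rule N\<phi>)
  ultimately have "integral UNIV (pairing c0 (\<lambda>_. 1) \<phi>0) = 0" by simp
  \<comment> \<open>The two expressions for the form agree only on \<open>V\<close> without
    \<open>z0\<close>. Elsewhere both sides vanish, because \<open>dbar g\<close> is zero at
    \<open>z0\<close> and outside the disc of radius \<open>e\<close>.\<close>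
  also have "pairing c0 (\<lambda>_. 1) \<phi>0 = (\<lambda>z. dbar g z * (h z / (z - z0) ^ n))"
  proof
    fix z
    have dg0: "dbar g z0 = 0"
      unfolding g_def by (subst dbar_radial[OF has_real_derivative_cutoff continuous_on_cutoff']) simp
    have dgz: "dbar g z = 0" if "z \<notin> cball z0 e"
      using that cutoff_kernel_zero[OF r(1) V(1) cV, of z] r(2) by (simp add: g_def)
    show "pairing c0 (\<lambda>_. 1) \<phi>0 z = dbar g z * (h z / (z - z0) ^ n)"
    proof (cases "z \<in> chart_img c0")
      case True
      have "dbar (in_chart c0 \<phi>0) z = dbar g z"
        by (rule dbar_cong_open[OF open_chart_img[OF c0(1)] True])
           (use c0 in \<open>auto simp: in_chart_eq \<phi>0_def ext_def\<close>)
      moreover have "dbar g z * F c0 z = dbar g z * (h z / (z - z0) ^ n)"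
      proof (cases "z \<in> V \<and> z \<noteq> z0")
        case True
        hence "F c0 z = h z / (z - z0) ^ n" using FV by blast
        thus ?thesis by (simp only:)
      next
        case False
        hence "z = z0 \<or> z \<notin> cball z0 e" using e(2) by blast
        hence "dbar g z = 0" using dg0 dgz by blast
        thus ?thesis by simp
      qed
      moreover have "in_chart c0 (\<lambda>_. 1) z = (1 :: complex)" by (simp add: in_chart_def)
      ultimately show ?thesis using True by (simp add: pairing_def)
    next
      case False
      hence "z \<notin> cball z0 e" using ce by blast
      hence "dbar g z = 0" by (rule dgz)
      thus ?thesis using False by (simp add: pairing_def)
    qed
  qed
  also have "integral UNIV (\<lambda>z. dbar g z * (h z / (z - z0) ^ n)) =
      integral UNIV (\<lambda>z. dbar g z / (z - z0)) * residue (\<lambda>z. h z / (z - z0) ^ n) z0"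
    unfolding g_def by (rule cutoff_kernel_residue[OF r(1) V(1) cV hV])
  finally have "residue (\<lambda>z. h z / (z - z0) ^ n) z0 = 0"
    using cutoff_kernel_nonzero[OF r(1) V(1) cV] by (simp add: g_def)
  moreover have "residue (F c0) z0 = residue (\<lambda>z. h z / (z - z0) ^ n) z0"
  proof (rule residue_cong)
    show "\<forall>\<^sub>F z in at z0. F c0 z = h z / (z - z0) ^ n"
      using eventually_at_in_open[OF V] by (rule eventually_mono) (use FV in auto)
  qed auto
  ultimately show ?thesis by (simp add: z0_def)
qed

end

section \<open>Skew-symmetric matrices\<close>

definition cscale :: "complex \<Rightarrow> complex^'n^'n \<Rightarrow> complex^'n^'n" where
  "cscale c M = map_matrix ((*) c) M"

lemma cscale_nth [simp]: "cscale c M $ i $ j = c * M $ i $ j"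
  by (simp add: cscale_def map_matrix_def)

lemma outer_nth [simp]: "outer u v $ i $ j = u $ i * v $ j"
  by (simp add: outer_def)

lemma matrix_mult_nth: "(M ** N) $ i $ j = (\<Sum>k\<in>UNIV. M $ i $ k * N $ k $ j)"
  by (simp add: matrix_matrix_mult_def)

lemma trace_mult: "trace (M ** N) = (\<Sum>i\<in>UNIV. \<Sum>k\<in>UNIV. M $ i $ k * N $ k $ i)"
  by (simp add: trace_def matrix_mult_nth)

lemma cscale_mult_left: "cscale c M ** N = cscale c (M ** N)"
  by (simp add: vec_eq_iff matrix_mult_nth sum_distrib_left mult.assoc)

lemma cscale_mult_right: "M ** cscale c N = cscale c (M ** N)"
  by (simp add: vec_eq_iff matrix_mult_nth sum_distrib_left mult_ac)

lemma matrix_mult_add: "(M + N :: complex^'n^'n) ** K = M ** K + N ** K" "K ** (M + N) = K ** M + K ** N"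
  by (simp_all add: vec_eq_iff matrix_mult_nth distrib_left distrib_right sum.distrib)

lemma matrix_mult_diff: "(M - N :: complex^'n^'n) ** K = M ** K - N ** K" "K ** (M - N) = K ** M - K ** N"
  by (simp_all add: vec_eq_iff matrix_mult_nth left_diff_distrib right_diff_distrib sum_subtractf)

lemma matrix_mult_uminus: "(- M :: complex^'n^'n) ** K = - (M ** K)" "K ** (- M) = - (K ** M)"
  by (simp_all add: vec_eq_iff matrix_mult_nth sum_negf)

lemma trace_uminus: "trace (- M :: complex^'n^'n) = - trace M"
  by (simp add: trace_def sum_negf)

lemma cscale_1: "cscale 1 M = M"
  by (simp add: vec_eq_iff)

lemma cscale_diff: "cscale c (M - N) = cscale c M - cscale c N"
  by (simp add: vec_eq_iff right_diff_distrib)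

lemma trace_cscale: "trace (cscale c M) = c * trace M"
  by (simp add: trace_def sum_distrib_left)

lemma lie_add_left: "lie (M + N) K = lie M K + lie N K"
  by (simp add: lie_def matrix_mult_add)

lemma lie_add_right: "lie K (M + N) = lie K M + lie K N"
  by (simp add: lie_def matrix_mult_add)

lemma lie_cscale: "lie (cscale c M) N = cscale c (lie M N)" "lie M (cscale c N) = cscale c (lie M N)"
  by (simp_all add: lie_def cscale_mult_left cscale_mult_right cscale_diff)

lemma lie_skew: "lie N M = - lie M N"
  by (simp add: lie_def)

text \<open>Invariance of the trace form under the adjoint action, a consequence of the cyclicity of
  the trace.\<close>

lemma trace_lie_rotate: "trace (lie M N ** K) = trace (N ** lie K M)"
proof -
  have "trace ((M ** N) ** K) = trace (N ** (K ** M))"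
    using trace_mul_sym[of M "N ** K"] by (simp add: matrix_mul_assoc)
  thus ?thesis by (simp add: lie_def matrix_mult_diff trace_sub matrix_mul_assoc)
qed

lemma trace_lie_rotate': "trace (lie M N ** K) = trace (lie N K ** M)"
  using trace_lie_rotate[of N K M] trace_mul_sym[of K "lie M N"] by simp

lemma trace_lie_jacobi:
  "trace (lie (lie X Y) Z ** K) + trace (lie (lie Y Z) X ** K) + trace (lie (lie Z X) Y ** K) = 0"
proof -
  have "lie (lie X Y) Z + lie (lie Y Z) X + lie (lie Z X) Y = 0"
    by (simp add: lie_def matrix_mult_diff matrix_mul_assoc)
  hence "trace ((lie (lie X Y) Z + lie (lie Y Z) X + lie (lie Z X) Y) ** K) = 0"
    by (simp add: trace_def)
  thus ?thesis by (simp add: matrix_mult_add trace_add)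
qed

lemma bdot_commute: "bdot u v = bdot v u"
  by (simp add: bdot_def mult.commute)

lemma bdot_scale: "bdot u (c *s v) = c * bdot u v" "bdot (c *s u) v = c * bdot u v"
  by (simp_all add: bdot_def sum_distrib_left mult_ac)

lemma outer_mult: "outer u v ** outer x y = cscale (bdot v x) (outer u y)"
  by (simp add: vec_eq_iff matrix_mult_nth bdot_def sum_distrib_left mult_ac)

lemma outer_mult_vec: "outer u v *v x = bdot v x *s u"
  by (simp add: vec_eq_iff matrix_vector_mult_def bdot_def sum_distrib_left mult_ac)

lemma cscale_mult_vec: "cscale c M *v x = c *s (M *v x)"
  by (simp add: vec_eq_iff matrix_vector_mult_def sum_distrib_left mult.assoc)

lemma trace_mult_outer: "trace (W ** outer u v) = bdot v (W *v u)"
  by (simp add: trace_mult bdot_def matrix_vector_mult_def sum_distrib_left mult_ac)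

lemma bdot_skew:
  assumes "W \<in> so" shows "bdot u (W *v v) = - bdot (W *v u) v"
proof -
  have W: "W $ j $ i = - W $ i $ j" for i j
  proof -
    have "transpose W $ i $ j = (- W) $ i $ j" using assms by (simp add: so_def)
    thus ?thesis by (simp add: transpose_def)
  qed
  have "bdot u (W *v v) = (\<Sum>i\<in>UNIV. \<Sum>j\<in>UNIV. u $ i * W $ i $ j * v $ j)"
    by (simp add: bdot_def matrix_vector_mult_def sum_distrib_left mult_ac)
  also have "\<dots> = (\<Sum>j\<in>UNIV. \<Sum>i\<in>UNIV. u $ i * W $ i $ j * v $ j)" by (rule sum.swap)
  also have "\<dots> = (\<Sum>j\<in>UNIV. \<Sum>i\<in>UNIV. - (W $ j $ i * u $ i * v $ j))"
    by (intro sum.cong refl) (subst W, simp)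
  also have "\<dots> = - bdot (W *v u) v"
    by (simp add: bdot_def matrix_vector_mult_def sum_distrib_left sum_negf mult_ac)
  finally show ?thesis .
qed

section \<open>Principal parts built from an isotropic vector\<close>

definition skew_outer :: "complex^'n \<Rightarrow> complex^'n \<Rightarrow> complex^'n^'n" where
  "skew_outer a b = outer a b - outer b a"

text \<open>For principal parts of functions \<open>bdot b a\<close> is 0 and any eigenvalue is
  allowed; for the 1-form \<open>bdot b a\<close> is 1, and the trace vanishes only if
  \<open>W\<close> kills \<open>a\<close>, as brackets of matrices with eigenvector \<open>a\<close>
  do.\<close>

lemma trace_skew_outer:
  assumes "W \<in> so" "W *v a = (k::complex) *s a"
  shows "trace (W ** skew_outer a b) = 2 * k * bdot b a"
proof -
  have "trace (W ** skew_outer a b) = bdot b (W *v a) - bdot a (W *v b)"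
    by (simp add: skew_outer_def matrix_mult_diff trace_sub trace_mult_outer)
  also have "bdot a (W *v b) = - bdot (W *v a) b" by (rule bdot_skew[OF assms(1)])
  finally show ?thesis by (simp add: assms(2) bdot_scale bdot_commute[of a b])
qed

lemma skew_outer_mult:
  assumes "bdot a a = 0"
  shows "skew_outer a b ** skew_outer a c =
     cscale (bdot b a) (outer a c) - cscale (bdot b c) (outer a a) + cscale (bdot a c) (outer b a)"
  by (simp add: skew_outer_def matrix_mult_diff outer_mult assms)
     (simp add: vec_eq_iff)

text \<open>Both products equal \<open>- bdot b b'\<close> times \<open>outer a a\<close>, which is
  symmetric in \<open>b\<close> and \<open>b'\<close>. Hence the bracket of two elements of the
  algebra has no double pole.\<close>

lemma lie_skew_outer_eq_0:
  assumes "bdot a a = 0" "bdot b a = 0" "bdot b' a = 0"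
  shows "lie (skew_outer a b) (skew_outer a b') = 0"
proof -
  have "bdot a b = 0" "bdot a b' = 0" using assms by (simp_all add: bdot_commute[of a b] bdot_commute[of a b'])
  thus ?thesis using assms
    by (simp add: lie_def skew_outer_mult bdot_commute[of b' b]) (simp add: vec_eq_iff)
qed

text \<open>The product is a multiple of \<open>outer a a\<close>, whose trace is
  \<open>bdot a a\<close>. This removes the triple pole of the trace of L dL'.\<close>

lemma trace_skew_outer_mult_eq_0:
  assumes "bdot a a = 0" "bdot b a = 0" "bdot b' a = 0"
  shows "trace (skew_outer a b ** skew_outer a b') = 0"
proof -
  have "trace (outer a a) = bdot a a" by (simp add: trace_def bdot_def)
  moreover have "bdot a b' = 0" using assms by (simp add: bdot_commute[of a b'])
  ultimately show ?thesis using assms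
    by (simp add: skew_outer_mult trace_sub trace_add trace_cscale)
qed

text \<open>The two products contribute \<open>outer a b\<close> and \<open>outer b a\<close>; their
  terms in \<open>outer a a\<close> have the same coefficient and cancel in the bracket.\<close>

lemma lie_skew_outer:
  assumes "bdot a a = 0" "bdot b a = 0" "bdot \<beta> a = 1"
  shows "lie (skew_outer a \<beta>) (skew_outer a b) = skew_outer a b"
proof -
  have "bdot a b = 0" "bdot a \<beta> = 1" using assms by (simp_all add: bdot_commute[of a b] bdot_commute[of a \<beta>])
  thus ?thesis using assms unfolding lie_def
    by (simp add: skew_outer_mult bdot_commute[of b \<beta>]) (simp add: vec_eq_iff skew_outer_def)
qed

lemma lie_in_so:
  fixes M N :: "complex^'n^'n"
  assumes "M \<in> so" "N \<in> so" shows "lie M N \<in> so"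
proof -
  have "transpose (M ** N) = N ** M" "transpose (N ** M) = M ** N"
    using assms by (simp_all add: so_def matrix_transpose_mul matrix_mult_uminus)
  moreover have "transpose (A - B) = transpose A - transpose B" for A B :: "complex^'n^'n"
    by (simp add: transpose_def vec_eq_iff)
  ultimately show ?thesis by (simp add: so_def lie_def)
qed

text \<open>On the line spanned by \<open>a\<close> both matrices act as scalars and commute. The
  zero vector is written \<open>0 *s a\<close> to match the eigenvector condition of
  \<open>trace_skew_outer\<close>.\<close>

lemma lie_mult_vec:
  assumes "M *v a = k *s a" "N *v a = l *s a" shows "lie M N *v a = 0 *s a"
  using assms by (simp add: lie_def matrix_vector_mult_diff_rdistrib matrix_vector_mul_assoc[symmetric]
     vector_scalar_commute mult.commute)

text \<open>The coefficients of the expansion of \<open>tr (L dL' - [L,L'] \<L>)\<close> at a weak singularity that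
  have to vanish; here \<open>M, N\<close> and \<open>M', N'\<close> come from \<open>L\<close> and \<open>L'\<close>, and \<open>K, K0\<close> from \<open>\<L>\<close>.\<close>

lemma lax_coefficients:
  fixes a b b' \<beta> :: "complex^'n"
  defines "M \<equiv> skew_outer a b" and "M' \<equiv> skew_outer a b'" and "K \<equiv> skew_outer a \<beta>"
  assumes a: "bdot a a = 0" and b: "bdot b a = 0" "bdot b' a = 0" "bdot \<beta> a = 1"
  shows "trace (lie M U ** K) = trace (M ** U)"
    and "trace (lie U M' ** K) = - trace (U ** M')"
    and "N \<in> so \<Longrightarrow> N *v a = k *s a \<Longrightarrow> trace (M ** N) = 0"
    and "N \<in> so \<Longrightarrow> N' \<in> so \<Longrightarrow> K0 \<in> so \<Longrightarrow> N *v a = k *s a \<Longrightarrow> N' *v a = k' *s a \<Longrightarrow> K0 *v a = k0 *s a \<Longrightarrow>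
      trace (lie M N' ** K0) + trace (lie N M' ** K0) + trace (lie N N' ** K) = 0"
proof -
  show "trace (lie M U ** K) = trace (M ** U)"
    using trace_lie_rotate[of M U K] lie_skew_outer[OF a b(1,3)] trace_mul_sym[of U M]
    by (simp add: M_def K_def)
  show "trace (lie U M' ** K) = - trace (U ** M')"
  proof -
    have "lie M' K = - M'"
      using lie_skew[of M' K] lie_skew_outer[OF a b(2,3)] by (simp add: M'_def K_def)
    thus ?thesis using trace_lie_rotate'[of U M' K] trace_mul_sym[of U M']
      by (simp add: matrix_mult_uminus trace_uminus)
  qed
  have z: "trace (W ** skew_outer a c) = 0" if "W \<in> so" "W *v a = 0 *s a" for W c
    using trace_skew_outer[OF that] by simp
  show "trace (M ** N) = 0" if "N \<in> so" "N *v a = k *s a"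
    using trace_skew_outer[OF that, of b] b trace_mul_sym[of M N] by (simp add: M_def)
  show "trace (lie M N' ** K0) + trace (lie N M' ** K0) + trace (lie N N' ** K) = 0"
    if "N \<in> so" "N' \<in> so" "K0 \<in> so" "N *v a = k *s a" "N' *v a = k' *s a" "K0 *v a = k0 *s a"
  proof -
    have "trace (lie M N' ** K0) = trace (lie N' K0 ** M)" by (rule trace_lie_rotate')
    also have "\<dots> = 0" unfolding M_def by (rule z[OF lie_in_so[OF that(2,3)] lie_mult_vec[OF that(5,6)]])
    finally have 1: "trace (lie M N' ** K0) = 0" .
    have "trace (lie N M' ** K0) = trace (lie K0 N ** M')"
      using trace_lie_rotate'[of K0 N M'] by simp
    also have "\<dots> = 0" unfolding M'_def by (rule z[OF lie_in_so[OF that(3,1)] lie_mult_vec[OF that(6,4)]])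
    finally have 2: "trace (lie N M' ** K0) = 0" .
    have 3: "trace (lie N N' ** K) = 0" unfolding K_def by (rule z[OF lie_in_so[OF that(1,2)] lie_mult_vec[OF that(4,5)]])
    show ?thesis using 1 2 3 by simp
  qed
qed

section \<open>Regularity at a weak singularity\<close>

definition mat_analytic :: "(complex \<Rightarrow> complex^'n^'n) \<Rightarrow> complex \<Rightarrow> bool" where
  "mat_analytic U z0 \<longleftrightarrow> (\<forall>i j. (\<lambda>z. U z $ i $ j) analytic_on {z0})"

definition mat_deriv :: "(complex \<Rightarrow> complex^'n^'n) \<Rightarrow> complex \<Rightarrow> complex^'n^'n" where
  "mat_deriv U z = (\<chi> i j. deriv (\<lambda>w. U w $ i $ j) z)"

lemma mat_deriv_nth [simp]: "mat_deriv U z $ i $ j = deriv (\<lambda>w. U w $ i $ j) z"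
  by (simp add: mat_deriv_def)

lemma mat_analytic_const: "mat_analytic (\<lambda>_. M) z0"
  by (simp add: mat_analytic_def)

lemma mat_analytic_mat_deriv: "mat_analytic U z0 \<Longrightarrow> mat_analytic (mat_deriv U) z0"
  by (auto simp: mat_analytic_def intro!: analytic_deriv)

lemma mat_analytic_lie: "mat_analytic U z0 \<Longrightarrow> mat_analytic V z0 \<Longrightarrow> mat_analytic (\<lambda>z. lie (U z) (V z)) z0"
  by (auto simp: mat_analytic_def lie_def matrix_mult_nth intro!: analytic_intros)

lemma trace_mult_analytic:
  "mat_analytic U z0 \<Longrightarrow> mat_analytic V z0 \<Longrightarrow> (\<lambda>z. trace (U z ** V z)) analytic_on {z0}"
  by (auto simp: mat_analytic_def trace_mult intro!: analytic_intros)

lemma eventually_analytic: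
  assumes "f analytic_on {z0}" shows "\<forall>\<^sub>F z in nhds z0. f analytic_on {z}"
proof -
  obtain V where V: "open V" "z0 \<in> V" "f holomorphic_on V" using assms by (auto simp: analytic_at)
  show ?thesis
    using eventually_nhds_in_open[OF V(1,2)] by (rule eventually_mono) (use V in \<open>auto simp: analytic_at\<close>)
qed

lemma eventually_mat_analytic:
  assumes "mat_analytic U z0" shows "\<forall>\<^sub>F z in at z0. mat_analytic U z"
proof -
  have "\<forall>\<^sub>F z in nhds z0. \<forall>i j. (\<lambda>z. U z $ i $ j) analytic_on {z}"
    using assms by (intro eventually_all_finite eventually_analytic) (auto simp: mat_analytic_def)
  thus ?thesis unfolding mat_analytic_def by (simp add: eventually_nhds_conv_at)
qed

lemma deriv_trace_mult:
  assumes "mat_analytic U z"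
  shows "deriv (\<lambda>z. trace (M ** U z)) z = trace (M ** mat_deriv U z)"
proof (rule DERIV_imp_deriv)
  have "((\<lambda>w. U w $ i $ j) has_field_derivative deriv (\<lambda>w. U w $ i $ j) z) (at z)" for i j
    using assms by (intro analytic_derivI) (auto simp: mat_analytic_def)
  thus "((\<lambda>z. trace (M ** U z)) has_field_derivative trace (M ** mat_deriv U z)) (at z)"
    unfolding trace_mult by (auto intro!: DERIV_sum DERIV_cmult)
qed

text \<open>The entrywise remainders are collected in one analytic matrix function, so that the
  singular terms can be compared by matrix algebra instead of entry by entry.\<close>

lemma simple_expansion_analytic:
  assumes "simple_expansion F z0 M N"
  obtains U where "mat_analytic U z0" "U z0 = N"
    "\<forall>\<^sub>F z in at z0. F z = cscale (1 / (z - z0)) M + U z"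
proof -
  have "\<forall>i j. \<exists>h. h analytic_on {z0} \<and> (\<forall>\<^sub>F z in at z0. F z $ i $ j - (M $ i $ j / (z - z0) + N $ i $ j) = (z - z0) * h z)"
    using assms by (simp add: simple_expansion_def order_at_least_def)
  then obtain h where "\<forall>i j. h i j analytic_on {z0} \<and>
     (\<forall>\<^sub>F z in at z0. F z $ i $ j - (M $ i $ j / (z - z0) + N $ i $ j) = (z - z0) * h i j z)"
    by (simp only: choice_iff) blast
  hence h: "\<And>i j. h i j analytic_on {z0}"
     "\<And>i j. \<forall>\<^sub>F z in at z0. F z $ i $ j - (M $ i $ j / (z - z0) + N $ i $ j) = (z - z0) * h i j z"
    by blast+
  define U where "U = (\<lambda>z. \<chi> i j. N $ i $ j + (z - z0) * h i j z)"
  show ?thesis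
  proof (rule that[of U])
    show "mat_analytic U z0" using h(1) by (auto simp: mat_analytic_def U_def intro!: analytic_intros)
    show "U z0 = N" by (simp add: U_def vec_eq_iff)
    have "\<forall>\<^sub>F z in at z0. \<forall>i j. F z $ i $ j - (M $ i $ j / (z - z0) + N $ i $ j) = (z - z0) * h i j z"
      by (intro eventually_all_finite h(2))
    thus "\<forall>\<^sub>F z in at z0. F z = cscale (1 / (z - z0)) M + U z"
    proof eventually_elim
      case (elim z)
      have "F z $ i $ j = M $ i $ j / (z - z0) + N $ i $ j + (z - z0) * h i j z" for i j
        using elim by (metis add.commute diff_eq_eq)
      thus ?case by (simp add: vec_eq_iff U_def)
    qed
  qed
qed

lemma skew_outer_in_so: "skew_outer a b \<in> so"
  by (simp add: so_def skew_outer_def transpose_def vec_eq_iff mult.commute)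

text \<open>The expansion conditions do not demand that the constant term be skew-symmetric; it
  inherits this as a limit of skew-symmetric matrices, since the principal part is skew-symmetric
  too.\<close>

lemma so_regular_part:
  assumes U: "mat_analytic U z0" and F: "\<forall>\<^sub>F z in at z0. F z = cscale (1 / (z - z0)) M + U z"
    and M: "M \<in> so" and so: "\<forall>\<^sub>F z in at z0. F z \<in> so"
  shows "U z0 \<in> so"
proof -
  have entry: "A $ j $ i = - A $ i $ j" if "A \<in> so" for A :: "complex^'n^'n" and i j
  proof -
    have "transpose A $ i $ j = (- A) $ i $ j" using that by (simp add: so_def)
    thus ?thesis by (simp add: transpose_def)
  qed
  have sym: "U z0 $ j $ i = - U z0 $ i $ j" for i j
  proof -
    have lim: "((\<lambda>z. U z $ i $ j) \<longlongrightarrow> U z0 $ i $ j) (at z0)" for i j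
      using U analytic_at_imp_isCont[of "\<lambda>z. U z $ i $ j" z0] by (auto simp: mat_analytic_def isCont_def)
    have "\<forall>\<^sub>F z in at z0. U z $ j $ i = - U z $ i $ j"
      using F so
    proof eventually_elim
      case (elim z)
      have U: "U z = F z - cscale (1 / (z - z0)) M" using elim by simp
      show ?case unfolding U using entry[OF elim(2), of i j] entry[OF M, of i j] by simp
    qed
    from Lim_transform_eventually[OF lim this]
    have "((\<lambda>z. - U z $ i $ j) \<longlongrightarrow> U z0 $ j $ i) (at z0)" .
    moreover have "((\<lambda>z. - U z $ i $ j) \<longlongrightarrow> - U z0 $ i $ j) (at z0)" by (intro tendsto_minus lim)
    ultimately show ?thesis using tendsto_unique trivial_limit_at by blast
  qed
  have "transpose (U z0) $ i $ j = (- U z0) $ i $ j" for i j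
    using sym[of j i] by (simp add: transpose_def)
  thus ?thesis by (simp add: so_def vec_eq_iff)
qed

lemma mat_deriv_expansion:
  assumes F: "\<forall>\<^sub>F z in at z0. F z = cscale (1 / (z - z0)) M + U z" and U: "mat_analytic U z0"
  shows "\<forall>\<^sub>F z in at z0. mat_deriv F z = cscale (- (1 / (z - z0))\<^sup>2) M + mat_deriv U z"
proof -
  obtain V where V: "open V" "z0 \<in> V" "\<And>z. z \<in> V \<Longrightarrow> z \<noteq> z0 \<Longrightarrow> F z = cscale (1 / (z - z0)) M + U z"
    using F unfolding eventually_at_topological by blast
  have "\<forall>\<^sub>F z in at z0. z \<in> V \<and> z \<noteq> z0" using eventually_at_in_open[OF V(1,2)] by simp
  with eventually_mat_analytic[OF U] show ?thesis
  proof eventually_elim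
    case (elim z)
    have "deriv (\<lambda>w. F w $ i $ j) z = - (1 / (z - z0))\<^sup>2 * M $ i $ j + deriv (\<lambda>w. U w $ i $ j) z" for i j
    proof (rule DERIV_imp_deriv)
      have "((\<lambda>w. U w $ i $ j) has_field_derivative deriv (\<lambda>w. U w $ i $ j) z) (at z)"
        using elim by (intro analytic_derivI) (auto simp: mat_analytic_def)
      moreover have "((\<lambda>w. 1 / (w - z0)) has_field_derivative - (1 / (z - z0))\<^sup>2) (at z)"
        using elim by (auto intro!: derivative_eq_intros simp: power2_eq_square)
      ultimately have "((\<lambda>w. 1 / (w - z0) * M $ i $ j + U w $ i $ j) has_field_derivative
         - (1 / (z - z0))\<^sup>2 * M $ i $ j + deriv (\<lambda>w. U w $ i $ j) z) (at z)"
        by (intro DERIV_add DERIV_cmult_right)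
      thus "((\<lambda>w. F w $ i $ j) has_field_derivative
         - (1 / (z - z0))\<^sup>2 * M $ i $ j + deriv (\<lambda>w. U w $ i $ j) z) (at z)"
        by (rule has_field_derivative_transform_within_open[of _ _ _ "V - {z0}"]) (use elim V in auto)
    qed
    thus ?case by (simp add: vec_eq_iff)
  qed
qed

text \<open>With \<open>w = z - z0\<close>, \<open>F = M/w + U\<close>, \<open>F' = M'/w + U'\<close>, \<open>G = K/w + W\<close>, the singular terms that do not
  cancel identically are \<open>d/dz (tr(M U')/w)\<close> and \<open>tr([M,U'] W + [U,M'] W + [U,U'] K)/w\<close>, whose
  numerators vanish at \<open>z0\<close>.\<close>

lemma lax_regular_germ:
  fixes a b b' \<beta> :: "complex^'n"
  assumes F: "simple_expansion F z0 (skew_outer a b) N" and F': "simple_expansion F' z0 (skew_outer a b') N'"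
    and G: "simple_expansion G z0 (skew_outer a \<beta>) K0"
    and a: "bdot a a = 0" and b: "bdot b a = 0" "bdot b' a = 0" "bdot \<beta> a = 1"
    and eigen: "N *v a = k *s a" "N' *v a = k' *s a" "K0 *v a = k0 *s a"
    and so: "\<forall>\<^sub>F z in at z0. F z \<in> so" "\<forall>\<^sub>F z in at z0. F' z \<in> so" "\<forall>\<^sub>F z in at z0. G z \<in> so"
  shows "order_at_least 0 (\<lambda>z. trace (F z ** mat_deriv F' z - lie (F z) (F' z) ** G z)) z0"
proof -
  define M M' K where "M = skew_outer a b" and "M' = skew_outer a b'" and "K = skew_outer a \<beta>"
  obtain U where U: "mat_analytic U z0" "U z0 = N" "\<forall>\<^sub>F z in at z0. F z = cscale (1 / (z - z0)) M + U z"
    by (rule simple_expansion_analytic[OF F[folded M_def]]) (rule that)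
  obtain U' where U': "mat_analytic U' z0" "U' z0 = N'" "\<forall>\<^sub>F z in at z0. F' z = cscale (1 / (z - z0)) M' + U' z"
    by (rule simple_expansion_analytic[OF F'[folded M'_def]]) (rule that)
  obtain W where W: "mat_analytic W z0" "W z0 = K0" "\<forall>\<^sub>F z in at z0. G z = cscale (1 / (z - z0)) K + W z"
    by (rule simple_expansion_analytic[OF G[folded K_def]]) (rule that)
  have skew: "M \<in> so" "M' \<in> so" "K \<in> so"
    unfolding M_def M'_def K_def by (rule skew_outer_in_so)+
  have soN: "N \<in> so" "N' \<in> so" "K0 \<in> so"
    using so_regular_part[OF U(1,3) skew(1) so(1)] so_regular_part[OF U'(1,3) skew(2) so(2)]
      so_regular_part[OF W(1,3) skew(3) so(3)] by (simp_all only: U(2) U'(2) W(2))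
  note coeff = lax_coefficients[OF a b, folded M_def M'_def K_def]
  \<comment> \<open>\<open>\<phi>\<close> is the numerator of the term tr(M U')/w. It vanishes at
    \<open>z0\<close> because \<open>N'\<close> has the eigenvector \<open>a\<close> and
    \<open>bdot b a\<close> is 0, so the quotient \<open>\<phi>1\<close> is analytic.\<close>
  define \<phi> where "\<phi> = (\<lambda>z. trace (M ** U' z))"
  have \<phi>: "\<phi> analytic_on {z0}" "\<phi> z0 = 0"
  proof -
    show "\<phi> analytic_on {z0}" unfolding \<phi>_def by (intro trace_mult_analytic mat_analytic_const U'(1))
    show "\<phi> z0 = 0" unfolding \<phi>_def U'(2) by (rule coeff(3)[OF soN(2) eigen(2)])
  qed
  obtain \<phi>1 where \<phi>1: "\<phi>1 analytic_on {z0}" "\<And>z. \<phi> z = (z - z0) * \<phi>1 z"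
  proof (rule analytic_factor[OF \<phi>(1)])
    fix k assume "k analytic_on {z0}" "\<And>z. \<phi> z = \<phi> z0 + (z - z0) * k z"
    thus thesis using \<phi>(2) by (intro that[of k]) simp_all
  qed
  define g where "g = (\<lambda>z. trace (lie M (U' z) ** W z) + trace (lie (U z) M' ** W z) + trace (lie (U z) (U' z) ** K))"
  have g: "g analytic_on {z0}" "g z0 = 0"
  proof -
    show "g analytic_on {z0}" unfolding g_def
      by (intro trace_mult_analytic mat_analytic_lie mat_analytic_const analytic_on_add U(1) U'(1) W(1))
    show "g z0 = 0" unfolding g_def U(2) U'(2) W(2) by (rule coeff(4)[OF soN eigen])
  qed
  \<comment> \<open>What is left of the density once the poles of order two and three have
    cancelled. The quotient by \<open>z - z0\<close> is harmless because \<open>g\<close> vanishes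
    at \<open>z0\<close>.\<close>
  define R where "R = (\<lambda>z. deriv \<phi>1 z - g z / (z - z0) + trace (U z ** mat_deriv U' z) - trace (lie (U z) (U' z) ** W z))"
  have "order_at_least 0 R z0"
  proof -
    have "order_at_least 0 (\<lambda>z. g z / (z - z0)) z0"
      using order_at_least_divide[OF order_at_least_1_vanishing[OF g]] by simp
    moreover have "order_at_least 0 (deriv \<phi>1) z0"
      "order_at_least 0 (\<lambda>z. trace (U z ** mat_deriv U' z)) z0"
      "order_at_least 0 (\<lambda>z. trace (lie (U z) (U' z) ** W z)) z0"
      by (intro order_at_least_analytic analytic_deriv \<phi>1 trace_mult_analytic mat_analytic_lie
          mat_analytic_mat_deriv U(1) U'(1) W(1))+
    ultimately show ?thesis unfolding R_def
      by (intro order_at_least_add order_at_least_diff)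
  qed
  moreover have "\<forall>\<^sub>F z in at z0. trace (F z ** mat_deriv F' z - lie (F z) (F' z) ** G z) = R z"
  proof -
    have "\<forall>\<^sub>F z in at z0. z \<noteq> z0" by (auto simp: eventually_at_filter)
    moreover have "\<forall>\<^sub>F z in at z0. \<phi>1 analytic_on {z}"
      using eventually_analytic[OF \<phi>1(1)] by (simp add: eventually_nhds_conv_at)
    ultimately show ?thesis
      using U(3) U'(3) W(3) mat_deriv_expansion[OF U'(3,1)] eventually_mat_analytic[OF U'(1)]
    proof eventually_elim
      case (elim z)
      define p where "p = 1 / (z - z0)"
      have "(\<phi> has_field_derivative \<phi>1 z + (z - z0) * deriv \<phi>1 z) (at z)"
      proof -
        have "((\<lambda>z. (z - z0) * \<phi>1 z) has_field_derivative \<phi>1 z + (z - z0) * deriv \<phi>1 z) (at z)"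
          using elim(2) by (auto intro!: derivative_eq_intros analytic_derivI)
        thus ?thesis by (simp add: \<phi>1(2) [abs_def])
      qed
      hence "trace (M ** mat_deriv U' z) = \<phi>1 z + (z - z0) * deriv \<phi>1 z"
        using deriv_trace_mult[OF elim(7), of M] by (simp add: \<phi>_def DERIV_imp_deriv)
      \<comment> \<open>The quotient rule for \<open>\<phi> z / (z - z0)\<close>. Its double pole
        absorbs the term in tr(M U') that remains after the terms in tr(U M') have
        cancelled.\<close>
      hence d: "deriv \<phi>1 z = p * trace (M ** mat_deriv U' z) - p\<^sup>2 * trace (M ** U' z)"
      proof -
        have pw: "p * (z - z0) = 1" using elim(1) by (simp add: p_def)
        have "p * (\<phi>1 z + (z - z0) * deriv \<phi>1 z) - p\<^sup>2 * ((z - z0) * \<phi>1 z) =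
            p * \<phi>1 z + (p * (z - z0)) * deriv \<phi>1 z - p * (p * (z - z0)) * \<phi>1 z"
          by (simp only: power2_eq_square distrib_left mult_ac)
        thus ?thesis using \<phi>1(2)[of z] \<open>trace (M ** mat_deriv U' z) = _\<close> unfolding pw by (simp add: \<phi>_def)
      qed
      have e: "F z = cscale p M + U z" "F' z = cscale p M' + U' z" "G z = cscale p K + W z"
        "mat_deriv F' z = cscale (- p\<^sup>2) M' + mat_deriv U' z"
        using elim by (simp_all add: p_def)
      have 1: "trace (F z ** mat_deriv F' z) = p * trace (M ** mat_deriv U' z) - p\<^sup>2 * trace (U z ** M') + trace (U z ** mat_deriv U' z)"
        using trace_skew_outer_mult_eq_0[OF a b(1,2)]
        by (simp add: e matrix_mult_add cscale_mult_left cscale_mult_right trace_add trace_cscale flip: M_def M'_def)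
      have "lie (F z) (F' z) = cscale p (lie M (U' z)) + cscale p (lie (U z) M') + lie (U z) (U' z)"
        using lie_skew_outer_eq_0[OF a b(1,2)]
        by (simp add: e lie_add_left lie_add_right lie_cscale flip: M_def M'_def) (simp add: vec_eq_iff)
      hence 2: "trace (lie (F z) (F' z) ** G z) = p\<^sup>2 * (trace (M ** U' z) - trace (U z ** M')) + p * g z + trace (lie (U z) (U' z) ** W z)"
        using coeff(1)[of "U' z"] coeff(2)[of "U z"]
        by (simp add: e matrix_mult_add cscale_mult_left cscale_mult_right trace_add trace_cscale g_def power2_eq_square algebra_simps)
      show ?case
        unfolding trace_sub 1 2 R_def d by (simp add: p_def algebra_simps)
    qed
  qed
  ultimately show ?thesis by (rule iffD2[OF order_at_least_cong, rotated])
qed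

section \<open>The cocycle identities for germs\<close>

definition mat_mero :: "(complex \<Rightarrow> complex^'n^'n) \<Rightarrow> complex \<Rightarrow> bool" where
  "mat_mero F z0 \<longleftrightarrow> (\<forall>i j. (\<lambda>z. F z $ i $ j) meromorphic_on {z0})"

definition lax_density ::
  "(complex \<Rightarrow> complex^'n^'n) \<Rightarrow> (complex \<Rightarrow> complex^'n^'n) \<Rightarrow> (complex \<Rightarrow> complex^'n^'n) \<Rightarrow> complex \<Rightarrow> complex" where
  "lax_density F F' G z = trace (F z ** mat_deriv F' z - lie (F z) (F' z) ** G z)"

text \<open>In this form closure of meromorphic functions, of holomorphic functions and of order
  bounds under sums and products applies directly.\<close>

lemma lax_density_entries:
  "lax_density F F' G z = (\<Sum>i\<in>UNIV. \<Sum>k\<in>UNIV. F z $ i $ k * deriv (\<lambda>w. F' w $ k $ i) z)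
     - (\<Sum>i\<in>UNIV. \<Sum>k\<in>UNIV. ((\<Sum>l\<in>UNIV. F z $ i $ l * F' z $ l $ k) - (\<Sum>l\<in>UNIV. F' z $ i $ l * F z $ l $ k)) * G z $ k $ i)"
  by (simp only: lax_density_def trace_sub trace_mult lie_def matrix_mult_nth vector_minus_component mat_deriv_nth)

lemma lax_density_meromorphic:
  fixes F F' G :: "complex \<Rightarrow> complex^'n^'n"
  assumes "\<And>i j. (\<lambda>z. F z $ i $ j) meromorphic_on B" "\<And>i j. (\<lambda>z. F' z $ i $ j) meromorphic_on B"
    "\<And>i j. (\<lambda>z. G z $ i $ j) meromorphic_on B"
  shows "lax_density F F' G meromorphic_on B"
  unfolding lax_density_entries [abs_def] by (intro meromorphic_intros assms)

lemma lax_density_holomorphic: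
  fixes F F' G :: "complex \<Rightarrow> complex^'n^'n"
  assumes "\<And>i j. (\<lambda>z. F z $ i $ j) holomorphic_on B" "\<And>i j. (\<lambda>z. F' z $ i $ j) holomorphic_on B"
    "\<And>i j. (\<lambda>z. G z $ i $ j) holomorphic_on B" "open B"
  shows "lax_density F F' G holomorphic_on B"
  unfolding lax_density_entries [abs_def] by (intro holomorphic_intros holomorphic_deriv assms)

lemma mat_mero_eventually_analytic:
  assumes "mat_mero F z0" shows "\<forall>\<^sub>F z in at z0. mat_analytic F z"
  unfolding mat_analytic_def
proof (intro eventually_all_finite)
  fix i j
  have "isolated_singularity_at (\<lambda>z. F z $ i $ j) z0"
    using assms by (auto simp: mat_mero_def meromorphic_at_iff)
  then obtain r where r: "r > 0" "(\<lambda>z. F z $ i $ j) analytic_on ball z0 r - {z0}"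
    by (auto simp: isolated_singularity_at_def)
  have "\<forall>\<^sub>F z in at z0. z \<in> ball z0 r - {z0}" using eventually_at_in_open[of "ball z0 r" z0] r(1) by simp
  thus "\<forall>\<^sub>F z in at z0. (\<lambda>z. F z $ i $ j) analytic_on {z}"
    by (rule eventually_mono) (use r(2) analytic_on_subset in blast)
qed

lemma mat_mero_trace_mult:
  assumes "mat_mero F z0" "mat_mero F' z0"
  shows "(\<lambda>z. trace (F z ** F' z)) meromorphic_on {z0}"
  unfolding trace_mult using assms by (intro meromorphic_intros) (auto simp: mat_mero_def)

lemma mat_mero_lie:
  assumes "mat_mero F z0" "mat_mero F' z0"
  shows "mat_mero (\<lambda>z. lie (F z) (F' z)) z0"
  unfolding mat_mero_def lie_def vector_minus_component matrix_mult_nth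
  using assms by (intro allI meromorphic_intros) (auto simp: mat_mero_def)

lemma mat_mero_add: "mat_mero F z0 \<Longrightarrow> mat_mero H z0 \<Longrightarrow> mat_mero (\<lambda>z. F z + H z) z0"
  by (auto simp: mat_mero_def intro!: meromorphic_intros)

lemma mat_mero_cscale: "mat_mero F z0 \<Longrightarrow> mat_mero (\<lambda>z. cscale a (F z)) z0"
  by (auto simp: mat_mero_def intro!: meromorphic_intros)

lemma mat_deriv_works:
  assumes "mat_analytic F z"
  shows "((\<lambda>w. F w $ i $ j) has_field_derivative mat_deriv F z $ i $ j) (at z)"
  using assms by (auto simp: mat_analytic_def intro!: analytic_derivI)

lemma mat_deriv_mult:
  assumes "mat_analytic F z" "mat_analytic H z"
  shows "mat_deriv (\<lambda>w. F w ** H w) z = mat_deriv F z ** H z + F z ** mat_deriv H z"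
proof -
  have "deriv (\<lambda>w. \<Sum>k\<in>UNIV. F w $ i $ k * H w $ k $ j) z =
     (\<Sum>k\<in>UNIV. mat_deriv F z $ i $ k * H z $ k $ j + mat_deriv H z $ k $ j * F z $ i $ k)" for i j
    by (intro DERIV_imp_deriv DERIV_sum DERIV_mult mat_deriv_works assms)
  thus ?thesis by (simp add: vec_eq_iff matrix_mult_nth sum.distrib mult.commute)
qed

lemma mat_deriv_lie:
  assumes "mat_analytic F z" "mat_analytic H z"
  shows "mat_deriv (\<lambda>w. lie (F w) (H w)) z = lie (mat_deriv F z) (H z) + lie (F z) (mat_deriv H z)"
proof -
  have an: "mat_analytic (\<lambda>w. F w ** H w) z" "mat_analytic (\<lambda>w. H w ** F w) z"
    using assms by (auto simp: mat_analytic_def matrix_mult_nth intro!: analytic_intros)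
  have "deriv (\<lambda>w. (F w ** H w) $ i $ j - (H w ** F w) $ i $ j) z =
      mat_deriv (\<lambda>w. F w ** H w) z $ i $ j - mat_deriv (\<lambda>w. H w ** F w) z $ i $ j" for i j
    by (intro DERIV_imp_deriv DERIV_diff mat_deriv_works an)
  hence "mat_deriv (\<lambda>w. lie (F w) (H w)) z = mat_deriv (\<lambda>w. F w ** H w) z - mat_deriv (\<lambda>w. H w ** F w) z"
    by (simp add: vec_eq_iff lie_def del: mat_deriv_nth) (simp add: mat_deriv_def)
  thus ?thesis using assms by (simp add: mat_deriv_mult lie_def)
qed

lemma deriv_trace_product:
  assumes "mat_analytic F z" "mat_analytic H z"
  shows "deriv (\<lambda>w. trace (F w ** H w)) z = trace (mat_deriv F z ** H z) + trace (F z ** mat_deriv H z)"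
proof -
  have "mat_analytic (\<lambda>w. F w ** H w) z"
    using assms by (auto simp: mat_analytic_def matrix_mult_nth intro!: analytic_intros)
  hence "deriv (\<lambda>w. trace (F w ** H w)) z = trace (mat_deriv (\<lambda>w. F w ** H w) z)"
    unfolding trace_def by (intro DERIV_imp_deriv DERIV_sum mat_deriv_works)
  thus ?thesis using assms by (simp add: mat_deriv_mult trace_add)
qed

definition lax_residue where
  "lax_residue F F' G z0 = residue (lax_density F F' G) z0"

lemma mat_mero_lax_density:
  "mat_mero F z0 \<Longrightarrow> mat_mero F' z0 \<Longrightarrow> mat_mero G z0 \<Longrightarrow> lax_density F F' G meromorphic_on {z0}"
  by (rule lax_density_meromorphic) (auto simp: mat_mero_def)

context
  fixes G :: "complex \<Rightarrow> complex^'n^'n" and z0 :: complex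
  assumes G: "mat_mero G z0"
begin

lemma lax_residue_add_left:
  assumes "mat_mero F z0" "mat_mero H z0" "mat_mero F' z0"
  shows "lax_residue (\<lambda>z. F z + H z) F' G z0 = lax_residue F F' G z0 + lax_residue H F' G z0"
proof -
  have "lax_density (\<lambda>z. F z + H z) F' G = (\<lambda>z. lax_density F F' G z + lax_density H F' G z)"
    by (simp add: lax_density_def matrix_mult_add lie_add_left trace_add trace_sub fun_eq_iff)
  thus ?thesis
    by (simp add: lax_residue_def residue_add_meromorphic mat_mero_lax_density assms G)
qed

lemma lax_residue_cscale_left:
  assumes "mat_mero F z0" "mat_mero F' z0"
  shows "lax_residue (\<lambda>z. cscale a (F z)) F' G z0 = a * lax_residue F F' G z0"
proof -
  have "lax_density (\<lambda>z. cscale a (F z)) F' G = (\<lambda>z. a * lax_density F F' G z)"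
    by (simp add: lax_density_def cscale_mult_left lie_cscale trace_cscale trace_sub fun_eq_iff right_diff_distrib)
  thus ?thesis
    by (simp add: lax_residue_def residue_cmult_meromorphic mat_mero_lax_density assms G)
qed

lemma lax_residue_antisym:
  assumes F: "mat_mero F z0" "mat_mero F' z0"
  shows "lax_residue F' F G z0 = - lax_residue F F' G z0"
proof -
  have "lax_residue F F' G z0 + lax_residue F' F G z0 = residue (\<lambda>z. lax_density F F' G z + lax_density F' F G z) z0"
    by (simp add: lax_residue_def residue_add_meromorphic mat_mero_lax_density assms G)
  also have "\<dots> = residue (deriv (\<lambda>z. trace (F z ** F' z))) z0"
  proof (rule residue_cong)
    show "\<forall>\<^sub>F z in at z0. lax_density F F' G z + lax_density F' F G z = deriv (\<lambda>z. trace (F z ** F' z)) z"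
      using mat_mero_eventually_analytic[OF F(1)] mat_mero_eventually_analytic[OF F(2)]
    proof eventually_elim
      case (elim z)
      have "trace (lie (F' z) (F z) ** G z) = - trace (lie (F z) (F' z) ** G z)"
        using lie_skew[of "F' z" "F z"] by (simp add: matrix_mult_uminus trace_uminus)
      thus ?case using trace_mul_sym[of "mat_deriv F z" "F' z"]
        by (simp add: lax_density_def trace_sub deriv_trace_product elim)
    qed
  qed auto
  also have "\<dots> = 0" by (intro residue_deriv_meromorphic mat_mero_trace_mult F)
  finally show ?thesis by (simp add: eq_neg_iff_add_eq_0 add.commute)
qed

text \<open>Linearity in the second argument, where a derivative is taken, follows from antisymmetry
  and linearity in the first.\<close>

lemma lax_residue_add_right:
  assumes "mat_mero F z0" "mat_mero H z0" "mat_mero F' z0"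
  shows "lax_residue F' (\<lambda>z. F z + H z) G z0 = lax_residue F' F G z0 + lax_residue F' H G z0"
  using lax_residue_antisym[OF mat_mero_add[OF assms(1,2)] assms(3)] lax_residue_add_left[OF assms]
    lax_residue_antisym[OF assms(1,3)] lax_residue_antisym[OF assms(2,3)] by simp

lemma lax_residue_cscale_right:
  assumes "mat_mero F z0" "mat_mero F' z0"
  shows "lax_residue F' (\<lambda>z. cscale a (F z)) G z0 = a * lax_residue F' F G z0"
  using lax_residue_antisym[OF mat_mero_cscale[OF assms(1)] assms(2), of a] lax_residue_cscale_left[OF assms, of a]
    lax_residue_antisym[OF assms] by simp

lemma lax_residue_cocycle:
  assumes XYZ: "mat_mero X z0" "mat_mero Y z0" "mat_mero Z z0"
  shows "lax_residue (\<lambda>z. lie (X z) (Y z)) Z G z0 + lax_residue (\<lambda>z. lie (Y z) (Z z)) X G z0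
    + lax_residue (\<lambda>z. lie (Z z) (X z)) Y G z0 = 0"
proof -
  note m = mat_mero_lax_density[OF mat_mero_lie]
  have "lax_residue (\<lambda>z. lie (X z) (Y z)) Z G z0 + lax_residue (\<lambda>z. lie (Y z) (Z z)) X G z0
    + lax_residue (\<lambda>z. lie (Z z) (X z)) Y G z0 = residue (\<lambda>z. lax_density (\<lambda>z. lie (X z) (Y z)) Z G z +
       lax_density (\<lambda>z. lie (Y z) (Z z)) X G z + lax_density (\<lambda>z. lie (Z z) (X z)) Y G z) z0"
    unfolding lax_residue_def
    by (subst residue_add_meromorphic, intro meromorphic_intros m XYZ G, intro m XYZ G)
       (subst residue_add_meromorphic, auto intro!: m XYZ G)
  also have "\<dots> = residue (deriv (\<lambda>z. trace (lie (X z) (Y z) ** Z z))) z0"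
  proof (rule residue_cong)
    show "\<forall>\<^sub>F z in at z0. lax_density (\<lambda>z. lie (X z) (Y z)) Z G z +
       lax_density (\<lambda>z. lie (Y z) (Z z)) X G z + lax_density (\<lambda>z. lie (Z z) (X z)) Y G z =
       deriv (\<lambda>z. trace (lie (X z) (Y z) ** Z z)) z"
      using mat_mero_eventually_analytic[OF XYZ(1)] mat_mero_eventually_analytic[OF XYZ(2)]
        mat_mero_eventually_analytic[OF XYZ(3)]
    proof eventually_elim
      case (elim z)
      have "deriv (\<lambda>z. trace (lie (X z) (Y z) ** Z z)) z = trace (lie (mat_deriv X z) (Y z) ** Z z) +
          trace (lie (X z) (mat_deriv Y z) ** Z z) + trace (lie (X z) (Y z) ** mat_deriv Z z)"
        using elim by (simp add: deriv_trace_product mat_analytic_lie mat_deriv_lie matrix_mult_add trace_add)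
      \<comment> \<open>Rotation of the traces moves each derivative to the last position; the three
        cyclic brackets of the cocycle identity appear.\<close>
      also have "trace (lie (mat_deriv X z) (Y z) ** Z z) = trace (lie (Y z) (Z z) ** mat_deriv X z)"
        by (rule trace_lie_rotate')
      also have "trace (lie (X z) (mat_deriv Y z) ** Z z) = trace (lie (Z z) (X z) ** mat_deriv Y z)"
        using trace_lie_rotate[of "X z" "mat_deriv Y z" "Z z"] trace_mul_sym[of "mat_deriv Y z" "lie (Z z) (X z)"]
        by (rule trans)
      finally show ?case using trace_lie_jacobi[of "X z" "Y z" "Z z" "G z"]
        by (simp add: lax_density_def trace_sub algebra_simps)
    qed
  qed auto
  also have "\<dots> = 0" by (intro residue_deriv_meromorphic mat_mero_trace_mult mat_mero_lie XYZ)
  finally show ?thesis .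
qed

end

text \<open>The differential costs one order and the 1-form costs \<open>n\<close>; with
  \<open>n \<ge> 1\<close> the second loss bounds both summands.\<close>

lemma lax_density_order:
  fixes F F' G :: "complex \<Rightarrow> complex^'n^'n"
  assumes "\<And>i j. order_at_least m (\<lambda>z. F z $ i $ j) z0" "\<And>i j. order_at_least m' (\<lambda>z. F' z $ i $ j) z0"
    "\<And>i j. order_at_least (- int n) (\<lambda>z. G z $ i $ j) z0" "n \<ge> 1"
  shows "order_at_least (m + m' - int n) (lax_density F F' G) z0"
  unfolding lax_density_entries [abs_def]
proof (intro order_at_least_diff order_at_least_sum)
  fix i k
  have "order_at_least (m + (m' - 1)) (\<lambda>z. F z $ i $ k * deriv (\<lambda>w. F' w $ k $ i) z) z0"
    using order_at_least_mult[OF assms(1) order_at_least_deriv[OF assms(2)]] by simp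
  thus "order_at_least (m + m' - int n) (\<lambda>z. F z $ i $ k * deriv (\<lambda>w. F' w $ k $ i) z) z0"
    by (rule order_at_least_mono) (use assms(4) in simp)
  have "order_at_least (m + m') (\<lambda>z. (\<Sum>l\<in>UNIV. F z $ i $ l * F' z $ l $ k) - (\<Sum>l\<in>UNIV. F' z $ i $ l * F z $ l $ k)) z0"
    using order_at_least_mult[OF assms(1,2)] order_at_least_mult[OF assms(2,1)]
    by (intro order_at_least_diff order_at_least_sum) (simp_all add: add.commute)
  from order_at_least_mult[OF this assms(3)]
  show "order_at_least (m + m' - int n) (\<lambda>z. ((\<Sum>l\<in>UNIV. F z $ i $ l * F' z $ l $ k) - (\<Sum>l\<in>UNIV. F' z $ i $ l * F z $ l $ k)) * G z $ k $ i) z0"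
    by simp
qed

lemma mat_mero_order:
  fixes G :: "complex \<Rightarrow> complex^'n^'n"
  assumes "mat_mero G z0"
  obtains n :: nat where "n \<ge> 1" "\<And>i j. order_at_least (- int n) (\<lambda>z. G z $ i $ j) z0"
proof -
  have "\<forall>i j. \<exists>n::nat. order_at_least (- int n) (\<lambda>z. G z $ i $ j) z0"
    using assms meromorphic_imp_order_at_least by (auto simp: mat_mero_def)
  then obtain n :: "'n \<Rightarrow> 'n \<Rightarrow> nat" where n: "\<forall>i j. order_at_least (- int (n i j)) (\<lambda>z. G z $ i $ j) z0"
    by (simp only: choice_iff) blast
  \<comment> \<open>The sum dominates every entry's pole order, and the successor makes the bound
    positive.\<close>
  define N where "N = Suc (\<Sum>i\<in>UNIV. \<Sum>j\<in>UNIV. n i j)"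
  have "n i j \<le> N" for i j
  proof -
    have "n i j \<le> (\<Sum>j\<in>UNIV. n i j)" by (rule member_le_sum) auto
    also have "\<dots> \<le> (\<Sum>i\<in>UNIV. \<Sum>j\<in>UNIV. n i j)" by (rule member_le_sum[of i UNIV "\<lambda>i. \<Sum>j\<in>UNIV. n i j"]) auto
    finally show ?thesis by (simp add: N_def)
  qed
  hence "order_at_least (- int N) (\<lambda>z. G z $ i $ j) z0" for i j
    using n order_at_least_mono[of "- int (n i j)"] by simp
  moreover have "N \<ge> 1" by (simp add: N_def)
  ultimately show ?thesis using that by blast
qed

lemma order_at_least_0_remove_sings:
  assumes "order_at_least 0 f z0"
  shows "remove_sings f analytic_on {z0}" "(f \<longlongrightarrow> remove_sings f z0) (at z0)"
proof -
  obtain h where h: "h analytic_on {z0}" "\<forall>\<^sub>F z in at z0. f z = h z"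
    using assms by (auto simp: order_at_least_def)
  obtain V where V: "open V" "z0 \<in> V" "h holomorphic_on V" using h(1) by (auto simp: analytic_at)
  obtain W where W: "open W" "z0 \<in> W" "\<And>z. z \<in> W \<Longrightarrow> z \<noteq> z0 \<Longrightarrow> f z = h z"
    using h(2) unfolding eventually_at_topological by blast
  have lim: "(f \<longlongrightarrow> h z) (at z)" if z: "z \<in> V \<inter> W" for z
  proof -
    have "(h \<longlongrightarrow> h z) (at z)"
      using V z holomorphic_on_imp_continuous_on[OF V(3)] by (simp add: continuous_on_eq_continuous_at isCont_def)
    moreover have "\<forall>\<^sub>F w in at z. h w = f w"
    proof (cases "z = z0")
      case True thus ?thesis using h(2) by (auto elim: eventually_mono)
    next
      case False
      have "\<forall>\<^sub>F w in at z. w \<in> W - {z0}"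
        using z False W by (intro eventually_at_in_open') auto
      thus ?thesis by (rule eventually_mono) (use W in auto)
    qed
    ultimately show ?thesis by (rule Lim_transform_eventually)
  qed
  have eq: "remove_sings f z = h z" if "z \<in> V \<inter> W" for z using lim[OF that] by (rule remove_sings_eqI)
  show "(f \<longlongrightarrow> remove_sings f z0) (at z0)" using lim[of z0] eq[of z0] V W by simp
  have "remove_sings f holomorphic_on V \<inter> W"
    by (rule holomorphic_transform[of h]) (use eq V(3) holomorphic_on_subset in auto)
  thus "remove_sings f analytic_on {z0}" using V W by (auto simp: analytic_at intro!: exI[of _ "V \<inter> W"])
qed

section \<open>Change of charts\<close>

text \<open>With \<open>T z - T z0 = (z - z0) t z\<close> and \<open>s = \<phi>/t\<close>, the principal part \<open>\<phi> M/(T z - T z0)\<close> is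
  \<open>s M/(z - z0)\<close>, which is expanded to first order. The cases \<open>\<phi> = 1\<close> and \<open>\<phi> = T'\<close> are the transformation
  rules of functions and 1-forms.\<close>

lemma simple_expansion_compose:
  fixes F :: "complex \<Rightarrow> complex^'n^'n"
  assumes F: "simple_expansion F (T z0) M N" and T: "T analytic_on {z0}" "deriv T z0 \<noteq> 0"
    and \<phi>: "\<phi> analytic_on {z0}"
  obtains e where "simple_expansion (\<lambda>z. cscale (\<phi> z) (F (T z))) z0 (cscale (\<phi> z0 / deriv T z0) M)
    (cscale (\<phi> z0) N + cscale e M)"
proof -
  obtain t where t: "t analytic_on {z0}" "\<And>z. T z - T z0 = (z - z0) * t z" "t z0 = deriv T z0" "\<forall>\<^sub>F z in at z0. t z \<noteq> 0"
    by (rule coordinate_factor[OF T]) (rule that)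
  define s where "s = (\<lambda>z. \<phi> z / t z)"
  have s: "s analytic_on {z0}" unfolding s_def using t(1,3) T(2) by (intro analytic_intros \<phi>) auto
  have "simple_expansion (\<lambda>z. cscale (\<phi> z) (F (T z))) z0 (cscale (\<phi> z0 / deriv T z0) M)
    (cscale (\<phi> z0) N + cscale (deriv s z0) M)"
    unfolding simple_expansion_def
  proof (intro allI)
    fix i j
    have "order_at_least 1 (\<lambda>z. F (T z) $ i $ j - (M $ i $ j / (T z - T z0) + N $ i $ j)) z0"
      by (rule order_at_least_compose[OF _ T, of 1 "\<lambda>w. F w $ i $ j - (M $ i $ j / (w - T z0) + N $ i $ j)"])
         (use F in \<open>simp add: simple_expansion_def\<close>)
    from order_at_least_mult[OF order_at_least_analytic[OF \<phi>] this]
    have 1: "order_at_least 1 (\<lambda>z. \<phi> z * (F (T z) $ i $ j - (M $ i $ j / (T z - T z0) + N $ i $ j))) z0" by simp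
    have 2: "order_at_least 1 (\<lambda>z. M $ i $ j * (s z / (z - z0) - (s z0 / (z - z0) + deriv s z0))) z0"
      by (intro order_at_least_cmult order_at_least_expansion s)
    have 3: "order_at_least 1 (\<lambda>z. N $ i $ j * (\<phi> z - \<phi> z0)) z0"
      by (intro order_at_least_cmult order_at_least_1_vanishing analytic_on_diff \<phi>) auto
    have eq: "(\<phi> z * (F (T z) $ i $ j - (M $ i $ j / (T z - T z0) + N $ i $ j))
          + M $ i $ j * (s z / (z - z0) - (s z0 / (z - z0) + deriv s z0))) + N $ i $ j * (\<phi> z - \<phi> z0)
       = cscale (\<phi> z) (F (T z)) $ i $ j - (cscale (\<phi> z0 / deriv T z0) M $ i $ j / (z - z0)
          + (cscale (\<phi> z0) N + cscale (deriv s z0) M) $ i $ j)" for z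
    proof -
      have "\<phi> z * (M $ i $ j / (T z - T z0)) = M $ i $ j * (s z / (z - z0))"
        by (simp add: t(2) s_def mult_ac)
      moreover have "cscale (\<phi> z0 / deriv T z0) M $ i $ j / (z - z0) = M $ i $ j * (s z0 / (z - z0))"
        by (simp add: s_def t(3))
      ultimately show ?thesis by (simp add: right_diff_distrib distrib_left)
    qed
    from order_at_least_add[OF order_at_least_add[OF 1 2] 3]
    show "order_at_least 1 (\<lambda>z. cscale (\<phi> z) (F (T z)) $ i $ j - (cscale (\<phi> z0 / deriv T z0) M $ i $ j / (z - z0)
          + (cscale (\<phi> z0) N + cscale (deriv s z0) M) $ i $ j)) z0"
      unfolding eq .
  qed
  thus ?thesis by (rule that)
qed

lemma simple_expansion_cong:
  fixes F G :: "complex \<Rightarrow> complex^'n^'n"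
  assumes "simple_expansion F z0 M N" "\<forall>\<^sub>F z in at z0. G z = F z"
  shows "simple_expansion G z0 M N"
  unfolding simple_expansion_def
proof (intro allI)
  fix i j
  have "\<forall>\<^sub>F z in at z0. G z $ i $ j - (M $ i $ j / (z - z0) + N $ i $ j) = F z $ i $ j - (M $ i $ j / (z - z0) + N $ i $ j)"
    using assms(2) by eventually_elim simp
  thus "order_at_least 1 (\<lambda>z. G z $ i $ j - (M $ i $ j / (z - z0) + N $ i $ j)) z0"
    by (rule iffD2[OF order_at_least_cong]) (use assms(1) in \<open>simp add: simple_expansion_def\<close>)
qed

text \<open>A change of coordinate adds a multiple of the residue matrix to the constant term. Since
  \<open>a\<close> is an eigenvector of the residue matrix, the eigenvector condition on the
  constant term survives.\<close>

lemma skew_outer_mult_vec_eq: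
  assumes "bdot a a = 0" shows "skew_outer a b *v a = bdot b a *s a"
  using assms by (simp add: skew_outer_def matrix_vector_mult_diff_rdistrib outer_mult_vec)

context surface
begin

text \<open>The point \<open>p\<close> may itself belong to \<open>D\<close>: the punctured filter
  excludes it, and the remaining finite part of \<open>D\<close> is closed.\<close>

lemma eventually_chart_off:
  assumes c: "c \<in> A" and p: "p \<in> fst c" and D: "finite D" and W: "openin X W" "p \<in> W"
  shows "\<forall>\<^sub>F z in at (snd c p). z \<in> snd c ` (fst c \<inter> W - D)"
proof -
  have "closedin X (topspace X \<inter> (D - {p}))"
    using Hausdorff D by (intro closedin_Hausdorff_finite) auto
  hence o: "openin X (W \<inter> (topspace X - topspace X \<inter> (D - {p})))" using W(1) by auto
  have pU: "p \<in> W \<inter> (topspace X - topspace X \<inter> (D - {p}))" using p W chart_subset[OF c] by auto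
  have "\<forall>\<^sub>F z in at (snd c p). z \<in> snd c ` (fst c \<inter> (W \<inter> (topspace X - topspace X \<inter> (D - {p})))) - {snd c p}"
    by (rule eventually_at_in_open[OF open_image_chart[OF c o]]) (use p pU in auto)
  thus ?thesis
    by (rule eventually_mono) auto
qed

lemma eventually_chart_img:
  assumes "c \<in> A" "p \<in> fst c" shows "\<forall>\<^sub>F z in at (snd c p). z \<in> chart_img c"
  using eventually_at_in_open'[OF open_chart_img[OF assms(1)]] assms by blast

lemma transition_analytic:
  assumes "c \<in> A" "c' \<in> A" "p \<in> fst c" "p \<in> fst c'" shows "transition c c' analytic_on {snd c p}"
  using transition_holomorphic[OF assms(1,2)] open_overlap[OF assms(1,2)] assms(3,4) by (auto simp: analytic_at)

lemma eventually_in_chart_trans: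
  assumes c: "c \<in> A" "c' \<in> A" and p: "p \<in> fst c" "p \<in> fst c'"
  shows "\<forall>\<^sub>F z in at (snd c p). in_chart c f z = in_chart c' f (transition c c' z)"
proof -
  have "\<forall>\<^sub>F z in at (snd c p). z \<in> snd c ` (fst c \<inter> fst c')"
    by (rule eventually_at_in_open'[OF open_overlap[OF c]]) (use p in auto)
  thus ?thesis by (rule eventually_mono) (rule in_chart_trans[OF c])
qed

lemma fun_order_change_chart:
  assumes c: "c \<in> A" "c' \<in> A" and p: "p \<in> fst c" "p \<in> fst c'"
    and o: "order_at_least m (in_chart c' f) (snd c' p)"
  shows "order_at_least m (in_chart c f) (snd c p)"
proof -
  have "order_at_least m (\<lambda>z. in_chart c' f (transition c c' z)) (snd c p)"
    by (rule order_at_least_compose[OF _ transition_analytic[OF c p] transition_deriv_nonzero[OF c p]])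
       (use o c p in \<open>simp add: transition_eq\<close>)
  thus ?thesis by (rule iffD2[OF order_at_least_cong[OF eventually_in_chart_trans[OF c p]]])
qed

lemma fun_order_at_least_chart:
  assumes "fun_order_at_least A m L p" "c \<in> A" "p \<in> fst c"
  shows "order_at_least m (\<lambda>z. in_chart c L z $ i $ j) (snd c p)"
proof -
  obtain c' where c': "c' \<in> A" "p \<in> fst c'" "order_at_least m (in_chart c' (\<lambda>q. L q $ i $ j)) (snd c' p)"
    using assms(1) by (auto simp: fun_order_at_least_def charts_at_def)
  have "order_at_least m (in_chart c (\<lambda>q. L q $ i $ j)) (snd c p)"
    by (rule fun_order_change_chart[OF assms(2) c'(1) assms(3) c'(2,3)])
  thus ?thesis by (simp add: in_chart_def [abs_def])
qed

definition form_rule :: "'a set \<Rightarrow> ('a, complex) form \<Rightarrow> bool" where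
  "form_rule D \<omega> \<longleftrightarrow> (\<forall>c\<in>A. \<forall>c'\<in>A. \<forall>p\<in>fst c \<inter> fst c' - D. \<omega> c p = \<omega> c' p * deriv (transition c c') (snd c p))"

lemma eventually_form_trans:
  assumes c: "c \<in> A" "c' \<in> A" and p: "p \<in> fst c" "p \<in> fst c'" and D: "finite D" "form_rule D \<omega>"
  shows "\<forall>\<^sub>F z in at (snd c p). in_chart c (\<omega> c) z = in_chart c' (\<omega> c') (transition c c' z) * deriv (transition c c') z"
proof -
  have "\<forall>\<^sub>F z in at (snd c p). z \<in> snd c ` (fst c \<inter> fst c' - D)"
    by (rule eventually_chart_off[OF c(1) p(1) D(1) open_chart_dom[OF c(2)] p(2)])
  thus ?thesis
  proof (rule eventually_mono)
    fix z assume "z \<in> snd c ` (fst c \<inter> fst c' - D)"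
    then obtain q where q: "q \<in> fst c \<inter> fst c' - D" "z = snd c q" by auto
    have "\<omega> c q = \<omega> c' q * deriv (transition c c') (snd c q)"
      using D(2) c q(1) unfolding form_rule_def by blast
    moreover have "in_chart c (\<omega> c) z = \<omega> c q" "in_chart c' (\<omega> c') (transition c c' z) = \<omega> c' q"
      using q c by (simp_all add: in_chart_eq)
    ultimately show "in_chart c (\<omega> c) z = in_chart c' (\<omega> c') (transition c c' z) * deriv (transition c c') z"
      using q(2) by (simp only:)
  qed
qed

lemma form_order_change_chart:
  assumes c: "c \<in> A" "c' \<in> A" and p: "p \<in> fst c" "p \<in> fst c'" and D: "finite D" "form_rule D \<omega>"
    and o: "order_at_least m (in_chart c' (\<omega> c')) (snd c' p)"
  shows "order_at_least m (in_chart c (\<omega> c)) (snd c p)"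
proof -
  have "order_at_least m (\<lambda>z. in_chart c' (\<omega> c') (transition c c' z)) (snd c p)"
    by (rule order_at_least_compose[OF _ transition_analytic[OF c p] transition_deriv_nonzero[OF c p]])
       (use o c p in \<open>simp add: transition_eq\<close>)
  from order_at_least_mult[OF this order_at_least_analytic[OF analytic_deriv[OF transition_analytic[OF c p]]]]
  show ?thesis using order_at_least_cong[OF eventually_form_trans[OF c p D]] by simp
qed

lemma lax_at_chart:
  assumes L: "lax_at A p a L" and a: "bdot a a = 0" and c: "c \<in> A" "p \<in> fst c"
  obtains L0 b k where "simple_expansion (in_chart c L) (snd c p) (skew_outer a b) L0" "bdot b a = 0" "L0 *v a = k *s a"
proof -
  obtain c' N b k where c': "c' \<in> A" "p \<in> fst c'" and 1: "simple_expansion (in_chart c' L) (snd c' p) (skew_outer a b) N"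
     "bdot b a = 0" "N *v a = k *s a"
    using L by (auto simp: lax_at_def charts_at_def skew_outer_def)
  define T where "T = transition c c'"
  have T: "T analytic_on {snd c p}" "deriv T (snd c p) \<noteq> 0" "T (snd c p) = snd c' p"
    unfolding T_def using transition_analytic transition_deriv_nonzero c c' by (auto simp: transition_eq)
  obtain e where "simple_expansion (\<lambda>z. cscale 1 (in_chart c' L (T z))) (snd c p)
      (cscale (1 / deriv T (snd c p)) (skew_outer a b)) (cscale 1 N + cscale e (skew_outer a b))"
    by (rule simple_expansion_compose[OF 1(1)[folded T(3)] T(1,2), of "\<lambda>_. 1"]) (simp, rule that)
  hence e: "simple_expansion (\<lambda>z. in_chart c' L (T z)) (snd c p)
      (cscale (1 / deriv T (snd c p)) (skew_outer a b)) (N + cscale e (skew_outer a b))"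
    by (simp only: cscale_1)
  \<comment> \<open>The factor by which the residue of a function changes is absorbed into
    \<open>b\<close>; orthogonality to \<open>a\<close> is unaffected by scaling.\<close>
  define b' where "b' = (1 / deriv T (snd c p)) *s b"
  have scale: "cscale (1 / deriv T (snd c p)) (skew_outer a b) = skew_outer a b'"
    by (simp add: b'_def skew_outer_def vec_eq_iff right_diff_distrib)
  have "\<forall>\<^sub>F z in at (snd c p). in_chart c L z = in_chart c' L (T z)"
    unfolding T_def by (rule eventually_in_chart_trans[OF c(1) c'(1) c(2) c'(2)])
  from simple_expansion_cong[OF e[unfolded scale] this]
  have "simple_expansion (in_chart c L) (snd c p) (skew_outer a b') (N + cscale e (skew_outer a b))" .
  moreover have "bdot b' a = 0" using 1(2) by (simp add: b'_def bdot_scale)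
  moreover have "(N + cscale e (skew_outer a b)) *v a = k *s a"
    by (simp add: matrix_vector_mult_add_rdistrib 1 cscale_mult_vec skew_outer_mult_vec_eq[OF a])
  ultimately show ?thesis by (rule that)
qed

text \<open>For a 1-form the derivative of the transition map cancels the factor in the principal
  part. The residue matrix is the same in all charts, which makes the normalization
  \<open>bdot b a = 1\<close> meaningful; only the eigenvalue changes.\<close>

lemma lax_form_at_chart:
  fixes \<L> :: "('a, complex^'n^'n) form"
  assumes L: "lax_form_at A p a \<L>" and a: "bdot a a = 0" and c: "c \<in> A" "p \<in> fst c"
    and D: "finite D" "\<And>i j. form_rule D (\<lambda>c p. \<L> c p $ i $ j)"
  obtains L0 b k where "simple_expansion (in_chart c (\<L> c)) (snd c p) (skew_outer a b) L0" "bdot b a = 1" "L0 *v a = k *s a"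
proof -
  obtain c' N b k where c': "c' \<in> A" "p \<in> fst c'" and 1: "simple_expansion (in_chart c' (\<L> c')) (snd c' p) (skew_outer a b) N"
     "bdot b a = 1" "N *v a = k *s a"
    using L by (auto simp: lax_form_at_def charts_at_def skew_outer_def)
  define T where "T = transition c c'"
  have T: "T analytic_on {snd c p}" "deriv T (snd c p) \<noteq> 0" "T (snd c p) = snd c' p"
    unfolding T_def using transition_analytic transition_deriv_nonzero c c' by (auto simp: transition_eq)
  obtain e where e: "simple_expansion (\<lambda>z. cscale (deriv T z) (in_chart c' (\<L> c') (T z))) (snd c p)
      (cscale (deriv T (snd c p) / deriv T (snd c p)) (skew_outer a b))
      (cscale (deriv T (snd c p)) N + cscale e (skew_outer a b))"
    by (rule simple_expansion_compose[OF 1(1)[folded T(3)] T(1,2) analytic_deriv[OF T(1)]]) (rule that)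
  have "\<forall>\<^sub>F z in at (snd c p). \<forall>i j. in_chart c (\<L> c) z $ i $ j = in_chart c' (\<L> c') (T z) $ i $ j * deriv T z"
  proof (intro eventually_all_finite)
    fix i j
    show "\<forall>\<^sub>F z in at (snd c p). in_chart c (\<L> c) z $ i $ j = in_chart c' (\<L> c') (T z) $ i $ j * deriv T z"
      using eventually_form_trans[OF c(1) c'(1) c(2) c'(2) D(1) D(2)[of i j]] by (simp add: in_chart_def [abs_def] T_def)
  qed
  hence "\<forall>\<^sub>F z in at (snd c p). in_chart c (\<L> c) z = cscale (deriv T z) (in_chart c' (\<L> c') (T z))"
    by eventually_elim (simp add: vec_eq_iff mult.commute)
  from simple_expansion_cong[OF e this]
  have "simple_expansion (in_chart c (\<L> c)) (snd c p) (skew_outer a b) (cscale (deriv T (snd c p)) N + cscale e (skew_outer a b))"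
    using T(2) by (simp add: cscale_1)
  moreover have "(cscale (deriv T (snd c p)) N + cscale e (skew_outer a b)) *v a = (deriv T (snd c p) * k + e) *s a"
    by (simp add: matrix_vector_mult_add_rdistrib 1 cscale_mult_vec skew_outer_mult_vec_eq[OF a] vector_sadd_rdistrib)
  ultimately show ?thesis using 1(2) that by blast
qed

text \<open>The points of \<open>D\<close> other than \<open>P\<close> are removable singularities.
  Filling them in turns \<omega> into a form holomorphic off \<open>P\<close> without changing its
  residue there.\<close>

theorem residue_unique_pole_eq_0:
  assumes cpt: "compact_space X" and P: "P \<in> topspace X" and D: "finite D" "meromorphic_form A D \<omega>"
    and reg: "\<And>p. p \<in> topspace X - {P} \<Longrightarrow> form_regular_at A \<omega> p"
  shows "form_residue A \<omega> P = 0"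
proof -
  have rule: "form_rule D \<omega>" using D(2) unfolding meromorphic_form_def form_rule_def by (rule conjunct2)
  have mero: "in_chart c (\<omega> c) meromorphic_on {snd c p}" if "c \<in> A" "p \<in> fst c" for c p
  proof -
    have "in_chart c (\<omega> c) meromorphic_on chart_img c"
      using D(2) that(1) unfolding meromorphic_form_def by blast
    thus ?thesis by (rule meromorphic_on_subset) (use that(2) in simp)
  qed
  define F where "F = (\<lambda>c. remove_sings (in_chart c (\<omega> c)))"
  have order: "order_at_least 0 (in_chart c (\<omega> c)) (snd c p)" if "c \<in> A" "p \<in> fst c - {P}" for c p
  proof -
    have "form_regular_at A \<omega> p" using that chart_subset[OF that(1)] by (intro reg) auto
    moreover have "c \<in> charts_at A p" using that by (simp add: charts_at_def)
    ultimately show ?thesis unfolding form_regular_at_def by (rule bspec)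
  qed
  interpret punctured_form X A P F
  proof
    show "P \<in> topspace X" by fact
    show "F c holomorphic_on snd c ` (fst c - {P})" if c: "c \<in> A" for c
    proof -
      have "F c analytic_on {snd c p}" if "p \<in> fst c - {P}" for p
        unfolding F_def using order_at_least_0_remove_sings(1)[OF order[OF c that]] .
      hence "F c analytic_on (snd c ` (fst c - {P}))"
        by (subst analytic_on_analytic_at) auto
      thus ?thesis by (rule analytic_imp_holomorphic)
    qed
    fix c c' p assume c: "c \<in> A" "c' \<in> A" and p: "p \<in> fst c \<inter> fst c' - {P}"
    have p': "p \<in> fst c" "p \<in> fst c'" "p \<in> fst c - {P}" "p \<in> fst c' - {P}" using p by auto
    \<comment> \<open>At points of \<open>D\<close> the chain rule is not given. The filled-in
      coefficients are limits there, so the rule carries over from the punctured neighbourhood by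
      uniqueness of limits.\<close>
    have lim: "(in_chart c (\<omega> c) \<longlongrightarrow> F c (snd c p)) (at (snd c p))"
      "(in_chart c' (\<omega> c') \<longlongrightarrow> F c' (snd c' p)) (at (snd c' p))"
      unfolding F_def using order_at_least_0_remove_sings(2) order c p' by blast+
    have "filterlim (transition c c') (at (transition c c' (snd c p))) (at (snd c p))"
      by (rule coordinate_factor[OF transition_analytic[OF c p'(1,2)] transition_deriv_nonzero[OF c p'(1,2)]])
    hence "filterlim (transition c c') (at (snd c' p)) (at (snd c p))" using c p' by (simp add: transition_eq)
    from filterlim_compose[OF lim(2) this]
    have "((\<lambda>z. in_chart c' (\<omega> c') (transition c c' z) * deriv (transition c c') z) \<longlongrightarrow> F c' (snd c' p) * deriv (transition c c') (snd c p)) (at (snd c p))"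
      using analytic_at_imp_isCont[OF analytic_deriv[OF transition_analytic[OF c p'(1,2)]]]
      by (intro tendsto_mult) (auto simp: isCont_def)
    moreover have "\<forall>\<^sub>F z in at (snd c p). in_chart c' (\<omega> c') (transition c c' z) * deriv (transition c c') z = in_chart c (\<omega> c) z"
      using eventually_form_trans[OF c p'(1,2) D(1) rule] by eventually_elim simp
    ultimately have "(in_chart c (\<omega> c) \<longlongrightarrow> F c' (snd c' p) * deriv (transition c c') (snd c p)) (at (snd c p))"
      by (rule Lim_transform_eventually)
    thus "F c (snd c p) = F c' (snd c' p) * deriv (transition c c') (snd c p)"
      using lim(1) tendsto_unique trivial_limit_at by blast
  qed
  have "P \<in> (\<Union>c\<in>A. fst c)" unfolding charts_cover by (rule assms(2))
  hence "\<exists>c. c \<in> charts_at A P" by (auto simp: charts_at_def)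
  hence c0: "(SOME c. c \<in> charts_at A P) \<in> charts_at A P" by (rule someI_ex)
  define c0 where "c0 = (SOME c. c \<in> charts_at A P)"
  have c0': "c0 \<in> A" "P \<in> fst c0" using c0 by (auto simp: c0_def charts_at_def)
  have "F c0 meromorphic_on {snd c0 P}" unfolding F_def
    by (intro remove_sings_meromorphic mero c0')
  hence "residue (F c0) (snd c0 P) = 0"
    by (rule residue_puncture_eq_0[OF cpt c0'])
  moreover have "residue (F c0) (snd c0 P) = residue (in_chart c0 (\<omega> c0)) (snd c0 P)"
    unfolding F_def using mero[OF c0'] by (intro residue_remove_sings) (auto simp: meromorphic_at_iff)
  ultimately show ?thesis by (simp add: form_residue_def Let_def c0_def)
qed

end

section \<open>The cocycle of a Lax operator algebra\<close>

locale lax_form_data = surface X A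
  for X :: "'a topology" and A :: "'a chart set" +
  fixes P Q :: 'a and S :: "nat set" and \<gamma> :: "nat \<Rightarrow> 'a" and \<alpha> :: "nat \<Rightarrow> complex^'n"
    and \<L> :: "('a, complex^'n^'n) form"
  assumes compact: "compact_space X" and P: "P \<in> topspace X" and Q: "Q \<in> topspace X"
    and S: "finite S"
    and isotropic: "\<And>s. s \<in> S \<Longrightarrow> bdot (\<alpha> s) (\<alpha> s) = 0"
    and so_form: "so_form A (sing P Q S \<gamma>) \<L>"
    and lax_form_at: "\<And>s. s \<in> S \<Longrightarrow> lax_form_at A (\<gamma> s) (\<alpha> s) \<L>"
begin

abbreviation D :: "'a set" where "D \<equiv> sing P Q S \<gamma>"
abbreviation V :: "('a \<Rightarrow> complex^'n^'n) set" where "V \<equiv> lax_so X A P Q S \<gamma> \<alpha>"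

lemma finite_D: "finite D"
  using S by (simp add: sing_def)

lemma open_chart_minus_D: "c \<in> A \<Longrightarrow> open (snd c ` (fst c - D))"
proof -
  assume c: "c \<in> A"
  have "closedin X (topspace X \<inter> D)" using Hausdorff finite_D by (intro closedin_Hausdorff_finite) auto
  hence "open (snd c ` (fst c \<inter> (topspace X - topspace X \<inter> D)))" by (intro open_image_chart c) auto
  moreover have "fst c \<inter> (topspace X - topspace X \<inter> D) = fst c - D" using chart_subset[OF c] by auto
  ultimately show ?thesis by simp
qed

lemma
  assumes "L \<in> V" "c \<in> A"
  shows entry_holomorphic: "(\<lambda>z. in_chart c L z $ i $ j) holomorphic_on snd c ` (fst c - D)"
    and entry_meromorphic: "(\<lambda>z. in_chart c L z $ i $ j) meromorphic_on chart_img c"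
proof -
  have "meromorphic_fun A D (\<lambda>p. L p $ i $ j)" using assms(1) by (simp add: lax_so_def)
  hence "in_chart c (\<lambda>p. L p $ i $ j) holomorphic_on snd c ` (fst c - D)"
    "in_chart c (\<lambda>p. L p $ i $ j) meromorphic_on chart_img c"
    using assms(2) unfolding meromorphic_fun_def by blast+
  thus "(\<lambda>z. in_chart c L z $ i $ j) holomorphic_on snd c ` (fst c - D)"
    "(\<lambda>z. in_chart c L z $ i $ j) meromorphic_on chart_img c"
    by (simp_all add: in_chart_def [abs_def])
qed

lemma
  assumes "c \<in> A"
  shows form_entry_holomorphic: "(\<lambda>z. in_chart c (\<L> c) z $ i $ j) holomorphic_on snd c ` (fst c - D)"
    and form_entry_meromorphic: "(\<lambda>z. in_chart c (\<L> c) z $ i $ j) meromorphic_on chart_img c"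
proof -
  have "meromorphic_form A D (\<lambda>c p. \<L> c p $ i $ j)" using so_form by (simp add: so_form_def)
  hence "in_chart c (\<lambda>p. \<L> c p $ i $ j) holomorphic_on snd c ` (fst c - D)"
    "in_chart c (\<lambda>p. \<L> c p $ i $ j) meromorphic_on chart_img c"
    using assms unfolding meromorphic_form_def by blast+
  thus "(\<lambda>z. in_chart c (\<L> c) z $ i $ j) holomorphic_on snd c ` (fst c - D)"
    "(\<lambda>z. in_chart c (\<L> c) z $ i $ j) meromorphic_on chart_img c"
    by (simp_all add: in_chart_def [abs_def])
qed

lemma form_entry_rule: "form_rule D (\<lambda>c p. \<L> c p $ i $ j)"
proof -
  have "meromorphic_form A D (\<lambda>c p. \<L> c p $ i $ j)" using so_form by (simp add: so_form_def)
  thus ?thesis unfolding meromorphic_form_def form_rule_def by (rule conjunct2)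
qed

lemma mat_mero_chart:
  assumes "L \<in> V" "c \<in> A" "p \<in> fst c" shows "mat_mero (in_chart c L) (snd c p)"
  unfolding mat_mero_def
  by (intro allI meromorphic_on_subset[OF entry_meromorphic[OF assms(1,2)]]) (use assms in simp)

lemma mat_mero_form_chart:
  assumes "c \<in> A" "p \<in> fst c" shows "mat_mero (in_chart c (\<L> c)) (snd c p)"
  unfolding mat_mero_def
  by (intro allI meromorphic_on_subset[OF form_entry_meromorphic[OF assms(1)]]) (use assms in simp)

lemma differential_chart:
  assumes "c \<in> A" "p \<in> fst c"
  shows "differential L c p = mat_deriv (in_chart c L) (snd c p)"
  by (simp add: differential_def mat_deriv_def in_chart_def [abs_def])

lemma lax_form_chart:
  assumes "c \<in> A" "z \<in> chart_img c"
  shows "in_chart c (lax_form \<L> L L' c) z = lax_density (in_chart c L) (in_chart c L') (in_chart c (\<L> c)) z"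
proof -
  obtain p where p: "p \<in> fst c" "z = snd c p" using assms(2) by auto
  show ?thesis
    using assms(1) p by (simp add: in_chart_eq lax_form_def lax_density_def differential_chart)
qed

text \<open>Each summand picks up the derivative of the transition map exactly once, from the
  differential of \<open>L'\<close> and from \<L> respectively.\<close>

lemma lax_form_chain_rule:
  assumes L: "L' \<in> V" and c: "c \<in> A" "c' \<in> A" and p: "p \<in> fst c" "p \<in> fst c'" "p \<notin> D"
  shows "lax_form \<L> L L' c p = lax_form \<L> L L' c' p * deriv (transition c c') (snd c p)"
proof -
  define t where "t = deriv (transition c c') (snd c p)"
  have "deriv (\<lambda>w. in_chart c L' w $ i $ j) (snd c p) = deriv (\<lambda>w. in_chart c' L' w $ i $ j) (snd c' p) * t" for i j
  proof (rule DERIV_imp_deriv)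
    have "((\<lambda>w. in_chart c' L' w $ i $ j) has_field_derivative deriv (\<lambda>w. in_chart c' L' w $ i $ j) (snd c' p)) (at (snd c' p))"
      by (rule holomorphic_derivI[OF entry_holomorphic[OF L c(2)] open_chart_minus_D[OF c(2)]]) (use p in auto)
    hence "((\<lambda>w. in_chart c' L' w $ i $ j) has_field_derivative deriv (\<lambda>w. in_chart c' L' w $ i $ j) (snd c' p)) (at (transition c c' (snd c p)))"
      using c p by (simp add: transition_eq)
    moreover have "(transition c c' has_field_derivative t) (at (snd c p))" unfolding t_def
      by (rule holomorphic_derivI[OF transition_holomorphic[OF c] open_overlap[OF c]]) (use p in auto)
    ultimately have "((\<lambda>z. in_chart c' L' (transition c c' z) $ i $ j) has_field_derivative deriv (\<lambda>w. in_chart c' L' w $ i $ j) (snd c' p) * t) (at (snd c p))"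
      by (rule DERIV_chain2)
    thus "((\<lambda>w. in_chart c L' w $ i $ j) has_field_derivative deriv (\<lambda>w. in_chart c' L' w $ i $ j) (snd c' p) * t) (at (snd c p))"
    proof (rule has_field_derivative_transform_within_open[OF _ open_overlap[OF c]])
      show "snd c p \<in> snd c ` (fst c \<inter> fst c')" using p by blast
      show "in_chart c' L' (transition c c' z) $ i $ j = in_chart c L' z $ i $ j" if "z \<in> snd c ` (fst c \<inter> fst c')" for z
        by (simp only: in_chart_trans[OF c that, of L'])
    qed
  qed
  hence 1: "differential L' c p = cscale t (differential L' c' p)"
    using c p by (simp add: differential_chart vec_eq_iff)
  have "\<L> c p $ i $ j = \<L> c' p $ i $ j * t" for i j
    using form_entry_rule[of i j] c p unfolding form_rule_def t_def by blast
  hence 2: "\<L> c p = cscale t (\<L> c' p)" by (simp add: vec_eq_iff)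
  show ?thesis
    unfolding lax_form_def 1 2 t_def[symmetric]
    by (simp add: cscale_mult_right trace_sub trace_cscale algebra_simps)
qed

lemma lax_form_meromorphic:
  assumes L: "L \<in> V" "L' \<in> V" shows "meromorphic_form A D (lax_form \<L> L L')"
  unfolding meromorphic_form_def
proof (intro conjI ballI)
  fix c assume c: "c \<in> A"
  let ?d = "lax_density (in_chart c L) (in_chart c L') (in_chart c (\<L> c))"
  have "?d holomorphic_on snd c ` (fst c - D)"
    by (intro lax_density_holomorphic entry_holomorphic form_entry_holomorphic open_chart_minus_D L c)
  thus "in_chart c (lax_form \<L> L L' c) holomorphic_on snd c ` (fst c - D)"
    by (rule holomorphic_transform) (use lax_form_chart[OF c] in auto)
  have "?d meromorphic_on chart_img c"
    by (intro lax_density_meromorphic entry_meromorphic form_entry_meromorphic L c)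
  moreover have "\<forall>\<^sub>F w in at z. in_chart c (lax_form \<L> L L' c) w = ?d w" if "z \<in> chart_img c" for z
    using eventually_at_in_open'[OF open_chart_img[OF c] that]
    by (rule eventually_mono) (rule lax_form_chart[OF c])
  ultimately show "in_chart c (lax_form \<L> L L' c) meromorphic_on chart_img c"
    by (subst meromorphic_on_cong) auto
next
  fix c c' p assume "c \<in> A" "c' \<in> A" "p \<in> fst c \<inter> fst c' - D"
  thus "lax_form \<L> L L' c p = lax_form \<L> L L' c' p * deriv (transition c c') (snd c p)"
    using L by (intro lax_form_chain_rule) auto
qed

lemma lax_form_order_cong:
  assumes "c \<in> A" "p \<in> fst c"
  shows "order_at_least m (in_chart c (lax_form \<L> L L' c)) (snd c p) \<longleftrightarrow>
    order_at_least m (lax_density (in_chart c L) (in_chart c L') (in_chart c (\<L> c))) (snd c p)"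
  by (rule order_at_least_cong, rule eventually_mono[OF eventually_chart_img[OF assms]])
     (rule lax_form_chart[OF assms(1)])

lemma lax_form_regular:
  assumes L: "L \<in> V" "L' \<in> V" and p: "p \<in> topspace X - {P, Q}"
  shows "form_regular_at A (lax_form \<L> L L') p"
  unfolding form_regular_at_def
proof
  fix c assume "c \<in> charts_at A p"
  hence c: "c \<in> A" "p \<in> fst c" by (auto simp: charts_at_def)
  show "order_at_least 0 (in_chart c (lax_form \<L> L L' c)) (snd c p)"
  proof (cases "p \<in> D")
    case False
    have "in_chart c (lax_form \<L> L L' c) holomorphic_on snd c ` (fst c - D)"
      using lax_form_meromorphic[OF L] c(1) unfolding meromorphic_form_def by blast
    hence "in_chart c (lax_form \<L> L L' c) analytic_on {snd c p}"
      using open_chart_minus_D[OF c(1)] c False by (auto simp: analytic_at)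
    thus ?thesis by (rule order_at_least_analytic)
  next
    case True
    then obtain s where s: "s \<in> S" "p = \<gamma> s" using p by (auto simp: sing_def)
    have lax: "lax_at A p (\<alpha> s) L" "lax_at A p (\<alpha> s) L'" using L s by (auto simp: lax_so_def)
    obtain N b k where 1: "simple_expansion (in_chart c L) (snd c p) (skew_outer (\<alpha> s) b) N" "bdot b (\<alpha> s) = 0" "N *v \<alpha> s = k *s \<alpha> s"
      by (rule lax_at_chart[OF lax(1) isotropic[OF s(1)] c]) (rule that)
    obtain N' b' k' where 2: "simple_expansion (in_chart c L') (snd c p) (skew_outer (\<alpha> s) b') N'" "bdot b' (\<alpha> s) = 0" "N' *v \<alpha> s = k' *s \<alpha> s"
      by (rule lax_at_chart[OF lax(2) isotropic[OF s(1)] c]) (rule that)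
    have lf: "lax_form_at A p (\<alpha> s) \<L>" using lax_form_at s by simp
    obtain K0 \<beta> k0 where 3: "simple_expansion (in_chart c (\<L> c)) (snd c p) (skew_outer (\<alpha> s) \<beta>) K0" "bdot \<beta> (\<alpha> s) = 1" "K0 *v \<alpha> s = k0 *s \<alpha> s"
      by (rule lax_form_at_chart[OF lf isotropic[OF s(1)] c finite_D form_entry_rule]) (rule that)
    have so: "\<forall>\<^sub>F z in at (snd c p). in_chart c M z \<in> so" if "M \<in> V" for M
      using that by (simp add: lax_so_def in_chart_def)
    have "p \<in> topspace X" using p by simp
    hence "\<forall>\<^sub>F z in at (snd c p). z \<in> snd c ` (fst c \<inter> topspace X - D)"
      by (intro eventually_chart_off[OF c finite_D]) auto
    \<comment> \<open>Skew-symmetry of \<L> is known only off \<open>D\<close>, so a punctured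
      neighbourhood that avoids \<open>D\<close> is needed.\<close>
    hence soL: "\<forall>\<^sub>F z in at (snd c p). in_chart c (\<L> c) z \<in> so"
    proof (rule eventually_mono)
      fix z assume "z \<in> snd c ` (fst c \<inter> topspace X - D)"
      then obtain q where "q \<in> fst c - D" "z = snd c q" by auto
      thus "in_chart c (\<L> c) z \<in> so" using so_form c(1) by (simp add: in_chart_eq so_form_def)
    qed
    have "order_at_least 0 (lax_density (in_chart c L) (in_chart c L') (in_chart c (\<L> c))) (snd c p)"
      unfolding lax_density_def [abs_def]
      by (rule lax_regular_germ[OF 1(1) 2(1) 3(1) isotropic[OF s(1)] 1(2) 2(2) 3(2) 1(3) 2(3) 3(3) so[OF L(1)] so[OF L(2)] soL])
    thus ?thesis using lax_form_order_cong[OF c] by blast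
  qed
qed

lemma chart_at_exists:
  assumes "p \<in> topspace X" obtains c where "c \<in> A" "p \<in> fst c"
proof -
  have "p \<in> (\<Union>c\<in>A. fst c)" unfolding charts_cover by (rule assms)
  thus ?thesis using that by blast
qed

text \<open>The same choice as in \<open>form_residue\<close>, so that the cocycle is a residue of
  germs in one fixed chart and the germ identities apply verbatim.\<close>

definition c0 :: "'a chart" where "c0 = (SOME c. c \<in> charts_at A P)"

lemma c0: "c0 \<in> A" "P \<in> fst c0"
proof -
  obtain c where "c \<in> A" "P \<in> fst c" by (rule chart_at_exists[OF P])
  hence "c \<in> charts_at A P" by (simp add: charts_at_def)
  hence "\<exists>c. c \<in> charts_at A P" by (rule exI)
  from someI_ex[OF this] show "c0 \<in> A" "P \<in> fst c0" by (auto simp: c0_def charts_at_def)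
qed

lemma lax_cocycle_eq:
  "lax_cocycle A P \<L> L L' = lax_residue (in_chart c0 L) (in_chart c0 L') (in_chart c0 (\<L> c0)) (snd c0 P)"
proof -
  have "lax_cocycle A P \<L> L L' = residue (in_chart c0 (lax_form \<L> L L' c0)) (snd c0 P)"
    by (simp add: lax_cocycle_def form_residue_def Let_def c0_def)
  also have "\<dots> = lax_residue (in_chart c0 L) (in_chart c0 L') (in_chart c0 (\<L> c0)) (snd c0 P)"
    unfolding lax_residue_def
    by (rule residue_cong, rule eventually_mono[OF eventually_chart_img[OF c0]])
       (simp_all add: lax_form_chart[OF c0(1)])
  finally show ?thesis .
qed

lemma lax_cocycle_two_cocycle: "two_cocycle V (lax_cocycle A P \<L>)"
proof -
  have chart: "in_chart c0 (\<lambda>p. Y p + Z p) = (\<lambda>z. in_chart c0 Y z + in_chart c0 Z z)"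
    "in_chart c0 (\<lambda>p. map_matrix ((*) a) (Y p)) = (\<lambda>z. cscale a (in_chart c0 Y z))"
    "in_chart c0 (\<lambda>p. lie (Y p) (Z p)) = (\<lambda>z. lie (in_chart c0 Y z) (in_chart c0 Z z))"
    for Y Z :: "'a \<Rightarrow> complex^'n^'n" and a
    by (simp_all add: in_chart_def [abs_def] cscale_def)
  note G = mat_mero_form_chart[OF c0]
  show ?thesis
    unfolding two_cocycle_def lax_cocycle_eq chart
    by (intro conjI ballI allI lax_residue_antisym[OF G] lax_residue_add_left[OF G] lax_residue_add_right[OF G]
        lax_residue_cscale_left[OF G] lax_residue_cscale_right[OF G] lax_residue_cocycle[OF G]
        mat_mero_chart[OF _ c0])
qed

lemma lax_cocycle_local: "local_form (lax_so_deg X A P Q S \<gamma> \<alpha> g) (lax_cocycle A P \<L>)"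
proof -
  obtain cQ where cQ: "cQ \<in> A" "Q \<in> fst cQ" by (rule chart_at_exists[OF Q])
  obtain nP :: nat where nP: "nP \<ge> 1" "\<And>i j. order_at_least (- int nP) (\<lambda>z. in_chart c0 (\<L> c0) z $ i $ j) (snd c0 P)"
    by (rule mat_mero_order[OF mat_mero_form_chart[OF c0]]) (rule that)
  obtain nQ :: nat where nQ: "nQ \<ge> 1" "\<And>i j. order_at_least (- int nQ) (\<lambda>z. in_chart cQ (\<L> cQ) z $ i $ j) (snd cQ Q)"
    by (rule mat_mero_order[OF mat_mero_form_chart[OF cQ]]) (rule that)
  have vanish: "lax_cocycle A P \<L> L L' = 0"
    if out: "\<not> (- int nQ - 2 * int g \<le> m + m' \<and> m + m' \<le> int nP)"
      and L: "L \<in> lax_so_deg X A P Q S \<gamma> \<alpha> g m" "L' \<in> lax_so_deg X A P Q S \<gamma> \<alpha> g m'" for m m' L L'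
  proof -
    have LV: "L \<in> V" "L' \<in> V" and ordP: "fun_order_at_least A m L P" "fun_order_at_least A m' L' P"
      and ordQ: "fun_order_at_least A (- m - int g) L Q" "fun_order_at_least A (- m' - int g) L' Q"
      using L by (auto simp: lax_so_deg_def)
    \<comment> \<open>Above the window the order at \<open>P\<close> is positive and there is no
      residue. Below it the order at \<open>Q\<close> is positive, since the degrees enter with the
      opposite sign and each contributes a further \<open>- g\<close>; then \<open>P\<close> is the
      only possible pole.\<close>
    consider "m + m' > int nP" | "m + m' < - int nQ - 2 * int g" using out by linarith
    thus ?thesis
    proof cases
      case 1
      have "order_at_least (m + m' - int nP) (lax_density (in_chart c0 L) (in_chart c0 L') (in_chart c0 (\<L> c0))) (snd c0 P)"
        by (intro lax_density_order nP fun_order_at_least_chart[OF ordP(1) c0] fun_order_at_least_chart[OF ordP(2) c0])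
      hence "order_at_least 0 (lax_density (in_chart c0 L) (in_chart c0 L') (in_chart c0 (\<L> c0))) (snd c0 P)"
        by (rule order_at_least_mono) (use 1 in simp)
      thus ?thesis unfolding lax_cocycle_eq lax_residue_def by (rule order_at_least_imp_residue_0)
    next
      case 2
      have "order_at_least ((- m - int g) + (- m' - int g) - int nQ) (lax_density (in_chart cQ L) (in_chart cQ L') (in_chart cQ (\<L> cQ))) (snd cQ Q)"
        by (intro lax_density_order nQ fun_order_at_least_chart[OF ordQ(1) cQ] fun_order_at_least_chart[OF ordQ(2) cQ])
      hence "order_at_least 0 (lax_density (in_chart cQ L) (in_chart cQ L') (in_chart cQ (\<L> cQ))) (snd cQ Q)"
        by (rule order_at_least_mono) (use 2 in simp)
      hence oQ: "order_at_least 0 (in_chart cQ (lax_form \<L> L L' cQ)) (snd cQ Q)"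
        using lax_form_order_cong[OF cQ] by blast
      have rule: "form_rule D (lax_form \<L> L L')"
        using lax_form_meromorphic[OF LV] unfolding meromorphic_form_def form_rule_def by (rule conjunct2)
      \<comment> \<open>The order was computed in one chart, while regularity refers to all charts
        at \<open>Q\<close>.\<close>
      have regQ: "form_regular_at A (lax_form \<L> L L') Q"
        unfolding form_regular_at_def charts_at_def
        using form_order_change_chart[OF _ cQ(1) _ cQ(2) finite_D rule oQ] by blast
      have "form_residue A (lax_form \<L> L L') P = 0"
      proof (rule residue_unique_pole_eq_0[OF compact P finite_D lax_form_meromorphic[OF LV]])
        fix p assume "p \<in> topspace X - {P}"
        thus "form_regular_at A (lax_form \<L> L L') p"
          using regQ lax_form_regular[OF LV, of p] by (cases "p = Q") auto
      qed
      thus ?thesis by (simp add: lax_cocycle_def)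
    qed
  qed
  show ?thesis unfolding local_form_def
    by (intro exI[of _ "- int nQ - 2 * int g"] exI[of _ "int nP"] allI impI ballI vanish)
qed

end

theorem theorem4p6:
  fixes X :: "'a topology"
    and A :: "'a chart set"
    and g :: nat
    and P Q :: 'a
    and \<gamma> :: "nat \<Rightarrow> 'a"
    and \<alpha> :: "nat \<Rightarrow> complex^'n"
    and S :: "nat set"
    and \<L> :: "('a, complex^'n^'n) form"
  assumes "riemann_surface X A" and "compact_space X" and "has_genus X g"
    and "P \<in> topspace X" and "Q \<in> topspace X" and "P \<noteq> Q"
    and S_def: "S = {1..CARD('n) * g}"
    and "inj_on \<gamma> S" and "\<gamma> ` S \<subseteq> topspace X - {P, Q}"
    and "\<And>s. s \<in> S \<Longrightarrow> \<alpha> s \<noteq> 0 \<and> bdot (\<alpha> s) (\<alpha> s) = 0"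
    and "so_form A (sing P Q S \<gamma>) \<L>"
    and "\<And>s. s \<in> S \<Longrightarrow> lax_form_at A (\<gamma> s) (\<alpha> s) \<L>"
  shows "(\<forall>L\<in>lax_so X A P Q S \<gamma> \<alpha>. \<forall>L'\<in>lax_so X A P Q S \<gamma> \<alpha>.
            meromorphic_form A (sing P Q S \<gamma>) (lax_form \<L> L L') \<and>
            (\<forall>p\<in>topspace X - {P, Q}. form_regular_at A (lax_form \<L> L L') p)) \<and>
         two_cocycle (lax_so X A P Q S \<gamma> \<alpha>) (lax_cocycle A P \<L>) \<and>
         local_form (lax_so_deg X A P Q S \<gamma> \<alpha> g) (lax_cocycle A P \<L>)"
proof -
  interpret lax_form_data X A P Q S \<gamma> \<alpha> \<L>
    by unfold_locales (use assms in \<open>auto simp: S_def\<close>)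
  show ?thesis
    using lax_form_meromorphic lax_form_regular lax_cocycle_two_cocycle lax_cocycle_local by blast
qed

end
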